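(* Let $d\ge2$ and $s\in(d/2,d/2+1)$. For each $N=2,3,4,\dots$ let $X_N^*$ be an $N$-point set on $\mathbb{S}^d$ that maximizes the generalized sum of Euclidean distances $$\sum_{j=1}^N\sum_{i=1}^N|\mathbf{x}_j-\mathbf{x}_i|^{2s-d}$$ over all $N$-point sets $\{\mathbf{x}_1,\dots,\mathbf{x}_N\}\subset\mathbb{S}^d$. Then $(X_N^* )$ is a sequence of QMC designs for $\mathbb{H}^s(\mathbb{S}^d)$.
   Context: $\mathbb{S}^d$ is the unit sphere in $\mathbb{R}^{d+1}$, $d\ge 2$, $|\cdot|$ is the Euclidean norm, and $\sigma_d$ is the normalized surface measure ($\sigma_d(\mathbb{S}^d)=1$). Let $\{Y_{\ell,k}:k=1,\dots,Z(d,\ell)\}$ be an $\mathbb{L}_2(\mathbb{S}^d,\sigma_d)$-orthonormal family of real spherical harmonics of exact degree $\ell$, where $Z(d,\ell)=(2\ell+d-1)\frac{\Gamma(\ell+d-1)}{\Gamma(d)\Gamma(\ell+1)}$, and let $\lambda_\ell=\ell(\ell+d-1)$, $\ell\ge 0$. For $f\in \mathbb{L}_2(\mathbb{S}^d)$ put $\widehat f_{\ell,k}=\int_{\mathbb{S}^d} f\,Y_{\ell,k}\,\mathrm{d}\sigma_d$. For $s>d/2$ the Sobolev space $\mathbb{H}^s(\mathbb{S}^d)$ is the set of $f\in \mathbb{L}_2(\mathbb{S}^d)$ with $\sum_{\ell=0}^\infty\sum_{k=1}^{Z(d,\ell)}(1+\lambda_\ell)^s|\widehat f_{\ell,k}|^2<\infty$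 (embedded in $C(\mathbb{S}^d)$), with norm $\|f\|_{\mathbb{H}^s}=\big[\sum_{\ell=0}^\infty\sum_{k=1}^{Z(d,\ell)}\frac{1}{a_\ell^{(s)}}|\widehat f_{\ell,k}|^2\big]^{1/2}$, where $(a_\ell^{(s)})_{\ell\ge0}$ is a fixed sequence of positive reals with $a_\ell^{(s)}\asymp(1+\lambda_\ell)^{-s}$ (all choices give equivalent norms, and the notion of QMC design does not depend on the choice). Here $a_n\asymp b_n$ means $c_1a_n\le b_n\le c_2a_n$ for all $n$ with positive constants $c_1,c_2$ independent of $n$. A sequence $(X_N)$ of $N$-point configurations on $\mathbb{S}^d$ is a sequence of QMC designs for $\mathbb{H}^s(\mathbb{S}^d)$ if there exists $c(s,d)>0$ independent of $N$ such that $$\sup_{f\in\mathbb{H}^s(\mathbb{S}^d),\ \|f\|_{\mathbb{H}^s}\le1}\Big|\frac1N\sum_{\mathbf{x}\in X_N}f(\mathbf{x})-\int_{\mathbb{S}^d}f\,\mathrm{d}\sigma_d\Big|\le\frac{c(s,d)}{N^{s/d}}.$$ *)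

theory Defs
  imports "HOL-Analysis.Analysis"
begin

text \<open>
  The sphere \<open>S^d\<close> is \<^term>\<open>sphere 0 1\<close> in a Euclidean space of dimension \<open>d + 1\<close>.
  Functions on it are functions on the ambient space of which only the values on the sphere
  are ever used.
\<close>

text \<open>
  Normalized surface measure, by polar coordinates: a Borel set \<open>A\<close> of the sphere has measure
  proportional to the volume of the cone \<open>{r x. x \<in> A, 0 < r < 1}\<close>. The origin, where
  \<^const>\<open>sgn\<close> leaves the sphere, is a null set.
\<close>

definition surface_measure :: "'a::euclidean_space measure" where
  "surface_measure =
     restrict_space (distr (uniform_measure lborel (ball 0 1)) borel sgn) (sphere 0 1)"

lemma space_surface_measure [simp]: "space surface_measure = sphere 0 1"
  by (simp add: surface_measure_def space_restrict_space)

lemma emeasure_surface_measure: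
  assumes A: "A \<in> sets borel" "A \<subseteq> sphere (0::'a::euclidean_space) 1"
  shows "emeasure surface_measure A =
    emeasure lborel {y \<in> ball 0 1. sgn y \<in> A} / emeasure lborel (ball (0::'a) 1)"
proof -
  have sgn: "(sgn :: 'a \<Rightarrow> 'a) \<in> borel_measurable borel"
    unfolding sgn_div_norm[abs_def] by measurable
  then have v: "sgn -` A \<in> sets (borel :: 'a measure)"
    using A by (metis measurable_sets_borel)
  have "emeasure surface_measure A =
      emeasure (distr (uniform_measure lborel (ball (0::'a) 1)) borel sgn) A"
    unfolding surface_measure_def using A by (intro emeasure_restrict_space) auto
  also have "\<dots> = emeasure (uniform_measure lborel (ball (0::'a) 1)) (sgn -` A)"
    using A sgn by (subst emeasure_distr) (auto simp: measurable_def)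
  also have "\<dots> = emeasure lborel (ball (0::'a) 1 \<inter> sgn -` A) / emeasure lborel (ball (0::'a) 1)"
    using v by (intro emeasure_uniform_measure) auto
  also have "ball 0 1 \<inter> sgn -` A = {y \<in> ball 0 1. sgn y \<in> A}"
    by auto
  finally show ?thesis .
qed

lemma emeasure_surface_measure_sphere:
  "emeasure surface_measure (sphere (0::'a::euclidean_space) 1) = 1"
proof -
  have "{y \<in> ball 0 1. sgn y \<in> sphere (0::'a) 1} = ball 0 1 - {0}"
    by (auto simp: norm_sgn split: if_splits)
  moreover have "emeasure lborel (ball (0::'a) 1 - {0}) = emeasure lborel (ball (0::'a) 1)"
    by (intro emeasure_Diff_null_set) auto
  moreover have "emeasure lborel (ball (0::'a) 1) \<noteq> 0"
  proof
    assume "emeasure lborel (ball (0::'a) 1) = 0"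
    then have "negligible (ball (0::'a) 1)"
      by (auto simp: negligible_iff_null_sets null_sets_def)
    then show False
      using open_not_negligible[of "ball (0::'a) 1"] by auto
  qed
  moreover have "emeasure lborel (ball (0::'a) 1) \<noteq> \<infinity>"
    using emeasure_lborel_ball_finite[of "0::'a" 1] by auto
  ultimately show ?thesis
    by (subst emeasure_surface_measure) (auto simp: ennreal_divide_self top.not_eq_extremum)
qed

definition laplacian :: "('a::euclidean_space \<Rightarrow> real) \<Rightarrow> 'a \<Rightarrow> real" where
  "laplacian p x = (\<Sum>b\<in>Basis. (deriv ^^ 2) (\<lambda>t. p (x + t *\<^sub>R b)) 0)"

definition spherical_harmonic :: "nat \<Rightarrow> ('a::euclidean_space \<Rightarrow> real) \<Rightarrow> bool" where
  "spherical_harmonic l f \<longleftrightarrow>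
     (\<exists>p. real_polynomial_function p \<and>
          (\<forall>c x. p (c *\<^sub>R x) = c ^ l * p x) \<and>
          (\<forall>x. laplacian p x = 0) \<and>
          (\<forall>x\<in>sphere 0 1. f x = p x))"

text \<open>The number \<open>Z(d,l)\<close>; the real expression is a natural number for \<open>d \<ge> 2\<close> (shown below).\<close>

definition harmonic_dim :: "nat \<Rightarrow> nat \<Rightarrow> nat" where
  "harmonic_dim d l =
     nat \<lfloor>(2 * real l + real d - 1) * (Gamma (real l + real d - 1) / (Gamma (real d) * Gamma (real l + 1)))\<rfloor>"

lemma harmonic_dim_eq:
  assumes "d \<ge> 2"
  shows "real (harmonic_dim d l) =
    (2 * real l + real d - 1) * (Gamma (real l + real d - 1) / (Gamma (real d) * Gamma (real l + 1)))"
proof -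
  define n where "n = d - 2"
  have d: "d = n + 2" using assms by (simp add: n_def)
  have G: "Gamma (real l + real d - 1) = fact (l + n)" "Gamma (real d) = fact (n + 1)"
      "Gamma (real l + 1) = fact l"
    using Gamma_fact[of "l + n", where 'a = real] Gamma_fact[of "n + 1", where 'a = real]
      Gamma_fact[of l, where 'a = real]
    by (simp_all add: d add_ac)
  have "(2 * real l + real d - 1) * (fact (l + n) / (fact (n + 1) * fact l)) =
      real ((l + n + 1) choose l) + real (if l = 0 then 0 else (l + n) choose (l - 1))"
  proof (cases l)
    case 0
    have "real n + 1 \<noteq> 0" by linarith
    then have "(real n + 1) * (fact n / ((real n + 1) * fact n)) = 1" by simp
    then show ?thesis using 0 by (simp add: d add_ac)
  next
    case (Suc m)
    have 1: "real ((l + n + 1) choose l) = fact (l + n + 1) / (fact l * fact (n + 1))"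
      by (simp add: binomial_fact)
    have 2: "real ((l + n) choose (l - 1)) = fact (l + n) / (fact (l - 1) * fact (n + 1))"
      using Suc by (simp add: binomial_fact)
    have 3: "(fact l :: real) = real l * fact (l - 1)"
      using Suc by simp
    have 4: "(fact (l + n + 1) :: real) = (real l + real n + 1) * fact (l + n)"
      by (simp add: add_ac)
    have alg: "(2 * x + z) * (A / (B * (x * C))) = (x + z) * A / (x * C * B) + A / (C * B)"
      if "x \<noteq> 0" "B \<noteq> 0" "C \<noteq> 0" for x z A B C :: real
      using that by (simp add: divide_simps) (simp add: algebra_simps)
    have "(2 * real l + (real n + 1)) * (fact (l + n) / (fact (n + 1) * (real l * fact (l - 1)))) =
        (real l + (real n + 1)) * fact (l + n) / (real l * fact (l - 1) * fact (n + 1)) +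
        fact (l + n) / (fact (l - 1) * fact (n + 1))"
      using Suc by (intro alg) (simp_all del: fact_Suc)
    moreover have "2 * real l + real d - 1 = 2 * real l + (real n + 1)"
      by (simp add: d)
    moreover have "real (if l = 0 then 0 else (l + n) choose (l - 1)) =
        fact (l + n) / (fact (l - 1) * fact (n + 1))"
      using 2 Suc by simp
    ultimately show ?thesis
      unfolding 1 4 3 by (simp only: add.assoc)
  qed
  then obtain m :: nat where m:
    "(2 * real l + real d - 1) * (fact (l + n) / (fact (n + 1) * fact l)) = real m"
    by (metis of_nat_add)
  show ?thesis
    unfolding harmonic_dim_def G m by simp
qed

definition orthonormal_harmonics ::
    "nat \<Rightarrow> (nat \<Rightarrow> nat \<Rightarrow> 'a::euclidean_space \<Rightarrow> real) \<Rightarrow> bool" where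
  "orthonormal_harmonics d Y \<longleftrightarrow>
     (\<forall>l. \<forall>k\<in>{1..harmonic_dim d l}. spherical_harmonic l (Y l k)) \<and>
     (\<forall>l l'. \<forall>k\<in>{1..harmonic_dim d l}. \<forall>k'\<in>{1..harmonic_dim d l'}.
        (LINT x|surface_measure. Y l k x * Y l' k' x) = (if l = l' \<and> k = k' then 1 else 0))"

definition eigval :: "nat \<Rightarrow> nat \<Rightarrow> real" where
  "eigval d l = real l * (real l + real d - 1)"

definition L2_sphere :: "('a::euclidean_space \<Rightarrow> real) set" where
  "L2_sphere = {f \<in> borel_measurable surface_measure. integrable surface_measure (\<lambda>x. (f x)\<^sup>2)}"

definition sphere_coeff ::
    "(nat \<Rightarrow> nat \<Rightarrow> 'a::euclidean_space \<Rightarrow> real) \<Rightarrow> ('a \<Rightarrow> real) \<Rightarrow> nat \<Rightarrow> nat \<Rightarrow> real" where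
  "sphere_coeff Y f l k = (LINT x|surface_measure. f x * Y l k x)"

text \<open>
  For \<open>s > d/2\<close> every class in the Sobolev space has exactly one continuous representative; the
  space is taken inside \<open>C(S^d)\<close>, so that point evaluation makes sense.
\<close>

definition sobolev_space ::
    "nat \<Rightarrow> real \<Rightarrow> (nat \<Rightarrow> nat \<Rightarrow> 'a::euclidean_space \<Rightarrow> real) \<Rightarrow> ('a \<Rightarrow> real) set" where
  "sobolev_space d s Y =
     {f \<in> L2_sphere. continuous_on (sphere 0 1) f \<and>
        summable (\<lambda>l. \<Sum>k=1..harmonic_dim d l.
          (1 + eigval d l) powr s * \<bar>sphere_coeff Y f l k\<bar>\<^sup>2)}"

definition comparable :: "(nat \<Rightarrow> real) \<Rightarrow> (nat \<Rightarrow> real) \<Rightarrow> bool" where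
  "comparable a b \<longleftrightarrow> (\<exists>c1>0. \<exists>c2>0. \<forall>n. c1 * a n \<le> b n \<and> b n \<le> c2 * a n)"

definition sobolev_norm ::
    "nat \<Rightarrow> (nat \<Rightarrow> real) \<Rightarrow> (nat \<Rightarrow> nat \<Rightarrow> 'a::euclidean_space \<Rightarrow> real) \<Rightarrow> ('a \<Rightarrow> real) \<Rightarrow> real" where
  "sobolev_norm d a Y f =
     sqrt (\<Sum>l. \<Sum>k=1..harmonic_dim d l. 1 / a l * \<bar>sphere_coeff Y f l k\<bar>\<^sup>2)"

text \<open>The supremum is taken in the extended reals: a real \<^const>\<open>Sup\<close> of an unbounded set is junk.\<close>

definition worst_case_error ::
    "nat \<Rightarrow> real \<Rightarrow> (nat \<Rightarrow> real) \<Rightarrow> (nat \<Rightarrow> nat \<Rightarrow> 'a::euclidean_space \<Rightarrow> real) \<Rightarrow> 'a set \<Rightarrow> ereal" where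
  "worst_case_error d s a Y X =
     (SUP f\<in>{f \<in> sobolev_space d s Y. sobolev_norm d a Y f \<le> 1}.
        ereal \<bar>1 / real (card X) * (\<Sum>x\<in>X. f x) - (LINT x|surface_measure. f x)\<bar>)"

definition point_set :: "nat \<Rightarrow> 'a::euclidean_space set \<Rightarrow> bool" where
  "point_set N X \<longleftrightarrow> finite X \<and> card X = N \<and> X \<subseteq> sphere 0 1"

text \<open>\<open>I\<close> is the set of cardinalities over which the sequence runs.\<close>

definition QMC_designs ::
    "nat \<Rightarrow> real \<Rightarrow> (nat \<Rightarrow> real) \<Rightarrow> (nat \<Rightarrow> nat \<Rightarrow> 'a::euclidean_space \<Rightarrow> real) \<Rightarrow>
     nat set \<Rightarrow> (nat \<Rightarrow> 'a set) \<Rightarrow> bool" where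
  "QMC_designs d s a Y I X \<longleftrightarrow>
     (\<forall>N\<in>I. point_set N (X N)) \<and>
     (\<exists>c>0. \<forall>N\<in>I. worst_case_error d s a Y (X N) \<le> ereal (c / real N powr (s / real d)))"

definition distance_sum :: "real \<Rightarrow> 'a::euclidean_space set \<Rightarrow> real" where
  "distance_sum p X = (\<Sum>x\<in>X. \<Sum>y\<in>X. norm (x - y) powr p)"

definition maximizes_distance_sum :: "real \<Rightarrow> nat \<Rightarrow> 'a::euclidean_space set \<Rightarrow> bool" where
  "maximizes_distance_sum p N X \<longleftrightarrow>
     point_set N X \<and> (\<forall>X'::'a set. point_set N X' \<longrightarrow> distance_sum p X' \<le> distance_sum p X)"

end

theory Submission
  imports Defs
begin

text \<open>
  Write \<open>p = 2 s - d\<close>, which lies in \<open>(0, 2)\<close>, let \<open>V\<close> be the mean of \<open>|x - y|\<^sup>p\<close> over the sphere and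
  \<open>S(X)\<close> the sum of distances of an \<open>N\<close>-point set \<open>X\<close>. The proof compares everything with the
  nonnegative number \<open>V - S(X) / N\<^sup>2\<close>, called the energy gap of \<open>X\<close>: its square root dominates the
  quadrature error uniformly over the unit ball of the Sobolev space, and some \<open>N\<close>-point set has a
  gap of order \<open>N\<close> to the power \<open>-2 s / d\<close>. A maximizer of \<open>S\<close> has the smallest gap, so its
  worst-case error is of order \<open>N\<close> to the power \<open>-s / d\<close>.

  The gap dominates the error because \<open>|x - y|\<^sup>p\<close> is a superposition of Poisson kernels
  \<open>P\<^sub>r(x, y)\<close>, that is, \<open>1 - r\<^sup>2\<close> divided by the \<open>(d + 1)\<close>-th power of \<open>|r x - y|\<close>. With \<open>v = r / (1 - r)\<^sup>2\<close> the normalized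
  kernel \<open>P\<^sub>r(x, y) / P\<^sub>r(x, x)\<close> is the function \<open>1 + v |x - y|\<^sup>2\<close> to the power \<open>-(d + 1) / 2\<close>
  (\<open>poisson_profile_eq\<close>), and by scaling \<open>c |x - y|\<^sup>p\<close> is the integral over \<open>v > 0\<close> of one minus that
  function against \<open>v\<close> to the power \<open>-p / 2 - 1\<close> (\<open>dist_density_integral\<close>). Hence the gap is a
  positive superposition of the quantities \<open>N\<^sup>-\<^sup>2 \<Sum>\<Sum> P\<^sub>r(x, y) - 1\<close>. Each of them is at least
  \<open>\<Sum> r\<^sup>l e\<^sub>l\<^sub>k\<^sup>2\<close> over \<open>l \<ge> 1\<close>, with \<open>e\<^sub>l\<^sub>k\<close> the quadrature error of the harmonic \<open>Y\<^sub>l\<^sub>k\<close>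
  (\<open>poisson_energy_ge\<close>). For \<open>v\<close> of order \<open>l\<^sup>2\<close> the number \<open>1 - r\<close> is of order \<open>1 / l\<close>, and integrating
  over such \<open>v\<close> gives \<open>e\<^sub>l\<^sub>k\<^sup>2\<close> the weight \<open>l\<close> to the power \<open>-2 s\<close> (\<open>energy_gap_ge\<close>). The
  Cauchy-Schwarz inequality against the Sobolev norm finishes this half (\<open>quad_err_le_energy_gap\<close>).

  What this requires of the spherical harmonics comes from the Poisson formula, a consequence of the
  maximum principle: it shows that \<open>Y\<^sub>l\<^sub>k\<close> is an eigenfunction of \<open>P\<^sub>r\<close> with eigenvalue \<open>r\<^sup>l\<close> and that
  the kernels form a semigroup. Completeness is a trace computation: the mean of \<open>P\<^sub>r(x, y)\<^sup>2\<close> is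
  \<open>(1 + r\<^sup>2) / (1 - r\<^sup>2)\<^sup>d\<close>, and this is exactly \<open>\<Sum> Z(d, l) r\<^sup>2\<^sup>l\<close>, so that Bessel's inequality for the
  kernel in the given orthonormal family is an equality.

  For the existence of a good point set, the uniform distribution is written as an average of \<open>N\<close>
  probability densities \<open>w\<^sub>1, \<dots>, w\<^sub>N\<close>, most of them supported in cells of diameter of order \<open>N\<close> to
  the power \<open>-1 / d\<close> (\<open>uniform_as_unit_densities\<close>). Choosing the \<open>i\<close>-th point according to \<open>w\<^sub>i\<close>, the
  expected value of \<open>S\<close> falls short of \<open>N\<^sup>2 V\<close> by the self-energies of the densities alone. These sum
  to the order of \<open>N\<close> to the power \<open>1 - p / d\<close>; here \<open>p < 2 \<le> d\<close> makes the contributions of the coarse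
  scales a convergent geometric series.
\<close>

section \<open>Integration on the sphere\<close>

abbreviation \<sigma> :: "'a::euclidean_space measure" where
  "\<sigma> \<equiv> surface_measure"

lemma sets_surface_measure:
  "sets (\<sigma> :: 'a::euclidean_space measure) = sets (restrict_space borel (sphere 0 1))"
  unfolding surface_measure_def by (rule sets_restrict_space_cong) simp

lemma measurable_surface_measure:
  "measurable (\<sigma> :: 'a::euclidean_space measure) N = measurable (restrict_space borel (sphere 0 1)) N"
  by (rule measurable_cong_sets) (simp_all add: sets_surface_measure)

lemma borel_measurable_surface:
  "f \<in> measurable borel N \<Longrightarrow> f \<in> measurable (\<sigma> :: 'a::euclidean_space measure) N"
  by (simp add: measurable_surface_measure measurable_restrict_space1)

interpretation surface: finite_measure "\<sigma> :: 'a::euclidean_space measure"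
  by standard (simp add: emeasure_surface_measure_sphere)

lemma measure_surface_sphere [simp]: "measure (\<sigma> :: 'a::euclidean_space measure) (sphere 0 1) = 1"
  by (simp add: measure_def emeasure_surface_measure_sphere)

lemma continuous_measurable_surface:
  fixes f :: "'a::euclidean_space \<Rightarrow> 'b::topological_space"
  assumes "continuous_on (sphere 0 1) f"
  shows "f \<in> borel_measurable \<sigma>"
  unfolding measurable_surface_measure by (rule borel_measurable_continuous_on_restrict[OF assms])

lemma integrable_bounded_surface:
  fixes f :: "'a::euclidean_space \<Rightarrow> real"
  assumes "f \<in> borel_measurable \<sigma>" and "\<And>x. x \<in> sphere 0 1 \<Longrightarrow> \<bar>f x\<bar> \<le> B"
  shows "integrable \<sigma> f"
  using assms by (intro surface.integrable_const_bound[of _ B]) (auto intro!: AE_I2)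

lemma bounded_continuous_sphere:
  fixes f :: "'a::euclidean_space \<Rightarrow> real"
  assumes "continuous_on (sphere 0 1) f"
  obtains B where "B > 0" "\<And>x. x \<in> sphere 0 1 \<Longrightarrow> \<bar>f x\<bar> \<le> B"
proof -
  have "bounded (f ` sphere 0 1)"
    by (intro compact_imp_bounded compact_continuous_image assms) simp
  then show ?thesis using that by (auto simp: bounded_pos)
qed

lemma integrable_continuous_surface:
  fixes f :: "'a::euclidean_space \<Rightarrow> real"
  assumes "continuous_on (sphere 0 1) f"
  shows "integrable \<sigma> f"
  using assms by (metis bounded_continuous_sphere integrable_bounded_surface continuous_measurable_surface)

lemma abs_integral_surface_le:
  fixes f :: "'a::euclidean_space \<Rightarrow> real"
  assumes "f \<in> borel_measurable \<sigma>" and "\<And>x. x \<in> sphere 0 1 \<Longrightarrow> \<bar>f x\<bar> \<le> B"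
  shows "\<bar>LINT x|\<sigma>. f x\<bar> \<le> B"
proof -
  have "\<bar>LINT x|\<sigma>. f x\<bar> \<le> (LINT x|\<sigma>. \<bar>f x\<bar>)"
    by (rule integral_abs_bound)
  also have "\<dots> \<le> (LINT x|(\<sigma>::'a measure). B)"
    using assms by (intro integral_mono integrable_abs integrable_bounded_surface[of f B]) auto
  finally show ?thesis by simp
qed

lemma Cauchy_Schwarz_integral:
  fixes f g :: "'b \<Rightarrow> real"
  assumes f: "integrable M (\<lambda>x. (f x)\<^sup>2)" and g: "integrable M (\<lambda>x. (g x)\<^sup>2)"
    and fg: "integrable M (\<lambda>x. f x * g x)"
  shows "(LINT x|M. f x * g x)\<^sup>2 \<le> (LINT x|M. (f x)\<^sup>2) * (LINT x|M. (g x)\<^sup>2)"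
proof -
  define F G H where "F = (LINT x|M. (f x)\<^sup>2)" and "G = (LINT x|M. (g x)\<^sup>2)"
    and "H = (LINT x|M. f x * g x)"
  have q: "0 \<le> F + 2 * t * H + t\<^sup>2 * G" for t
  proof -
    have "0 \<le> (LINT x|M. (f x + t * g x)\<^sup>2)" by simp
    also have "(\<lambda>x. (f x + t * g x)\<^sup>2) = (\<lambda>x. (f x)\<^sup>2 + 2 * t * (f x * g x) + t\<^sup>2 * (g x)\<^sup>2)"
      by (auto simp: power2_eq_square algebra_simps)
    also have "(LINT x|M. (f x)\<^sup>2 + 2 * t * (f x * g x) + t\<^sup>2 * (g x)\<^sup>2) = F + 2 * t * H + t\<^sup>2 * G"
      using assms by (simp add: F_def G_def H_def)
    finally show ?thesis .
  qed
  have "F \<ge> 0" "G \<ge> 0" by (simp_all add: F_def G_def)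
  have "H\<^sup>2 \<le> F * G"
  proof (cases "G = 0")
    case True
    have "H = 0"
    \<comment> \<open>A line with nonzero slope takes the value \<open>-1\<close>.\<close>
    proof (rule ccontr)
      assume "H \<noteq> 0"
      then have "F + 2 * (- (F + 1) / (2 * H)) * H = -1"
        by (simp add: field_simps)
      with q[of "- (F + 1) / (2 * H)"] True show False by simp
    qed
    then show ?thesis using True by simp
  next
    case False
    with \<open>G \<ge> 0\<close> have "G > 0" by simp
    then have "F + 2 * (- H / G) * H + (- H / G)\<^sup>2 * G = F - H\<^sup>2 / G"
      by (simp add: power2_eq_square field_simps)
    with q[of "- H / G"] have "H\<^sup>2 / G \<le> F" by linarith
    then show ?thesis using \<open>G > 0\<close> by (simp add: pos_divide_le_eq)
  qed
  then show ?thesis by (simp add: F_def G_def H_def)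
qed

text \<open>
  Dominated convergence along every sequence, which suffices because the parameter space is first
  countable. It is used with points \<open>x\<close> of the ball and with step sizes \<open>h\<close> as parameters.
\<close>

lemma tendsto_integral_surface:
  fixes k :: "'b::first_countable_topology \<Rightarrow> 'a::euclidean_space \<Rightarrow> real"
  assumes lim: "\<And>z. z \<in> sphere 0 1 \<Longrightarrow> ((\<lambda>x. k x z) \<longlongrightarrow> l z) (at a within A)"
    and meas: "\<And>x. x \<in> A - {a} \<Longrightarrow> k x \<in> borel_measurable \<sigma>"
    and bound: "\<And>x z. x \<in> A - {a} \<Longrightarrow> z \<in> sphere 0 1 \<Longrightarrow> \<bar>k x z\<bar> \<le> B"
    and measl: "l \<in> borel_measurable \<sigma>"
  shows "((\<lambda>x. LINT z|\<sigma>. k x z) \<longlongrightarrow> (LINT z|\<sigma>. l z)) (at a within A)"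
  unfolding tendsto_at_iff_sequentially comp_def
proof (intro allI impI)
  fix X :: "nat \<Rightarrow> 'b" assume X: "\<forall>i. X i \<in> A - {a}" "X \<longlonglongrightarrow> a"
  show "(\<lambda>n. LINT z|\<sigma>. k (X n) z) \<longlonglongrightarrow> (LINT z|\<sigma>. l z)"
  proof (rule integral_dominated_convergence[where w = "\<lambda>_. B"])
    show "AE z in \<sigma>. (\<lambda>n. k (X n) z) \<longlonglongrightarrow> l z"
      using lim X by (intro AE_I2) (auto simp: tendsto_at_iff_sequentially comp_def)
    show "AE z in \<sigma>. norm (k (X n) z) \<le> B" for n
      using bound X by (intro AE_I2) auto
  qed (use meas measl X in auto)
qed

lemma continuous_on_integral_surface:
  fixes k :: "'b::first_countable_topology \<Rightarrow> 'a::euclidean_space \<Rightarrow> real"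
  assumes lim: "\<And>z. z \<in> sphere 0 1 \<Longrightarrow> continuous_on A (\<lambda>x. k x z)"
    and meas: "\<And>x. x \<in> A \<Longrightarrow> k x \<in> borel_measurable \<sigma>"
    and bound: "\<And>x z. x \<in> A \<Longrightarrow> z \<in> sphere 0 1 \<Longrightarrow> \<bar>k x z\<bar> \<le> B"
  shows "continuous_on A (\<lambda>x. LINT z|\<sigma>. k x z)"
  unfolding continuous_on_def
  using assms by (intro ballI tendsto_integral_surface[where B = B]) (auto simp: continuous_on_def)

lemma translation_invariant_nn_integral_lborel:
  fixes f :: "'a::euclidean_space \<Rightarrow> ennreal"
  assumes [measurable]: "f \<in> borel_measurable borel"
  shows "(\<integral>\<^sup>+x. f (t + x) \<partial>lborel) = (\<integral>\<^sup>+x. f x \<partial>lborel)"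
    and "(\<integral>\<^sup>+x. f (t - x) \<partial>lborel) = (\<integral>\<^sup>+x. f x \<partial>lborel)"
proof -
  have "(\<integral>\<^sup>+x. f x \<partial>lborel) = (\<integral>\<^sup>+x. f x \<partial>(density (distr lborel borel (\<lambda>x. t + c *\<^sub>R x)) (\<lambda>_. \<bar>c\<bar>^DIM('a))))"
    if "c \<noteq> 0" for c
    using lborel_affine[OF that, of t] by simp
  note * = this
  have *: "(\<integral>\<^sup>+x. f x \<partial>lborel) = (\<integral>\<^sup>+x. f (t + c *\<^sub>R x) \<partial>lborel)" if "\<bar>c\<bar> = 1" for c
  proof -
    have "c \<noteq> 0" using that by auto
    from *[OF this] show ?thesis
      using that by (subst (asm) nn_integral_density) (auto simp: nn_integral_distr)
  qed
  show "(\<integral>\<^sup>+x. f (t + x) \<partial>lborel) = (\<integral>\<^sup>+x. f x \<partial>lborel)"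
    and "(\<integral>\<^sup>+x. f (t - x) \<partial>lborel) = (\<integral>\<^sup>+x. f x \<partial>lborel)"
    using *[of 1] *[of "-1"] by simp_all
qed

lemma orthogonal_transformation_borel_measurable:
  fixes U :: "'a::euclidean_space \<Rightarrow> 'a"
  assumes "orthogonal_transformation U"
  shows "U \<in> borel_measurable borel"
  using orthogonal_transformation_linear[OF assms]
  by (intro borel_measurable_continuous_onI linear_continuous_on) (auto simp: linear_conv_bounded_linear)

lemma orthogonal_transformation_measurable_surface:
  fixes U :: "'a::euclidean_space \<Rightarrow> 'a"
  assumes "orthogonal_transformation U"
  shows "U \<in> measurable \<sigma> \<sigma>"
  unfolding measurable_surface_measure
  by (subst measurable_cong_sets[OF refl sets_surface_measure], rule measurable_restrict_space3)
    (auto simp: orthogonal_transformation_norm[OF assms] orthogonal_transformation_borel_measurable[OF assms])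

text \<open>
  The image measure \<open>\<mu>\<close> of Lebesgue measure \<open>\<lambda>\<close> is again translation invariant. Evaluating
  \<open>\<integral>\<integral> 1\<^sub>A(x) 1\<^sub>B(y - x) \<lambda>(dx) \<mu>(dy)\<close> in both orders gives \<open>\<lambda>(A) \<mu>(B) = \<lambda>(B) \<mu>(A)\<close>, and for the
  unit ball \<open>B\<close>, which the isometry maps to itself, the factors \<open>\<mu>(B) = \<lambda>(B)\<close> cancel.
\<close>

lemma lborel_orthogonal_invariant:
  fixes U :: "'a::euclidean_space \<Rightarrow> 'a"
  assumes U: "orthogonal_transformation U"
  shows "distr lborel borel U = lborel"
proof (rule measure_eqI)
  have lin: "linear U" using U by (rule orthogonal_transformation_linear)
  note [measurable] = orthogonal_transformation_borel_measurable[OF U]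
  fix A :: "'a set" assume "A \<in> sets (distr lborel borel U)"
  then have [measurable]: "A \<in> sets borel" by simp
  define B :: "'a set" where "B = ball 0 1"
  have [measurable]: "B \<in> sets borel" by (simp add: B_def)
  have surj: "surj U" using U by (rule orthogonal_transformation_surj)
  have trans: "(\<integral>\<^sup>+y. f (U y - x) \<partial>lborel) = (\<integral>\<^sup>+y. f (U y) \<partial>lborel)"
    if [measurable]: "f \<in> borel_measurable borel" for f :: "'a \<Rightarrow> ennreal" and x
  proof -
    obtain w where w: "U w = x" using surj by (metis surjD)
    have "(\<integral>\<^sup>+y. f (U y - x) \<partial>lborel) = (\<integral>\<^sup>+y. f (U (- w + y)) \<partial>lborel)"
      using w by (simp add: linear_diff[OF lin])
    also have "\<dots> = (\<integral>\<^sup>+y. f (U y) \<partial>lborel)"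
      by (rule translation_invariant_nn_integral_lborel(1)) measurable
    finally show ?thesis .
  qed
  have refl: "(\<integral>\<^sup>+x. indicator A x * indicator B (y - x) \<partial>lborel) =
      (\<integral>\<^sup>+x. indicator A (y - x) * (indicator B x :: ennreal) \<partial>lborel)" for y
    using translation_invariant_nn_integral_lborel(2)[of "\<lambda>x. indicator A (y - x) * indicator B x" y]
    by simp
  have UB: "indicator B (U y) = (indicator B y :: ennreal)" for y
    using orthogonal_transformation_norm[OF U] by (simp add: B_def indicator_def)
  have "emeasure lborel A * emeasure lborel B =
      (\<integral>\<^sup>+x. indicator A x * (\<integral>\<^sup>+y. indicator B (U y) \<partial>lborel) \<partial>lborel)"
    by (simp add: UB nn_integral_multc)
  also have "\<dots> = (\<integral>\<^sup>+x. \<integral>\<^sup>+y. indicator A x * indicator B (U y - x) \<partial>lborel \<partial>lborel)"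
    by (simp add: nn_integral_cmult trans)
  also have "\<dots> = (\<integral>\<^sup>+y. \<integral>\<^sup>+x. indicator A x * indicator B (U y - x) \<partial>lborel \<partial>lborel)"
    by (rule lborel_pair.Fubini') measurable
  also have "\<dots> = (\<integral>\<^sup>+y. \<integral>\<^sup>+x. indicator A (U y - x) * indicator B x \<partial>lborel \<partial>lborel)"
    by (simp add: refl)
  also have "\<dots> = (\<integral>\<^sup>+x. \<integral>\<^sup>+y. indicator A (U y - x) * indicator B x \<partial>lborel \<partial>lborel)"
    by (rule lborel_pair.Fubini') measurable
  also have "\<dots> = (\<integral>\<^sup>+x. (\<integral>\<^sup>+y. indicator A (U y) \<partial>lborel) * indicator B x \<partial>lborel)"
    by (simp add: nn_integral_multc trans)
  also have "(\<integral>\<^sup>+y. indicator A (U y) \<partial>lborel) = emeasure (distr lborel borel U) A"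
  proof -
    have "emeasure (distr lborel borel U) A = (\<integral>\<^sup>+y. indicator A y \<partial>distr lborel borel U)"
      by (rule nn_integral_indicator[symmetric]) simp
    also have "\<dots> = (\<integral>\<^sup>+y. indicator A (U y) \<partial>lborel)"
      by (rule nn_integral_distr) measurable
    finally show ?thesis by simp
  qed
  finally have "emeasure lborel A * emeasure lborel B = emeasure (distr lborel borel U) A * emeasure lborel B"
    by (simp add: nn_integral_cmult)
  moreover have "emeasure lborel B \<noteq> 0"
    using open_not_negligible[of B] by (auto simp: B_def negligible_iff_null_sets null_sets_def)
  moreover have "emeasure lborel B \<noteq> \<infinity>"
    using emeasure_lborel_ball_finite[of "0::'a" 1] by (auto simp: B_def)
  ultimately show "emeasure (distr lborel borel U) A = emeasure lborel A"
    by (auto simp: mult.commute[of _ "emeasure lborel B"] ennreal_mult_cancel_left)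
qed simp

lemma surface_measure_orthogonal_invariant:
  fixes U :: "'a::euclidean_space \<Rightarrow> 'a"
  assumes U: "orthogonal_transformation U"
  shows "distr \<sigma> \<sigma> U = \<sigma>"
proof (rule measure_eqI)
  have lin: "linear U" using U by (rule orthogonal_transformation_linear)
  note Ub [measurable] = orthogonal_transformation_borel_measurable[OF U]
  have sgnb [measurable]: "(sgn :: 'a \<Rightarrow> 'a) \<in> borel_measurable borel"
    unfolding sgn_div_norm[abs_def] by measurable
  have norm: "norm (U x) = norm x" for x using U by (rule orthogonal_transformation_norm)
  note US = orthogonal_transformation_measurable_surface[OF U]
  fix A :: "'a set" assume "A \<in> sets (distr \<sigma> \<sigma> U)"
  then have A: "A \<in> sets borel" "A \<subseteq> sphere 0 1"
    by (auto simp: sets_surface_measure sets_restrict_space)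
  have A': "U -` A \<in> sets borel" "U -` A \<subseteq> sphere 0 1"
    using measurable_sets_borel[OF Ub A(1)] A(2) by (auto simp: norm subset_iff) 
  have m: "{y \<in> ball 0 1. sgn y \<in> A} \<in> sets borel" using A by measurable
  have "emeasure (distr \<sigma> \<sigma> U) A = emeasure \<sigma> (U -` A)"
    using A US A' by (subst emeasure_distr) (auto simp: sets_surface_measure sets_restrict_space Int_absorb2)
  also have "\<dots> = emeasure lborel {y \<in> ball 0 1. sgn y \<in> U -` A} / emeasure lborel (ball (0::'a) 1)"
    by (rule emeasure_surface_measure[OF A'])
  also have "{y \<in> ball 0 1. sgn y \<in> U -` A} = U -` {y \<in> ball 0 1. sgn y \<in> A}"
    using norm by (auto simp: sgn_div_norm linear_scale[OF lin])
  also have "emeasure lborel \<dots> = emeasure (distr lborel borel U) {y \<in> ball 0 1. sgn y \<in> A}"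
    using m by (subst emeasure_distr) auto
  also have "\<dots> / emeasure lborel (ball (0::'a) 1) = emeasure \<sigma> A"
    by (simp only: lborel_orthogonal_invariant[OF U] emeasure_surface_measure[OF A])
  finally show "emeasure (distr \<sigma> \<sigma> U) A = emeasure \<sigma> A" .
qed simp

lemma integral_surface_orthogonal:
  fixes U :: "'a::euclidean_space \<Rightarrow> 'a" and f :: "'a \<Rightarrow> real"
  assumes U: "orthogonal_transformation U" and f: "f \<in> borel_measurable \<sigma>"
  shows "(LINT z|\<sigma>. f (U z)) = (LINT z|\<sigma>. f z)"
proof -
  note US = orthogonal_transformation_measurable_surface[OF U]
  have "(LINT z|\<sigma>. f z) = (LINT z|distr \<sigma> \<sigma> U. f z)"
    by (simp only: surface_measure_orthogonal_invariant[OF U])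
  also have "\<dots> = (LINT z|\<sigma>. f (U z))"
    by (rule integral_distr[OF US f])
  finally show ?thesis by simp
qed

text \<open>
  The reflection in the hyperplane orthogonal to \<open>a - b\<close>: reflections alone act transitively on every
  sphere.
\<close>

lemma reflection_exists:
  fixes a b :: "'a::real_inner"
  assumes "norm a = norm b"
  obtains U where "orthogonal_transformation U" "U a = b"
proof (cases "a = b")
  case True
  then show ?thesis using that[of "\<lambda>x. x"] by simp
next
  case False
  define u where "u = a - b"
  define U where "U x = x - (2 * (x \<bullet> u) / (u \<bullet> u)) *\<^sub>R u" for x
  have uu: "u \<bullet> u \<noteq> 0" using False by (simp add: u_def)
  have "linear U"
    by (rule linearI) (simp_all add: U_def inner_add_left add_divide_distrib algebra_simps)
  moreover have "U v \<bullet> U w = v \<bullet> w" for v w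
    using uu by (simp add: U_def inner_diff_left inner_diff_right inner_commute field_simps)
  ultimately have "orthogonal_transformation U" by (simp add: orthogonal_transformation_def)
  moreover have "U a = b"
  proof -
    have "a \<bullet> a = b \<bullet> b" using assms by (simp add: norm_eq)
    then have "2 * (a \<bullet> u) = u \<bullet> u"
      by (simp add: u_def inner_diff_left inner_diff_right inner_commute)
    then show ?thesis using uu by (simp add: U_def u_def)
  qed
  ultimately show ?thesis by (rule that)
qed

text \<open>
  The cone over a point is contained in a line, a null set in dimension at least two.
\<close>

lemma surface_measure_singleton:
  fixes x :: "'a::euclidean_space"
  assumes "DIM('a) \<ge> 2" and x: "x \<in> sphere 0 1"
  shows "emeasure \<sigma> {x} = 0"
proof -
  have sub: "{y \<in> ball 0 1. sgn y \<in> {x}} \<subseteq> span {x}"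
  proof
    fix y assume "y \<in> {y \<in> ball 0 1. sgn y \<in> {x}}"
    then have "y = norm y *\<^sub>R x" by (metis mem_Collect_eq singletonD sgn_div_norm
        scaleR_scaleR divide_self_if scaleR_one inverse_eq_divide mult.right_neutral norm_eq_zero times_divide_eq_right scaleR_zero_left)
    then show "y \<in> span {x}" by (metis span_base span_mul singletonI)
  qed
  have "dim (span {x}) < DIM('a)"
    using assms dim_le_card'[of "{x}"] by (simp add: dim_span)
  then have neg: "negligible (span {x})" by (rule negligible_lowdim)
  have m: "{y \<in> ball 0 1. sgn y \<in> {x}} \<in> sets borel"
  proof -
    have [measurable]: "(sgn :: 'a \<Rightarrow> 'a) \<in> borel_measurable borel"
      unfolding sgn_div_norm[abs_def] by measurable
    show ?thesis by measurable
  qed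
  have "emeasure lborel {y \<in> ball 0 1. sgn y \<in> {x}} = 0"
    using negligible_subset[OF neg sub] m
    by (simp add: negligible_iff_null_sets null_sets_def)
  then show ?thesis using x by (subst emeasure_surface_measure) auto
qed

section \<open>Harmonic functions and the maximum principle\<close>

text \<open>
  Harmonicity is expressed by second difference quotients instead of second derivatives. Their limit is
  taken for a fixed point only, so that it can be exchanged with an integral over the sphere by dominated
  convergence, and it is all that the maximum principle uses.
\<close>

definition second_difference :: "('a::euclidean_space \<Rightarrow> real) \<Rightarrow> real \<Rightarrow> 'a \<Rightarrow> real" where
  "second_difference u h x = (\<Sum>b\<in>Basis. (u (x + h *\<^sub>R b) + u (x - h *\<^sub>R b) - 2 * u x) / h\<^sup>2)"

definition harmonic_at :: "('a::euclidean_space \<Rightarrow> real) \<Rightarrow> 'a \<Rightarrow> bool" where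
  "harmonic_at u x \<longleftrightarrow> ((\<lambda>h. second_difference u h x) \<longlongrightarrow> 0) (at 0)"

lemma second_difference_diff:
  "second_difference (\<lambda>x. u x - v x) h x = second_difference u h x - second_difference v h x"
proof -
  have "((p - q) + (p' - q') - 2 * (r - r')) / c = (p + p' - 2 * r) / c - (q + q' - 2 * r') / c"
    for p q p' q' r r' c :: real
    unfolding diff_divide_distrib[symmetric] by (rule arg_cong[where f = "\<lambda>y. y / c"]) simp
  then show ?thesis
    unfolding second_difference_def by (simp only: sum_subtractf)
qed

lemma harmonic_at_diff:
  "harmonic_at u x \<Longrightarrow> harmonic_at v x \<Longrightarrow> harmonic_at (\<lambda>x. u x - v x) x"
  unfolding harmonic_at_def second_difference_diff
  using tendsto_diff[of "\<lambda>h. second_difference u h x" 0 "at 0" "\<lambda>h. second_difference v h x" 0] by simp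

lemma second_difference_minus: "second_difference (\<lambda>x. - u x) h x = - second_difference u h x"
  using second_difference_diff[of "\<lambda>_. 0" u h x] by (simp add: second_difference_def)

lemma harmonic_at_minus: "harmonic_at u x \<Longrightarrow> harmonic_at (\<lambda>x. - u x) x"
  unfolding harmonic_at_def second_difference_minus
  using tendsto_minus[of "\<lambda>h. second_difference u h x" 0 "at 0"] by simp

text \<open>
  If \<open>u\<close> exceeds \<open>M\<close> inside, then so small a multiple \<open>\<epsilon> |x|\<^sup>2\<close> can be added to it that the maximum is
  still attained at a point \<open>y\<close> of the open ball. All second difference quotients of the sum are nonpositive at \<open>y\<close>, while those of \<open>\<epsilon> |x|\<^sup>2\<close> add
  up to \<open>2 \<epsilon>\<close> times the dimension; the quotients of \<open>u\<close> then stay away from \<open>0\<close>.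
\<close>

lemma maximum_principle:
  fixes u :: "'a::euclidean_space \<Rightarrow> real"
  assumes cont: "continuous_on (cball 0 R) u"
    and harm: "\<And>x. x \<in> ball 0 R \<Longrightarrow> harmonic_at u x"
    and bd: "\<And>x. x \<in> sphere 0 R \<Longrightarrow> u x \<le> M"
    and x: "x \<in> cball 0 R"
  shows "u x \<le> M"
proof (rule ccontr)
  assume "\<not> u x \<le> M"
  define \<epsilon> where "\<epsilon> = (u x - M) / (2 * (R\<^sup>2 + 1))"
  \<comment> \<open>So small that \<open>\<epsilon> R\<^sup>2\<close> cannot compensate the excess \<open>u x - M\<close>.\<close>
  have R2: "R\<^sup>2 + 1 > 0" by (simp add: add_nonneg_pos)
  have \<epsilon>: "\<epsilon> > 0" using \<open>\<not> u x \<le> M\<close> R2 by (auto simp: \<epsilon>_def)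
  have "\<epsilon> * (R\<^sup>2 + 1) = (u x - M) / 2" using R2 by (simp add: \<epsilon>_def field_simps)
  then have \<epsilon>R: "M + \<epsilon> * R\<^sup>2 < u x"
    using \<epsilon> \<open>\<not> u x \<le> M\<close> by (simp add: algebra_simps)
  define w where "w y = u y + \<epsilon> * (norm y)\<^sup>2" for y
  have "continuous_on (cball 0 R) w"
    unfolding w_def by (intro continuous_intros cont)
  then obtain y where y: "y \<in> cball 0 R" and ymax: "\<And>y'. y' \<in> cball 0 R \<Longrightarrow> w y' \<le> w y"
    using continuous_attains_sup[OF compact_cball, of 0 R w] x by blast
  have "w y \<ge> w x" using ymax x by blast
  moreover have "w x \<ge> u x" using \<epsilon> by (simp add: w_def)
  ultimately have "y \<notin> sphere 0 R"
    using bd[of y] \<epsilon>R by (auto simp: w_def)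
  then have yb: "y \<in> ball 0 R" using y by auto
  define \<delta> where "\<delta> = R - norm y"
  have \<delta>: "\<delta> > 0" using yb by (simp add: \<delta>_def)
  have le: "second_difference u h y \<le> - (2 * \<epsilon> * DIM('a))" if h: "h \<noteq> 0" "\<bar>h\<bar> < \<delta>" for h
  proof -
    have "(u (y + h *\<^sub>R b) + u (y - h *\<^sub>R b) - 2 * u y) / h\<^sup>2 \<le> - (2 * \<epsilon>)" if b: "b \<in> Basis" for b
    proof -
      have "norm (h *\<^sub>R b) < \<delta>" using h b by simp
      then have "y + h *\<^sub>R b \<in> cball 0 R" "y - h *\<^sub>R b \<in> cball 0 R"
        using norm_triangle_ineq[of y "h *\<^sub>R b"] norm_triangle_ineq4[of y "h *\<^sub>R b"]
        by (auto simp: \<delta>_def)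
      then have "w (y + h *\<^sub>R b) \<le> w y" "w (y - h *\<^sub>R b) \<le> w y" using ymax by auto
      moreover have "(norm (y + h *\<^sub>R b))\<^sup>2 + (norm (y - h *\<^sub>R b))\<^sup>2 = 2 * (norm y)\<^sup>2 + 2 * h\<^sup>2"
        using b unfolding power2_norm_eq_inner
        by (simp add: inner_add_left inner_add_right inner_diff_left inner_diff_right
            inner_commute power2_eq_square)
      moreover from this have "\<epsilon> * (norm (y + h *\<^sub>R b))\<^sup>2 + \<epsilon> * (norm (y - h *\<^sub>R b))\<^sup>2 =
          \<epsilon> * (2 * (norm y)\<^sup>2 + 2 * h\<^sup>2)"
        by (metis distrib_left)
      ultimately have "u (y + h *\<^sub>R b) + u (y - h *\<^sub>R b) - 2 * u y \<le> - (2 * \<epsilon>) * h\<^sup>2"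
        by (simp add: w_def algebra_simps)
      then show ?thesis using h by (simp add: divide_le_eq)
    qed
    then have "second_difference u h y \<le> (\<Sum>b\<in>(Basis::'a set). - (2 * \<epsilon>))"
      unfolding second_difference_def by (intro sum_mono)
    then show ?thesis by (simp add: algebra_simps)
  qed
  have ev: "eventually (\<lambda>h. second_difference u h y \<le> - (2 * \<epsilon> * DIM('a))) (at 0)"
    unfolding eventually_at by (intro exI[of _ \<delta>]) (use \<delta> le in auto)
  have "0 \<le> - (2 * \<epsilon> * DIM('a))"
    using harm[OF yb] unfolding harmonic_at_def
    by (rule tendsto_upperbound[OF _ ev]) simp
  then show False using \<epsilon> by (simp add: mult_le_0_iff)
qed

text \<open>
  Taylor expansion of the even function \<open>f h + f (- h)\<close>, whose first derivative vanishes at \<open>0\<close>.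
  Besides the limit of the quotients it yields the bounds needed for dominated convergence.
\<close>

lemma second_difference_mean_value:
  fixes f f' f'' :: "real \<Rightarrow> real"
  assumes d1: "\<And>t. \<bar>t\<bar> < \<delta> \<Longrightarrow> (f has_real_derivative f' t) (at t)"
    and d2: "\<And>t. \<bar>t\<bar> < \<delta> \<Longrightarrow> (f' has_real_derivative f'' t) (at t)"
    and h: "h \<noteq> 0" "\<bar>h\<bar> < \<delta>"
  obtains \<xi> where "\<bar>\<xi>\<bar> \<le> \<bar>h\<bar>" "(f h + f (- h) - 2 * f 0) / h\<^sup>2 = (f'' \<xi> + f'' (- \<xi>)) / 2"
proof -
  define D where "D m = (if m = 0 then (\<lambda>t. f t + f (- t)) else if m = 1 then (\<lambda>t. f' t - f' (- t))
    else (\<lambda>t. f'' t + f'' (- t)))" for m :: nat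
  have "\<exists>\<xi>>0. \<xi> < \<bar>h\<bar> \<and> (\<lambda>t. f t + f (- t)) \<bar>h\<bar> =
      (\<Sum>m<2. D m 0 / fact m * \<bar>h\<bar> ^ m) + D 2 \<xi> / fact 2 * \<bar>h\<bar> ^ 2"
  proof (rule Maclaurin)
    show "\<forall>m t. m < 2 \<and> 0 \<le> t \<and> t \<le> \<bar>h\<bar> \<longrightarrow> DERIV (D m) t :> D (Suc m) t"
    proof (intro allI impI)
      fix m :: nat and t assume mt: "m < 2 \<and> 0 \<le> t \<and> t \<le> \<bar>h\<bar>"
      then have t: "\<bar>t\<bar> < \<delta>" "\<bar>- t\<bar> < \<delta>" using h by auto
      have neg: "((\<lambda>t. - t) has_real_derivative -1) (at t)"
        by (auto intro!: derivative_eq_intros)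
      consider "m = 0" | "m = 1" using mt by linarith
      then show "DERIV (D m) t :> D (Suc m) t"
      proof cases
        case 1
        then show ?thesis
          using DERIV_add[OF d1[OF t(1)] DERIV_chain2[OF d1[OF t(2)] neg]] by (simp add: D_def)
      next
        case 2
        then show ?thesis
          using DERIV_diff[OF d2[OF t(1)] DERIV_chain2[OF d2[OF t(2)] neg]] by (simp add: D_def)
      qed
    qed
  qed (use h in \<open>auto simp: D_def\<close>)
  then obtain \<xi> where \<xi>: "\<xi> > 0" "\<xi> < \<bar>h\<bar>"
    and eq: "f \<bar>h\<bar> + f (- \<bar>h\<bar>) = 2 * f 0 + (f'' \<xi> + f'' (- \<xi>)) / 2 * h\<^sup>2"
    by (auto simp: D_def numeral_2_eq_2 fact_2)
  have "f h + f (- h) = f \<bar>h\<bar> + f (- \<bar>h\<bar>)" by (cases "h \<ge> 0") (auto simp: abs_if)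
  then have "(f h + f (- h) - 2 * f 0) / h\<^sup>2 = (f'' \<xi> + f'' (- \<xi>)) / 2"
    using eq h by (simp add: field_simps)
  then show ?thesis using \<xi> that[of \<xi>] by simp
qed

lemma second_difference_tendsto:
  fixes f f' f'' :: "real \<Rightarrow> real"
  assumes \<delta>: "\<delta> > 0"
    and d1: "\<And>t. \<bar>t\<bar> < \<delta> \<Longrightarrow> (f has_real_derivative f' t) (at t)"
    and d2: "\<And>t. \<bar>t\<bar> < \<delta> \<Longrightarrow> (f' has_real_derivative f'' t) (at t)"
    and cont: "isCont f'' 0"
  shows "((\<lambda>h. (f h + f (- h) - 2 * f 0) / h\<^sup>2) \<longlongrightarrow> f'' 0) (at 0)"
proof (rule LIM_I)
  fix e :: real assume "e > 0"
  then obtain \<eta> where \<eta>: "\<eta> > 0" "\<And>t. \<bar>t\<bar> < \<eta> \<Longrightarrow> \<bar>f'' t - f'' 0\<bar> < e"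
    using cont[unfolded continuous_at_eps_delta, rule_format, of e] by (auto simp: dist_real_def)
  show "\<exists>s>0. \<forall>h. h \<noteq> 0 \<and> norm (h - 0) < s \<longrightarrow>
      norm ((f h + f (- h) - 2 * f 0) / h\<^sup>2 - f'' 0) < e"
  proof (intro exI[of _ "min \<delta> \<eta>"] conjI allI impI)
    fix h :: real assume h: "h \<noteq> 0 \<and> norm (h - 0) < min \<delta> \<eta>"
    then obtain \<xi> where \<xi>: "\<bar>\<xi>\<bar> \<le> \<bar>h\<bar>" "(f h + f (- h) - 2 * f 0) / h\<^sup>2 = (f'' \<xi> + f'' (- \<xi>)) / 2"
      using second_difference_mean_value[OF d1 d2, of \<delta> h] by auto
    have "\<bar>f'' \<xi> - f'' 0\<bar> < e" "\<bar>f'' (- \<xi>) - f'' 0\<bar> < e"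
      using \<eta>(2)[of \<xi>] \<eta>(2)[of "- \<xi>"] \<xi>(1) h by auto
    then show "norm ((f h + f (- h) - 2 * f 0) / h\<^sup>2 - f'' 0) < e"
      unfolding \<xi>(2) real_norm_def abs_less_iff by argo
  qed (use \<delta> \<eta> in auto)
qed

lemma harmonic_polynomial_imp_harmonic_at:
  fixes p :: "'a::euclidean_space \<Rightarrow> real"
  assumes p: "real_polynomial_function p" and lap: "laplacian p x = 0"
  shows "harmonic_at p x"
proof -
  have lim: "((\<lambda>h. (p (x + h *\<^sub>R b) + p (x - h *\<^sub>R b) - 2 * p x) / h\<^sup>2) \<longlongrightarrow>
      (deriv ^^ 2) (\<lambda>t. p (x + t *\<^sub>R b)) 0) (at 0)" for b
  proof -
    define f where "f t = p (x + t *\<^sub>R b)" for t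
    have "polynomial_function (\<lambda>t::real. x + t *\<^sub>R b)"
      by (intro polynomial_function_add polynomial_function_const
          polynomial_function_bounded_linear bounded_linear_scaleR_left)
    then have "real_polynomial_function f"
      unfolding f_def by (rule real_polynomial_function_compose[OF _ p, unfolded comp_def])
    then obtain f' where f': "real_polynomial_function f'" "\<And>t. (f has_real_derivative f' t) (at t)"
      using has_real_derivative_polynomial_function by blast
    then obtain f'' where f'': "real_polynomial_function f''" "\<And>t. (f' has_real_derivative f'' t) (at t)"
      using has_real_derivative_polynomial_function by blast
    have "deriv f = f'" "deriv f' = f''"
      using f'(2) f''(2) by (auto intro!: ext DERIV_imp_deriv)
    then have "(deriv ^^ 2) f 0 = f'' 0" by (simp add: numeral_2_eq_2)
    moreover have "isCont f'' 0"
      using f''(1) by (metis continuous_polymonial_function real_polynomial_function_eq)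
    then have "((\<lambda>h. (f h + f (- h) - 2 * f 0) / h\<^sup>2) \<longlongrightarrow> f'' 0) (at 0)"
      by (intro second_difference_tendsto[of 1 f f' f'']) (use f' f'' in auto)
    ultimately show ?thesis by (simp add: f_def[abs_def])
  qed
  have "((\<lambda>h. second_difference p h x) \<longlongrightarrow> laplacian p x) (at 0)"
    unfolding second_difference_def laplacian_def by (intro tendsto_sum lim)
  then show ?thesis by (simp add: harmonic_at_def lap)
qed

lemma harmonic_at_scale:
  assumes "harmonic_at u (c *\<^sub>R x)" "c \<noteq> 0"
  shows "harmonic_at (\<lambda>x. u (c *\<^sub>R x)) x"
proof -
  have eq: "second_difference (\<lambda>x. u (c *\<^sub>R x)) h x = c\<^sup>2 * second_difference u (c * h) (c *\<^sub>R x)" for h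
    using \<open>c \<noteq> 0\<close> unfolding second_difference_def sum_distrib_left
    by (intro sum.cong) (auto simp: scaleR_add_right scaleR_diff_right power_mult_distrib)
  have "filterlim (\<lambda>h. c * h) (at 0) (at (0::real))"
  proof -
    have "((\<lambda>h. c * h) \<longlongrightarrow> c * 0) (at 0)" by (intro tendsto_intros)
    moreover have "eventually (\<lambda>h. c * h \<noteq> 0) (at (0::real))"
      using \<open>c \<noteq> 0\<close> unfolding eventually_at by (intro exI[of _ 1]) auto
    ultimately show ?thesis by (simp add: filterlim_at)
  qed
  then have "((\<lambda>h. second_difference u (c * h) (c *\<^sub>R x)) \<longlongrightarrow> 0) (at 0)"
    using assms(1) unfolding harmonic_at_def by (rule filterlim_compose[rotated])
  then show ?thesis
    unfolding harmonic_at_def eq by (rule tendsto_mult_right_zero)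
qed

section \<open>The Poisson kernel\<close>

text \<open>
  The Poisson kernel of the unit ball: \<open>1 - |x|\<^sup>2\<close> divided by \<open>|x - z|\<close> raised to the dimension of the
  space. Along a line both \<open>1 - |x|\<^sup>2\<close> and \<open>|x - z|\<^sup>2\<close> are quadratic polynomials, which is why the
  denominator is written as a real power of the squared norm.
\<close>

definition poisson :: "'a::euclidean_space \<Rightarrow> 'a \<Rightarrow> real" where
  "poisson x z = (1 - (norm x)\<^sup>2) * (norm (x - z))\<^sup>2 powr (- real DIM('a) / 2)"

lemma poisson_derivatives:
  fixes n0 n1 q0 q1 a t :: real
  defines "N \<equiv> (\<lambda>t. n0 - 2 * n1 * t - t\<^sup>2)" and "Q \<equiv> (\<lambda>t. q0 + 2 * q1 * t + t\<^sup>2)"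
  defines "N' \<equiv> (\<lambda>t. - 2 * n1 - 2 * t)" and "Q' \<equiv> (\<lambda>t. 2 * q1 + 2 * t)"
  assumes Q: "Q t > 0"
  shows "((\<lambda>t. N t * Q t powr a) has_real_derivative
           N' t * Q t powr a + N t * (a * Q t powr (a - 1) * Q' t)) (at t)" (is ?D1)
    and "((\<lambda>t. N' t * Q t powr a + N t * (a * Q t powr (a - 1) * Q' t)) has_real_derivative
           - 2 * Q t powr a + 2 * a * (N' t * Q' t) * Q t powr (a - 1) + 2 * a * N t * Q t powr (a - 1) +
           a * (a - 1) * N t * (Q' t)\<^sup>2 * Q t powr (a - 2)) (at t)" (is ?D2)
proof -
  have dN: "(N has_real_derivative N' t) (at t)" "(N' has_real_derivative - 2) (at t)"
    unfolding N_def N'_def by (auto intro!: derivative_eq_intros)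
  have dQ: "(Q has_real_derivative Q' t) (at t)" "(Q' has_real_derivative 2) (at t)"
    unfolding Q_def Q'_def by (auto intro!: derivative_eq_intros)
  have dp: "((\<lambda>t. Q t powr b) has_real_derivative b * Q t powr (b - 1) * Q' t) (at t)" for b
    using DERIV_fun_powr[OF dQ(1) Q, of b] by simp
  have e: "a - 1 - 1 = a - 2" by simp
  show ?D1
    by (rule DERIV_cong[OF DERIV_mult[OF dN(1) dp[of a]]]) (simp add: algebra_simps)
  show ?D2
    by (rule DERIV_cong[OF DERIV_add[OF DERIV_mult[OF dN(2) dp[of a]]
          DERIV_mult[OF dN(1) DERIV_mult[OF DERIV_cmult[OF dp[of "a - 1"], of a] dQ(2)]]]])
      (simp add: e algebra_simps power2_eq_square)
qed

context
  fixes x z :: "'a::euclidean_space"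
  assumes x: "norm x < 1" and z: "z \<in> sphere 0 1"
begin

text \<open>
  The second derivative of \<open>\<lambda>t. poisson (x + t *\<^sub>R b) z\<close>.
\<close>

definition "poisson_d2 b t =
  (let a = - real DIM('a) / 2; N = 1 - (norm x)\<^sup>2 - 2 * (x \<bullet> b) * t - t\<^sup>2;
       Q = (norm (x - z))\<^sup>2 + 2 * ((x - z) \<bullet> b) * t + t\<^sup>2;
       N' = - 2 * (x \<bullet> b) - 2 * t; Q' = 2 * ((x - z) \<bullet> b) + 2 * t
   in - 2 * Q powr a + 2 * a * (N' * Q') * Q powr (a - 1) + 2 * a * N * Q powr (a - 1) +
        a * (a - 1) * N * Q'\<^sup>2 * Q powr (a - 2))"

lemma norm_add_Basis:
  fixes y :: 'a
  assumes "b \<in> Basis"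
  shows "(norm (y + t *\<^sub>R b))\<^sup>2 = (norm y)\<^sup>2 + 2 * (y \<bullet> b) * t + t\<^sup>2"
  using assms unfolding power2_norm_eq_inner
  by (simp add: inner_add_left inner_add_right inner_commute power2_eq_square algebra_simps)

lemma poisson_line:
  assumes b: "b \<in> Basis"
  shows "poisson (x + t *\<^sub>R b) z = (1 - (norm x)\<^sup>2 - 2 * (x \<bullet> b) * t - t\<^sup>2) *
      ((norm (x - z))\<^sup>2 + 2 * ((x - z) \<bullet> b) * t + t\<^sup>2) powr (- real DIM('a) / 2)"
proof -
  have "x + t *\<^sub>R b - z = (x - z) + t *\<^sub>R b" by simp
  then show ?thesis
    unfolding poisson_def by (simp only: norm_add_Basis[OF b]) (simp add: algebra_simps)
qed

lemma dist_sphere_lower: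
  assumes b: "b \<in> Basis" and t: "\<bar>t\<bar> \<le> (1 - norm x) / 2"
  shows "(norm (x - z))\<^sup>2 + 2 * ((x - z) \<bullet> b) * t + t\<^sup>2 \<ge> ((1 - norm x) / 2)\<^sup>2"
    and "norm (x + t *\<^sub>R b) \<le> 1"
proof -
  have "norm (t *\<^sub>R b) \<le> (1 - norm x) / 2" using b t by simp
  then have *: "norm (x + t *\<^sub>R b) \<le> norm x + (1 - norm x) / 2"
    using norm_triangle_ineq[of x "t *\<^sub>R b"] by linarith
  then show "norm (x + t *\<^sub>R b) \<le> 1" using x by argo
  have "norm z \<le> norm (x - z + t *\<^sub>R b) + norm (x + t *\<^sub>R b)"
    using norm_triangle_ineq4[of "x + t *\<^sub>R b" "x - z + t *\<^sub>R b"] by (simp add: algebra_simps)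
  then have "norm (x - z + t *\<^sub>R b) \<ge> (1 - norm x) / 2" using * z by simp argo?
  then have "(norm (x - z + t *\<^sub>R b))\<^sup>2 \<ge> ((1 - norm x) / 2)\<^sup>2"
    using x by (intro power_mono) auto
  then show "(norm (x - z))\<^sup>2 + 2 * ((x - z) \<bullet> b) * t + t\<^sup>2 \<ge> ((1 - norm x) / 2)\<^sup>2"
    by (simp add: norm_add_Basis[OF b])
qed

lemma dist_sphere_pos:
  assumes b: "b \<in> Basis" and t: "\<bar>t\<bar> \<le> (1 - norm x) / 2"
  shows "(norm (x - z))\<^sup>2 + 2 * ((x - z) \<bullet> b) * t + t\<^sup>2 > 0"
proof -
  have "((1 - norm x) / 2)\<^sup>2 > 0" using x by simp
  then show ?thesis using dist_sphere_lower(1)[OF b t] by linarith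
qed

lemma poisson_second_difference:
  assumes b: "b \<in> Basis"
  shows "((\<lambda>h. (poisson (x + h *\<^sub>R b) z + poisson (x - h *\<^sub>R b) z - 2 * poisson x z) / h\<^sup>2)
           \<longlongrightarrow> poisson_d2 b 0) (at 0)" (is ?lim)
    and "h \<noteq> 0 \<Longrightarrow> \<bar>h\<bar> < (1 - norm x) / 2 \<Longrightarrow>
          \<exists>\<xi>. \<bar>\<xi>\<bar> \<le> \<bar>h\<bar> \<and> (poisson (x + h *\<^sub>R b) z + poisson (x - h *\<^sub>R b) z - 2 * poisson x z) / h\<^sup>2 =
            (poisson_d2 b \<xi> + poisson_d2 b (- \<xi>)) / 2" (is "_ \<Longrightarrow> _ \<Longrightarrow> ?mean")
proof -
  define f where "f t = poisson (x + t *\<^sub>R b) z" for t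
  have f: "f = (\<lambda>t. (1 - (norm x)\<^sup>2 - 2 * (x \<bullet> b) * t - t\<^sup>2) *
      ((norm (x - z))\<^sup>2 + 2 * ((x - z) \<bullet> b) * t + t\<^sup>2) powr (- real DIM('a) / 2))"
    unfolding f_def by (rule ext, rule poisson_line[OF b])
  define \<delta> where "\<delta> = (1 - norm x) / 2"
  have \<delta>: "\<delta> > 0" using x by (simp add: \<delta>_def)
  obtain f' where f': "\<And>t. \<bar>t\<bar> < \<delta> \<Longrightarrow> (f has_real_derivative f' t) (at t)"
      "\<And>t. \<bar>t\<bar> < \<delta> \<Longrightarrow> (f' has_real_derivative poisson_d2 b t) (at t)"
  proof (rule that)
    fix t assume t: "\<bar>t\<bar> < \<delta>"
    have pos: "(norm (x - z))\<^sup>2 + 2 * ((x - z) \<bullet> b) * t + t\<^sup>2 > 0"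
      using t by (intro dist_sphere_pos[OF b]) (simp add: \<delta>_def)
    show "(f has_real_derivative
        (- 2 * (x \<bullet> b) - 2 * t) * ((norm (x - z))\<^sup>2 + 2 * ((x - z) \<bullet> b) * t + t\<^sup>2) powr (- real DIM('a) / 2) +
        (1 - (norm x)\<^sup>2 - 2 * (x \<bullet> b) * t - t\<^sup>2) * (- real DIM('a) / 2 *
          ((norm (x - z))\<^sup>2 + 2 * ((x - z) \<bullet> b) * t + t\<^sup>2) powr (- real DIM('a) / 2 - 1) *
          (2 * ((x - z) \<bullet> b) + 2 * t))) (at t)"
      unfolding f by (rule poisson_derivatives(1)[OF pos])
    show "((\<lambda>t. (- 2 * (x \<bullet> b) - 2 * t) * ((norm (x - z))\<^sup>2 + 2 * ((x - z) \<bullet> b) * t + t\<^sup>2) powr (- real DIM('a) / 2) +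
        (1 - (norm x)\<^sup>2 - 2 * (x \<bullet> b) * t - t\<^sup>2) * (- real DIM('a) / 2 *
          ((norm (x - z))\<^sup>2 + 2 * ((x - z) \<bullet> b) * t + t\<^sup>2) powr (- real DIM('a) / 2 - 1) *
          (2 * ((x - z) \<bullet> b) + 2 * t))) has_real_derivative poisson_d2 b t) (at t)"
      unfolding poisson_d2_def Let_def by (rule poisson_derivatives(2)[OF pos])
  qed
  have 0: "(norm (x - z))\<^sup>2 \<noteq> 0" using dist_sphere_pos[OF b, of 0] x by simp
  have "isCont (poisson_d2 b) 0"
    unfolding poisson_d2_def Let_def using 0 by (intro continuous_intros) auto
  from second_difference_tendsto[OF \<delta> f' this] show ?lim
    by (simp add: f_def[abs_def])
  show ?mean if "h \<noteq> 0" "\<bar>h\<bar> < (1 - norm x) / 2"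
    using second_difference_mean_value[OF f', folded \<delta>_def, of \<delta> h] that
    by (metis \<delta>_def f_def add.right_neutral diff_conv_add_uminus scaleR_minus_left scaleR_zero_left)
qed

text \<open>
  Let \<open>D\<close> be the dimension of the space and \<open>a = - D / 2\<close>. In the sum of the second derivatives over the basis,
  \<open>|x - z|\<^sup>2\<close> to the power \<open>a - 1\<close> factors out; the remaining factor is a multiple of
  \<open>|x - z|\<^sup>2 - (1 - |x|\<^sup>2) - 2 x \<bullet> (x - z)\<close>, which vanishes for \<open>|z| = 1\<close>.
\<close>

lemma harmonic_at_poisson: "harmonic_at (\<lambda>x. poisson x z) x"
proof -
  define a where "a = - real DIM('a) / 2"
  define N where "N = 1 - (norm x)\<^sup>2"
  define Q where "Q = (norm (x - z))\<^sup>2"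
  have Q0: "Q > 0" using dist_sphere_pos[of "SOME b. b \<in> Basis" 0] x SOME_Basis by (auto simp: Q_def)
  have "(\<Sum>b\<in>Basis. poisson_d2 b 0) =
      (\<Sum>b\<in>(Basis::'a set). - 2 * Q powr a + 2 * a * N * Q powr (a - 1) +
        (-8 * a * Q powr (a - 1)) * ((x \<bullet> b) * ((x - z) \<bullet> b)) +
        (4 * (a * (a - 1)) * N * Q powr (a - 2)) * (((x - z) \<bullet> b) * ((x - z) \<bullet> b)))"
    unfolding poisson_d2_def Let_def a_def[symmetric] N_def[symmetric] Q_def[symmetric]
    by (intro sum.cong) (auto simp: N_def Q_def power2_eq_square algebra_simps)
  also have "\<dots> = DIM('a) * (- 2 * Q powr a + 2 * a * N * Q powr (a - 1)) +
        (-8 * a * Q powr (a - 1)) * (x \<bullet> (x - z)) +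
        (4 * (a * (a - 1)) * N * Q powr (a - 2)) * ((x - z) \<bullet> (x - z))"
    unfolding euclidean_inner[of x "x - z"] euclidean_inner[of "x - z" "x - z"]
      sum_distrib_left sum.distrib by (simp add: algebra_simps)
  also have "real DIM('a) = - 2 * a" by (simp add: a_def)
  also have "(x - z) \<bullet> (x - z) = Q" by (simp add: Q_def power2_norm_eq_inner)
  also have "Q powr a = Q * Q powr (a - 1)"
    using Q0 by (simp add: powr_diff)
  also have "Q powr (a - 2) = Q powr (a - 1) / Q"
    using Q0 powr_diff[of Q "a - 1" 1] by simp
  also have "- 2 * a * (- 2 * (Q * Q powr (a - 1)) + 2 * a * N * Q powr (a - 1)) +
      - 8 * a * Q powr (a - 1) * (x \<bullet> (x - z)) +
      4 * (a * (a - 1)) * N * (Q powr (a - 1) / Q) * Q =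
      4 * a * Q powr (a - 1) * (Q - N - 2 * (x \<bullet> (x - z)))"
    using Q0 by (simp add: field_simps power2_eq_square)
  also have "Q - N - 2 * (x \<bullet> (x - z)) = 0"
  proof -
    have "z \<bullet> z = 1" using z by (simp add: norm_eq_1)
    then show ?thesis
      by (simp add: Q_def N_def power2_norm_eq_inner inner_diff_left inner_diff_right inner_commute)
  qed
  finally have sum0: "(\<Sum>b\<in>Basis. poisson_d2 b 0) = 0" by simp
  have "((\<lambda>h. second_difference (\<lambda>x. poisson x z) h x) \<longlongrightarrow> (\<Sum>b\<in>Basis. poisson_d2 b 0)) (at 0)"
    unfolding second_difference_def by (intro tendsto_sum poisson_second_difference(1))
  then show ?thesis unfolding sum0 harmonic_at_def .
qed

lemma poisson_d2_bound:
  assumes b: "b \<in> Basis" and t: "\<bar>t\<bar> \<le> (1 - norm x) / 2"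
  defines "a \<equiv> - real DIM('a) / 2" and "q \<equiv> ((1 - norm x) / 2)\<^sup>2"
  shows "\<bar>poisson_d2 b t\<bar> \<le> 2 * q powr a + 18 * \<bar>a\<bar> * q powr (a - 1) + 16 * \<bar>a * (a - 1)\<bar> * q powr (a - 2)"
proof -
  define N where "N = 1 - (norm x)\<^sup>2 - 2 * (x \<bullet> b) * t - t\<^sup>2"
  define Q where "Q = (norm (x - z))\<^sup>2 + 2 * ((x - z) \<bullet> b) * t + t\<^sup>2"
  define N' where "N' = - 2 * (x \<bullet> b) - 2 * t"
  define Q' where "Q' = 2 * ((x - z) \<bullet> b) + 2 * t"
  have q: "q > 0" using x by (simp add: q_def)
  have Qq: "q \<le> Q" unfolding q_def Q_def by (rule dist_sphere_lower(1)[OF b t])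
  have a: "a < 0" by (simp add: a_def)
  have P: "Q powr (a - c) \<le> q powr (a - c)" if "c \<ge> 0" for c
    using Qq q a that by (intro powr_mono2') auto
  have y1: "norm (x + t *\<^sub>R b) \<le> 1" by (rule dist_sphere_lower(2)[OF b t])
  have "N = 1 - (norm (x + t *\<^sub>R b))\<^sup>2" by (simp add: norm_add_Basis[OF b] N_def)
  moreover have "(norm (x + t *\<^sub>R b))\<^sup>2 \<le> 1" using y1 by (simp add: power_le_one)
  ultimately have N: "\<bar>N\<bar> \<le> 1" by simp
  have "N' = - 2 * ((x + t *\<^sub>R b) \<bullet> b)" using b by (simp add: N'_def inner_add_left)
  then have N': "\<bar>N'\<bar> \<le> 2" using Basis_le_norm[OF b, of "x + t *\<^sub>R b"] y1 by simp
  have "Q' = 2 * ((x + t *\<^sub>R b - z) \<bullet> b)" using b by (simp add: Q'_def inner_add_left inner_diff_left)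
  moreover have "norm (x + t *\<^sub>R b - z) \<le> 2"
    using norm_triangle_ineq4[of "x + t *\<^sub>R b" z] y1 z by simp
  ultimately have Q': "\<bar>Q'\<bar> \<le> 4" using Basis_le_norm[OF b, of "x + t *\<^sub>R b - z"] by simp
  have NQ: "\<bar>N'\<bar> * \<bar>Q'\<bar> \<le> 2 * 4" using N' Q' by (intro mult_mono) auto
  have Q2: "Q'\<^sup>2 \<le> 16" using Q' abs_le_square_iff[of Q' 4] by simp
  have "\<bar>poisson_d2 b t\<bar> \<le> \<bar>- 2 * Q powr a\<bar> + \<bar>2 * a * (N' * Q') * Q powr (a - 1)\<bar> +
      \<bar>2 * a * N * Q powr (a - 1)\<bar> + \<bar>a * (a - 1) * N * Q'\<^sup>2 * Q powr (a - 2)\<bar>"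
    unfolding poisson_d2_def Let_def a_def[symmetric] N_def[symmetric] Q_def[symmetric]
      N'_def[symmetric] Q'_def[symmetric] by linarith
  also have "\<dots> = 2 * Q powr a + 2 * \<bar>a\<bar> * (\<bar>N'\<bar> * \<bar>Q'\<bar>) * Q powr (a - 1) +
      2 * \<bar>a\<bar> * \<bar>N\<bar> * Q powr (a - 1) + \<bar>a * (a - 1)\<bar> * \<bar>N\<bar> * Q'\<^sup>2 * Q powr (a - 2)"
    by (simp add: abs_mult)
  also have "\<dots> \<le> 2 * q powr a + 2 * \<bar>a\<bar> * (2 * 4) * q powr (a - 1) +
      2 * \<bar>a\<bar> * 1 * q powr (a - 1) + \<bar>a * (a - 1)\<bar> * 1 * 16 * q powr (a - 2)"
  proof (rule add_mono[OF add_mono[OF add_mono]])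
    show "2 * Q powr a \<le> 2 * q powr a" using P[of 0] by simp
    show "2 * \<bar>a\<bar> * (\<bar>N'\<bar> * \<bar>Q'\<bar>) * Q powr (a - 1) \<le> 2 * \<bar>a\<bar> * (2 * 4) * q powr (a - 1)"
      by (rule mult_mono[OF mult_left_mono[OF NQ] P]) auto
    show "2 * \<bar>a\<bar> * \<bar>N\<bar> * Q powr (a - 1) \<le> 2 * \<bar>a\<bar> * 1 * q powr (a - 1)"
      by (rule mult_mono[OF mult_left_mono[OF N] P]) auto
    show "\<bar>a * (a - 1)\<bar> * \<bar>N\<bar> * Q'\<^sup>2 * Q powr (a - 2) \<le> \<bar>a * (a - 1)\<bar> * 1 * 16 * q powr (a - 2)"
      by (rule mult_mono[OF mult_mono[OF mult_left_mono[OF N] Q2] P]) auto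
  qed
  finally show ?thesis by simp
qed

end

text \<open>
  The bound is uniform in \<open>h\<close> and \<open>z\<close>, which makes it a dominating constant for the integral over \<open>z\<close>.
\<close>

lemma poisson_second_difference_bound:
  fixes x :: "'a::euclidean_space"
  assumes x: "norm x < 1"
  obtains B where "\<And>h z. h \<noteq> 0 \<Longrightarrow> \<bar>h\<bar> < (1 - norm x) / 2 \<Longrightarrow> z \<in> sphere 0 1 \<Longrightarrow>
    \<bar>second_difference (\<lambda>x. poisson x z) h x\<bar> \<le> B"
proof -
  define a where "a = - real DIM('a) / 2"
  define q where "q = ((1 - norm x) / 2)\<^sup>2"
  define C where "C = 2 * q powr a + 18 * \<bar>a\<bar> * q powr (a - 1) + 16 * \<bar>a * (a - 1)\<bar> * q powr (a - 2)"
  show ?thesis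
  proof (rule that)
    fix h and z :: 'a
    assume h: "h \<noteq> 0" "\<bar>h\<bar> < (1 - norm x) / 2" and z: "z \<in> sphere 0 1"
    have *: "\<bar>(poisson (x + h *\<^sub>R b) z + poisson (x - h *\<^sub>R b) z - 2 * poisson x z) / h\<^sup>2\<bar> \<le> C"
      if b: "b \<in> Basis" for b
    proof -
      obtain \<xi> where \<xi>: "\<bar>\<xi>\<bar> \<le> \<bar>h\<bar>"
        and eq: "(poisson (x + h *\<^sub>R b) z + poisson (x - h *\<^sub>R b) z - 2 * poisson x z) / h\<^sup>2 =
            (poisson_d2 x z b \<xi> + poisson_d2 x z b (- \<xi>)) / 2"
        using poisson_second_difference(2)[OF x z b h] by blast
      have "\<bar>poisson_d2 x z b \<xi>\<bar> \<le> C" "\<bar>poisson_d2 x z b (- \<xi>)\<bar> \<le> C"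
        using poisson_d2_bound[OF x z b, of \<xi>] poisson_d2_bound[OF x z b, of "- \<xi>"] \<xi> h
        by (simp_all add: C_def a_def q_def)
      then show ?thesis unfolding eq by (simp add: abs_le_iff)
    qed
    have "\<bar>second_difference (\<lambda>x. poisson x z) h x\<bar> \<le> (\<Sum>b\<in>(Basis::'a set). C)"
      unfolding second_difference_def
      by (rule order_trans[OF sum_abs sum_mono[OF *]])
    then show "\<bar>second_difference (\<lambda>x. poisson x z) h x\<bar> \<le> real DIM('a) * C" by simp
  qed
qed

lemma poisson_nonneg: "norm x < 1 \<Longrightarrow> poisson x z \<ge> 0"
  unfolding poisson_def by (auto intro!: mult_nonneg_nonneg simp: power_le_one)

lemma poisson_le:
  fixes x z :: "'a::euclidean_space"
  assumes "norm x < 1" "\<delta> > 0" "norm (x - z) \<ge> \<delta>"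
  shows "poisson x z \<le> (1 - (norm x)\<^sup>2) * \<delta>\<^sup>2 powr (- real DIM('a) / 2)"
  unfolding poisson_def using assms
  by (intro mult_left_mono powr_mono2' power_mono) (auto simp: power_le_one)

lemma norm_diff_sphere_ge:
  fixes x z :: "'a::euclidean_space"
  assumes "z \<in> sphere 0 1"
  shows "norm (x - z) \<ge> 1 - norm x"
  using norm_triangle_ineq4[of x "x - z"] assms by simp

lemma abs_poisson_le:
  fixes x z :: "'a::euclidean_space"
  assumes x: "norm x \<le> R" and R: "R < 1" and z: "z \<in> sphere 0 1"
  shows "\<bar>poisson x z\<bar> \<le> (1 - R)\<^sup>2 powr (- real DIM('a) / 2)"
proof -
  have "poisson x z \<le> (1 - (norm x)\<^sup>2) * (1 - R)\<^sup>2 powr (- real DIM('a) / 2)"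
    using assms norm_diff_sphere_ge[OF z, of x] by (intro poisson_le) auto
  also have "\<dots> \<le> 1 * (1 - R)\<^sup>2 powr (- real DIM('a) / 2)"
    by (intro mult_right_mono) auto
  finally show ?thesis using poisson_nonneg[of x z] x R by simp
qed

lemma poisson_measurable:
  "(\<lambda>z. poisson x z) \<in> borel_measurable (\<sigma> :: 'a::euclidean_space measure)"
  unfolding poisson_def by (rule borel_measurable_surface) measurable

lemma continuous_on_poisson1:
  fixes z :: "'a::euclidean_space"
  assumes "z \<in> sphere 0 1" "A \<subseteq> ball 0 1"
  shows "continuous_on A (\<lambda>x. poisson x z)"
  unfolding poisson_def using assms by (intro continuous_intros) auto

lemma continuous_on_poisson2:
  fixes x :: "'a::euclidean_space"
  assumes "norm x < 1"
  shows "continuous_on (sphere 0 1) (\<lambda>z. poisson x z)"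
  unfolding poisson_def using assms by (intro continuous_intros) auto

lemma integrable_poisson:
  fixes x :: "'a::euclidean_space"
  assumes "norm x < 1" "continuous_on (sphere 0 1) f"
  shows "integrable \<sigma> (\<lambda>z. poisson x z * f z)"
  using assms by (intro integrable_continuous_surface continuous_intros continuous_on_poisson2)

text \<open>
  The Poisson integral of \<open>f\<close>, the candidate for the harmonic function with boundary values \<open>f\<close>.
\<close>

definition poisson_int :: "('a::euclidean_space \<Rightarrow> real) \<Rightarrow> 'a \<Rightarrow> real" where
  "poisson_int f x = (LINT z|\<sigma>. poisson x z * f z)"

lemma continuous_on_poisson_int:
  fixes f :: "'a::euclidean_space \<Rightarrow> real"
  assumes f: "continuous_on (sphere 0 1) f" and R: "R < 1" and A: "A \<subseteq> cball 0 R"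
  shows "continuous_on A (poisson_int f)"
proof -
  obtain B where B: "B > 0" "\<And>z. z \<in> sphere 0 1 \<Longrightarrow> \<bar>f z\<bar> \<le> B"
    using bounded_continuous_sphere[OF f] by blast
  have A': "\<And>x. x \<in> A \<Longrightarrow> norm x \<le> R" using A by auto
  show ?thesis
    unfolding poisson_int_def
  proof (rule continuous_on_integral_surface)
    fix z :: 'a assume "z \<in> sphere 0 1"
    then show "continuous_on A (\<lambda>x. poisson x z * f z)"
      using A' R by (intro continuous_intros continuous_on_poisson1) fastforce+
  next
    fix x z :: 'a assume "x \<in> A" "z \<in> sphere 0 1"
    then show "\<bar>poisson x z * f z\<bar> \<le> (1 - R)\<^sup>2 powr (- real DIM('a) / 2) * B"
      unfolding abs_mult using A' R B by (intro mult_mono abs_poisson_le) auto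
  qed (intro borel_measurable_times poisson_measurable continuous_measurable_surface f)
qed

lemma harmonic_at_poisson_int:
  fixes f :: "'a::euclidean_space \<Rightarrow> real"
  assumes f: "continuous_on (sphere 0 1) f" and x: "norm x < 1"
  shows "harmonic_at (poisson_int f) x"
proof -
  define \<delta> where "\<delta> = (1 - norm x) / 2"
  have \<delta>: "\<delta> > 0" using x by (simp add: \<delta>_def)
  define H where "H = ball 0 \<delta> - {0::real}"
  obtain B where B: "B > 0" "\<And>z. z \<in> sphere 0 1 \<Longrightarrow> \<bar>f z\<bar> \<le> B"
    using bounded_continuous_sphere[OF f] by blast
  obtain C where C: "\<And>h z. h \<noteq> 0 \<Longrightarrow> \<bar>h\<bar> < \<delta> \<Longrightarrow> z \<in> sphere 0 1 \<Longrightarrow>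
      \<bar>second_difference (\<lambda>x. poisson x z) h x\<bar> \<le> C"
    using poisson_second_difference_bound[OF x] unfolding \<delta>_def by blast
  have inside: "norm (x + h *\<^sub>R b) < 1" "norm (x - h *\<^sub>R b) < 1" if "b \<in> Basis" "\<bar>h\<bar> < \<delta>" for h b
    using norm_triangle_ineq[of x "h *\<^sub>R b"] norm_triangle_ineq4[of x "h *\<^sub>R b"] that \<delta>
    by (auto simp: \<delta>_def field_simps)
  have eq: "second_difference (poisson_int f) h x =
      (LINT z|\<sigma>. second_difference (\<lambda>x. poisson x z) h x * f z)" if h: "\<bar>h\<bar> < \<delta>" for h
  proof -
    have int: "integrable \<sigma> (\<lambda>z. poisson (x + h *\<^sub>R b) z * f z)"
        "integrable \<sigma> (\<lambda>z. poisson (x - h *\<^sub>R b) z * f z)"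
        "integrable \<sigma> (\<lambda>z. poisson x z * f z)" if "b \<in> Basis" for b
      using inside[OF that h] x by (auto intro!: integrable_poisson[OF _ f])
    have "(LINT z|\<sigma>. second_difference (\<lambda>x. poisson x z) h x * f z) =
       (LINT z|\<sigma>. (\<Sum>b\<in>Basis. (poisson (x + h *\<^sub>R b) z * f z + poisson (x - h *\<^sub>R b) z * f z
          - 2 * (poisson x z * f z)) / h\<^sup>2))"
      unfolding second_difference_def sum_distrib_right
      by (intro Bochner_Integration.integral_cong sum.cong refl) (simp add: algebra_simps)
    also have "\<dots> = second_difference (poisson_int f) h x"
      unfolding second_difference_def poisson_int_def
    proof (subst Bochner_Integration.integral_sum)
      fix b :: 'a assume "b \<in> Basis"
      then show "integrable \<sigma> (\<lambda>z. (poisson (x + h *\<^sub>R b) z * f z + poisson (x - h *\<^sub>R b) z * f z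
          - 2 * (poisson x z * f z)) / h\<^sup>2)"
        using int(1,2)[of b] int(3)[of b] by simp
    qed (rule sum.cong, use int in simp_all)
    finally show ?thesis by simp
  qed
  have "((\<lambda>h. LINT z|\<sigma>. second_difference (\<lambda>x. poisson x z) h x * f z) \<longlongrightarrow> (LINT z|\<sigma>. (0::real) * f z))
      (at 0 within ball 0 \<delta>)"
  proof (rule tendsto_integral_surface)
    fix z :: 'a assume z: "z \<in> sphere 0 1"
    show "((\<lambda>h. second_difference (\<lambda>x. poisson x z) h x * f z) \<longlongrightarrow> 0 * f z) (at 0 within ball 0 \<delta>)"
      using harmonic_at_poisson[OF x z] unfolding harmonic_at_def
      by (intro tendsto_mult tendsto_const) (rule tendsto_within_subset, auto)
  next
    fix h :: real and z :: 'a assume "h \<in> ball 0 \<delta> - {0}" "z \<in> sphere 0 1"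
    then show "\<bar>second_difference (\<lambda>x. poisson x z) h x * f z\<bar> \<le> C * B"
      unfolding abs_mult using C[of h z] B(2)[of z] by (intro mult_mono) auto
  next
    fix h :: real
    show "(\<lambda>z. second_difference (\<lambda>x. poisson x z) h x * f z) \<in> borel_measurable \<sigma>"
      unfolding second_difference_def
      by (intro borel_measurable_times borel_measurable_sum borel_measurable_divide borel_measurable_diff
          borel_measurable_add poisson_measurable borel_measurable_const continuous_measurable_surface f)
  qed simp
  then have "((\<lambda>h. LINT z|\<sigma>. second_difference (\<lambda>x. poisson x z) h x * f z) \<longlongrightarrow> 0) (at 0)"
    using \<delta> by (simp add: at_within_open[of 0 "ball 0 \<delta>"])
  moreover have "eventually (\<lambda>h. (LINT z|\<sigma>. second_difference (\<lambda>x. poisson x z) h x * f z) =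
      second_difference (poisson_int f) h x) (at 0)"
    unfolding eventually_at using \<delta> eq by (intro exI[of _ \<delta>]) auto
  ultimately show ?thesis
    unfolding harmonic_at_def by (rule Lim_transform_eventually)
qed

text \<open>
  The function is harmonic and, by the rotation invariance of the surface measure, radial. The maximum
  principle for it and its negative on the ball of radius \<open>|x|\<close> shows that its value at \<open>x\<close> is the one at
  the centre, where the kernel is constant.
\<close>

lemma poisson_int_one:
  fixes x :: "'a::euclidean_space"
  assumes x: "norm x < 1"
  shows "poisson_int (\<lambda>_. 1) x = 1"
proof -
  define v :: "'a \<Rightarrow> real" where "v = poisson_int (\<lambda>_. 1)"
  define R where "R = norm x"
  have zero: "v 0 = 1"
  proof -
    have "poisson_int (\<lambda>_. 1) (0::'a) = (LINT z|(\<sigma>::'a measure). 1)"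
      unfolding poisson_int_def by (intro Bochner_Integration.integral_cong) (auto simp: poisson_def)
    then show ?thesis by (simp add: v_def)
  qed
  have radial: "v y = v x" if "norm y = norm x" for y
  proof -
    obtain U where U: "orthogonal_transformation U" "U x = y"
      using reflection_exists[of x y] \<open>norm y = norm x\<close> by metis
    have inv: "poisson (U x) (U z) = poisson x z" for z
    proof -
      have "U x - U z = U (x - z)"
        using U(1) by (simp add: linear_diff orthogonal_transformation_linear)
      then show ?thesis by (simp add: poisson_def orthogonal_transformation_norm[OF U(1)])
    qed
    have "v y = (LINT z|\<sigma>. poisson (U x) z)" by (simp add: v_def poisson_int_def U)
    also have "\<dots> = (LINT z|\<sigma>. poisson (U x) (U z))"
      by (rule integral_surface_orthogonal[OF U(1) poisson_measurable, symmetric])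
    finally show ?thesis by (simp add: inv v_def poisson_int_def)
  qed
  have cont: "continuous_on (cball 0 R) v"
    unfolding v_def by (rule continuous_on_poisson_int[of _ R]) (use x in \<open>auto simp: R_def\<close>)
  have harm: "harmonic_at v y" if "y \<in> ball 0 R" for y
    unfolding v_def using that x by (intro harmonic_at_poisson_int) (auto simp: R_def)
  have bd: "v y = v x" if "y \<in> sphere 0 R" for y
    using that by (intro radial) (simp add: R_def)
  have 0: "0 \<in> cball (0::'a) R" by (simp add: R_def)
  have "v 0 \<le> v x"
    by (rule maximum_principle[OF cont harm eq_refl[OF bd] 0])
  moreover have "- v 0 \<le> - v x"
    by (rule maximum_principle[OF continuous_on_minus[OF cont] harmonic_at_minus[OF harm] _ 0])
      (assumption, drule bd, simp)
  ultimately show ?thesis using zero by (simp add: v_def)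
qed

text \<open>
  The kernel is a probability density that concentrates near \<open>x\<close>: at distance at least \<open>\<delta>\<close> from \<open>x\<close> it is
  at most a constant times \<open>1 - r\<^sup>2\<close>, and within distance \<open>\<delta>\<close> the function \<open>f\<close> is nearly constant.
\<close>

lemma poisson_int_tendsto:
  fixes f :: "'a::euclidean_space \<Rightarrow> real"
  assumes f: "continuous_on (sphere 0 1) f" and \<epsilon>: "\<epsilon> > 0"
  obtains R where "0 < R" "R < 1"
    "\<And>r x. R < r \<Longrightarrow> r < 1 \<Longrightarrow> x \<in> sphere 0 1 \<Longrightarrow> \<bar>poisson_int f (r *\<^sub>R x) - f x\<bar> \<le> \<epsilon>"
proof -
  obtain B where B: "B > 0" "\<And>z. z \<in> sphere 0 1 \<Longrightarrow> \<bar>f z\<bar> \<le> B"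
    using bounded_continuous_sphere[OF f] by blast
  have "uniformly_continuous_on (sphere 0 1) f"
    by (rule compact_uniformly_continuous[OF f]) simp
  then obtain \<delta> where \<delta>: "\<delta> > 0"
    and uc: "\<And>x z. x \<in> sphere 0 1 \<Longrightarrow> z \<in> sphere 0 1 \<Longrightarrow> norm (x - z) < \<delta> \<Longrightarrow> \<bar>f z - f x\<bar> < \<epsilon> / 2"
    unfolding uniformly_continuous_on_def dist_real_def dist_norm using \<epsilon>
    by (metis half_gt_zero norm_minus_commute abs_minus_commute)
  define C where "C = (\<delta> / 2)\<^sup>2 powr (- real DIM('a) / 2)"
  have C: "C \<ge> 0" by (simp add: C_def)
  \<comment> \<open>Since \<open>1 - r\<^sup>2 \<le> 2 \<eta>\<close>, the last bound gives \<open>(1 - r\<^sup>2) C (2 B) \<le> \<epsilon> / 2\<close>.\<close>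
  define \<eta> where "\<eta> = min (1/2) (min (\<delta> / 2) (\<epsilon> / (8 * B * C + 1)))"
  have "8 * B * C + 1 > 0" using B C by (simp add: add_nonneg_pos)
  moreover have "\<eta> \<le> 1/2" "\<eta> \<le> \<delta> / 2" "\<eta> \<le> \<epsilon> / (8 * B * C + 1)"
    unfolding \<eta>_def by linarith+
  moreover have "\<eta> > 0" using \<open>8 * B * C + 1 > 0\<close> \<delta> \<epsilon> by (simp add: \<eta>_def)
  ultimately have \<eta>: "\<eta> > 0" "\<eta> \<le> 1/2" "\<eta> \<le> \<delta> / 2" "\<eta> * (8 * B * C + 1) \<le> \<epsilon>"
    by (simp_all add: pos_le_divide_eq)
  show ?thesis
  proof (rule that[of "1 - \<eta>"])
    fix r and x :: 'a assume r: "1 - \<eta> < r" "r < 1" and x: "x \<in> sphere 0 1"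
    have r0: "r > 0" using r \<eta> by linarith
    have nrx: "norm (r *\<^sub>R x) = r" using r0 x by simp
    have pt: "\<bar>poisson (r *\<^sub>R x) z * (f z - f x)\<bar> \<le> \<epsilon> / 2 * poisson (r *\<^sub>R x) z + (1 - r\<^sup>2) * C * (2 * B)"
      if z: "z \<in> sphere 0 1" for z
    proof -
      have p0: "poisson (r *\<^sub>R x) z \<ge> 0" using nrx r by (intro poisson_nonneg) simp
      have r2: "1 - r\<^sup>2 \<ge> 0" using r r0 by (simp add: power_le_one)
      show ?thesis
      proof (cases "norm (x - z) < \<delta>")
        case True
        then have "\<bar>f z - f x\<bar> \<le> \<epsilon> / 2" using uc[OF x z] by simp
        then have "poisson (r *\<^sub>R x) z * \<bar>f z - f x\<bar> \<le> poisson (r *\<^sub>R x) z * (\<epsilon> / 2)"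
          using p0 by (intro mult_left_mono)
        moreover have "(1 - r\<^sup>2) * C * (2 * B) \<ge> 0"
          using r2 C B by (intro mult_nonneg_nonneg) auto
        moreover have "\<bar>poisson (r *\<^sub>R x) z * (f z - f x)\<bar> = poisson (r *\<^sub>R x) z * \<bar>f z - f x\<bar>"
          using p0 by (simp add: abs_mult)
        ultimately show ?thesis by (simp only: mult.commute[of _ "\<epsilon> / 2"])
      next
        case False
        have "norm (x - z) \<le> norm (x - r *\<^sub>R x) + norm (r *\<^sub>R x - z)"
          using norm_triangle_ineq[of "x - r *\<^sub>R x" "r *\<^sub>R x - z"] by simp
        moreover have "norm (x - r *\<^sub>R x) = 1 - r"
        proof -
          have "x - r *\<^sub>R x = (1 - r) *\<^sub>R x" by (simp add: scaleR_diff_left)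
          then show ?thesis using x r by simp
        qed
        ultimately have "norm (r *\<^sub>R x - z) \<ge> \<delta> / 2" using False r \<eta> by linarith
        then have "poisson (r *\<^sub>R x) z \<le> (1 - r\<^sup>2) * C"
          using poisson_le[of "r *\<^sub>R x" "\<delta> / 2" z] nrx r \<delta> by (simp add: C_def)
        moreover have "\<bar>f z - f x\<bar> \<le> 2 * B"
          using B(2)[OF x] B(2)[OF z] by (simp add: abs_le_iff)
        ultimately have "poisson (r *\<^sub>R x) z * \<bar>f z - f x\<bar> \<le> (1 - r\<^sup>2) * C * (2 * B)"
          using p0 r2 C by (intro mult_mono) auto
        moreover have "\<epsilon> / 2 * poisson (r *\<^sub>R x) z \<ge> 0" using p0 \<epsilon> by simp
        ultimately show ?thesis using p0 by (simp add: abs_mult)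
      qed
    qed
    have int1: "integrable \<sigma> (\<lambda>z. poisson (r *\<^sub>R x) z)"
      using integrable_poisson[of "r *\<^sub>R x" "\<lambda>_. 1"] nrx r by simp
    have intf: "integrable \<sigma> (\<lambda>z. poisson (r *\<^sub>R x) z * f z)"
      using integrable_poisson[of "r *\<^sub>R x" f] nrx r f by simp
    have one: "(LINT z|\<sigma>. poisson (r *\<^sub>R x) z) = 1"
      using poisson_int_one[of "r *\<^sub>R x"] nrx r by (simp add: poisson_int_def)
    have "poisson_int f (r *\<^sub>R x) - f x = (LINT z|\<sigma>. poisson (r *\<^sub>R x) z * (f z - f x))"
      using int1 intf one by (simp add: poisson_int_def right_diff_distrib)
    also have "\<bar>\<dots>\<bar> \<le> (LINT z|\<sigma>. \<bar>poisson (r *\<^sub>R x) z * (f z - f x)\<bar>)"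
      by (rule integral_abs_bound)
    also have "\<dots> \<le> (LINT z|\<sigma>. \<epsilon> / 2 * poisson (r *\<^sub>R x) z + (1 - r\<^sup>2) * C * (2 * B))"
    proof (rule integral_mono)
      show "integrable \<sigma> (\<lambda>z. \<bar>poisson (r *\<^sub>R x) z * (f z - f x)\<bar>)"
        using int1 intf by (simp add: right_diff_distrib)
    qed (use int1 pt in auto)
    also have "\<dots> = \<epsilon> / 2 + (1 - r\<^sup>2) * C * (2 * B)"
      using int1 one by simp
    also have "(1 - r\<^sup>2) * C * (2 * B) \<le> (2 * \<eta>) * C * (2 * B)"
    proof -
      have "1 - r\<^sup>2 = (1 - r) * (1 + r)" by (simp add: power2_eq_square algebra_simps)
      also have "\<dots> \<le> \<eta> * 2" using r r0 by (intro mult_mono) auto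
      finally show ?thesis using C B by (intro mult_right_mono) auto
    qed
    also have "(2 * \<eta>) * C * (2 * B) \<le> \<epsilon> / 2"
      using \<eta> by (simp add: algebra_simps)
    finally show "\<bar>poisson_int f (r *\<^sub>R x) - f x\<bar> \<le> \<epsilon>" by simp
  qed (use \<eta> in auto)
qed

text \<open>
  The difference of the two sides is harmonic and small on spheres of radius close to \<open>1\<close>, hence small
  inside them by the maximum principle.
\<close>

theorem poisson_formula:
  fixes u :: "'a::euclidean_space \<Rightarrow> real"
  assumes cont: "continuous_on (cball 0 1) u"
    and harm: "\<And>x. norm x < 1 \<Longrightarrow> harmonic_at u x"
    and x: "norm x < 1"
  shows "poisson_int u x = u x"
proof -
  have contS: "continuous_on (sphere 0 1) u"
    using cont by (rule continuous_on_subset) auto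
  have "\<bar>poisson_int u x - u x\<bar> \<le> \<epsilon>" if \<epsilon>: "\<epsilon> > 0" for \<epsilon>
  proof -
    obtain R1 where R1: "0 < R1" "R1 < 1"
      "\<And>r x. R1 < r \<Longrightarrow> r < 1 \<Longrightarrow> x \<in> sphere 0 1 \<Longrightarrow> \<bar>poisson_int u (r *\<^sub>R x) - u x\<bar> \<le> \<epsilon> / 2"
      using poisson_int_tendsto[OF contS, of "\<epsilon> / 2"] \<epsilon> by (metis half_gt_zero)
    have "uniformly_continuous_on (cball 0 1) u"
      by (rule compact_uniformly_continuous[OF cont]) simp
    then obtain \<delta> where \<delta>: "\<delta> > 0"
      and uc: "\<And>x z. x \<in> cball 0 1 \<Longrightarrow> z \<in> cball 0 1 \<Longrightarrow> norm (x - z) < \<delta> \<Longrightarrow> \<bar>u x - u z\<bar> < \<epsilon> / 2"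
      unfolding uniformly_continuous_on_def dist_real_def dist_norm using \<epsilon>
      by (metis half_gt_zero norm_minus_commute abs_minus_commute)
    define R where "R = (1 + Max {R1, norm x, 1 - \<delta>}) / 2"
    have R: "R1 < R" "norm x < R" "1 - \<delta> < R" "R < 1"
      using R1 x \<delta> by (auto simp: R_def)
    define w where "w y = poisson_int u y - u y" for y
    have cw: "continuous_on (cball 0 R) w"
      unfolding w_def using R
      by (intro continuous_on_diff continuous_on_poisson_int[OF contS, of R] continuous_on_subset[OF cont]) auto
    have hw: "harmonic_at w y" if "y \<in> ball 0 R" for y
      unfolding w_def using that R
      by (intro harmonic_at_diff harmonic_at_poisson_int[OF contS] harm) auto
    have bd: "\<bar>w y\<bar> \<le> \<epsilon>" if y: "y \<in> sphere 0 R" for y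
    proof -
      define e where "e = (1 / R) *\<^sub>R y"
      have R0: "R > 0" using R R1 by linarith
      have e: "e \<in> sphere 0 1" "y = R *\<^sub>R e" using R0 y by (auto simp: e_def)
      have "\<bar>poisson_int u y - u e\<bar> \<le> \<epsilon> / 2"
        unfolding e(2) using R1(3)[of R e] R e by simp
      moreover have "\<bar>u e - u y\<bar> < \<epsilon> / 2"
      proof (rule uc)
        have "e - y = (1 - R) *\<^sub>R e" by (simp add: e(2) scaleR_diff_left)
        then show "norm (e - y) < \<delta>" using e(1) R by simp
      qed (use e y R in auto)
      ultimately show ?thesis unfolding w_def by linarith
    qed
    have xR: "x \<in> cball 0 R" using R by simp
    have "w x \<le> \<epsilon>"
      by (rule maximum_principle[OF cw hw _ xR]) (use bd in \<open>auto simp: abs_le_iff\<close>)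
    moreover have "- w x \<le> \<epsilon>"
      by (rule maximum_principle[OF continuous_on_minus[OF cw] harmonic_at_minus[OF hw] _ xR])
        (use bd in \<open>auto simp: abs_le_iff\<close>)
    ultimately show ?thesis by (simp add: w_def)
  qed
  then have "\<bar>poisson_int u x - u x\<bar> \<le> 0" by (meson dense_ge)
  then show ?thesis by simp
qed

section \<open>The Poisson kernel on the sphere\<close>

lemma norm_diff_sphere_sq:
  fixes x y :: "'a::euclidean_space"
  assumes "x \<in> sphere 0 1" "y \<in> sphere 0 1"
  shows "(norm (r *\<^sub>R x - y))\<^sup>2 = (1 - r)\<^sup>2 + r * (norm (x - y))\<^sup>2"
proof -
  have "x \<bullet> x = 1" "y \<bullet> y = 1" using assms by (simp_all add: norm_eq_1)
  then show ?thesis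
    unfolding power2_norm_eq_inner
    by (simp add: inner_diff_left inner_diff_right inner_commute power2_eq_square algebra_simps)
qed

lemma poisson_sphere_eq:
  fixes x y :: "'a::euclidean_space"
  assumes "x \<in> sphere 0 1" "y \<in> sphere 0 1" "\<bar>r\<bar> < 1"
  shows "poisson (r *\<^sub>R x) y = (1 - r\<^sup>2) * ((1 - r)\<^sup>2 + r * (norm (x - y))\<^sup>2) powr (- real DIM('a) / 2)"
  unfolding poisson_def norm_diff_sphere_sq[OF assms(1,2)] using assms(1) by simp

lemma poisson_commute:
  fixes x y :: "'a::euclidean_space"
  assumes "x \<in> sphere 0 1" "y \<in> sphere 0 1" "\<bar>r\<bar> < 1"
  shows "poisson (r *\<^sub>R x) y = poisson (r *\<^sub>R y) x"
  using assms by (simp add: poisson_sphere_eq norm_minus_commute)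

text \<open>
  As a power series in \<open>r\<close>, the value on the diagonal is the generating function of the numbers
  \<open>harmonic_dim d l\<close>, see \<open>harmonic_dim_sums\<close>. This coincidence is what makes an orthonormal family of
  that size complete.
\<close>

lemma poisson_diag:
  fixes x :: "'a::euclidean_space"
  assumes x: "x \<in> sphere 0 1" and r: "0 \<le> r" "r < 1"
  shows "poisson (r *\<^sub>R x) x = (1 + r) / (1 - r) ^ (DIM('a) - 1)"
proof -
  obtain n where n: "DIM('a) = Suc n" using DIM_positive[where 'a='a] gr0_implies_Suc by blast
  have "(1 - r)\<^sup>2 powr (- real DIM('a) / 2) = (1 - r) powr (- real DIM('a))"
    using r by (simp add: powr_powr flip: powr_numeral)
  also have "\<dots> = 1 / (1 - r) ^ Suc n"
    using r by (simp add: powr_minus n powr_realpow inverse_eq_divide del: power_Suc of_nat_Suc)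
  finally have "poisson (r *\<^sub>R x) x = (1 - r\<^sup>2) / (1 - r) ^ Suc n"
    using x r by (subst poisson_sphere_eq) auto
  also have "1 - r\<^sup>2 = (1 + r) * (1 - r)" by (simp add: power2_eq_square algebra_simps)
  finally show ?thesis using r by (simp add: n)
qed

lemma spherical_harmonic_continuous:
  "spherical_harmonic l f \<Longrightarrow> continuous_on (sphere 0 1) f"
  unfolding spherical_harmonic_def
  by (metis continuous_on_cong continuous_on_polymonial_function real_polynomial_function_eq)

text \<open>
  A spherical harmonic is the restriction of a harmonic polynomial, which the Poisson formula reproduces
  in the ball; homogeneity produces the eigenvalue.
\<close>

lemma poisson_int_spherical_harmonic:
  fixes f :: "'a::euclidean_space \<Rightarrow> real"
  assumes f: "spherical_harmonic l f" and x: "x \<in> sphere 0 1" and r: "0 \<le> r" "r < 1"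
  shows "poisson_int f (r *\<^sub>R x) = r ^ l * f x"
proof -
  obtain p where p: "real_polynomial_function p" "\<And>c x. p (c *\<^sub>R x) = c ^ l * p x"
      "\<And>x. laplacian p x = 0" "\<And>x. x \<in> sphere 0 1 \<Longrightarrow> f x = p x"
    using f unfolding spherical_harmonic_def by blast
  have "poisson_int f (r *\<^sub>R x) = poisson_int p (r *\<^sub>R x)"
    unfolding poisson_int_def using p(4) by (intro Bochner_Integration.integral_cong) auto
  also have "\<dots> = p (r *\<^sub>R x)"
  proof (rule poisson_formula)
    show "continuous_on (cball 0 1) p"
      using p(1) by (simp add: continuous_on_polymonial_function real_polynomial_function_eq)
  qed (use x r p(1,3) harmonic_polynomial_imp_harmonic_at in auto)
  finally show ?thesis using p(2,4) x by simp
qed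

text \<open>
  The Poisson formula for the function \<open>\<lambda>z. poisson (s *\<^sub>R z) y\<close>, which is harmonic beyond the unit ball.
\<close>

lemma poisson_semigroup:
  fixes x y :: "'a::euclidean_space"
  assumes x: "x \<in> sphere 0 1" and y: "y \<in> sphere 0 1" and r: "0 < r" "r < 1" and s: "0 < s" "s < 1"
  shows "(LINT z|\<sigma>. poisson (r *\<^sub>R x) z * poisson (s *\<^sub>R y) z) = poisson ((r * s) *\<^sub>R x) y"
proof -
  have "(LINT z|\<sigma>. poisson (r *\<^sub>R x) z * poisson (s *\<^sub>R y) z) =
      poisson_int (\<lambda>z. poisson (s *\<^sub>R z) y) (r *\<^sub>R x)"
    unfolding poisson_int_def using y s
    by (intro Bochner_Integration.integral_cong refl arg_cong2[where f = "(*)"] poisson_commute) auto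
  also have "\<dots> = poisson (s *\<^sub>R r *\<^sub>R x) y"
  proof (rule poisson_formula)
    have "s * norm z < 1" if "norm z \<le> 1" for z :: 'a
      using mult_left_mono[OF that, of s] s by linarith
    then have "continuous_on ((\<lambda>z. s *\<^sub>R z) ` cball 0 1) (\<lambda>z. poisson z y)"
      using s y by (intro continuous_on_poisson1) auto
    then show "continuous_on (cball 0 1) (\<lambda>z. poisson (s *\<^sub>R z) y)"
      by (rule continuous_on_compose2[where g = "\<lambda>z. poisson z y"]) (auto intro!: continuous_intros)
  next
    fix z :: 'a assume "norm z < 1"
    then have "norm (s *\<^sub>R z) < 1" using s mult_strict_mono[of s 1 "norm z" 1] by simp
    then show "harmonic_at (\<lambda>z. poisson (s *\<^sub>R z) y) z"
      using s y by (intro harmonic_at_scale harmonic_at_poisson) auto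
  qed (use x r in auto)
  finally show ?thesis by (simp add: mult.commute)
qed

section \<open>Dimensions of the spaces of spherical harmonics\<close>

lemma negative_binomial_sums:
  fixes r :: real
  assumes "\<bar>r\<bar> < 1"
  shows "(\<lambda>l. real ((l + k) choose l) * r ^ l) sums (1 / (1 - r) ^ (k + 1))"
proof -
  have "(\<lambda>l. (- real (k + 1) gchoose l) * (- r) ^ l) sums (1 + - r) powr (- real (k + 1))"
    using assms by (intro gen_binomial_real) simp
  moreover have "(- real (k + 1) gchoose l) * (- r) ^ l = real ((l + k) choose l) * r ^ l" for l
  proof -
    have "(- real (k + 1) gchoose l) = (-1) ^ l * (real (k + 1) + real l - 1 gchoose l)"
      by (rule gbinomial_minus)
    also have "real (k + 1) + real l - 1 = real (l + k)" by simp
    finally have "(- real (k + 1) gchoose l) = (-1) ^ l * real ((l + k) choose l)"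
      by (simp only: binomial_gbinomial)
    then show ?thesis by (simp add: power_minus[of r])
  qed
  moreover have "(1 + - r) powr (- real (k + 1)) = 1 / (1 - r) ^ (k + 1)"
    using assms powr_realpow[of "1 - r" "k + 1"]
    by (simp only: powr_minus inverse_eq_divide) (simp add: add.commute)
  ultimately show ?thesis by (simp only:)
qed

text \<open>
  The number of monomials of degree \<open>l\<close> in \<open>d\<close> variables plus that of degree \<open>l - 1\<close>.
\<close>

lemma harmonic_dim_binomial:
  assumes d: "d \<ge> 2"
  shows "real (harmonic_dim d l) = real ((l + (d - 1)) choose l) +
    (if l = 0 then 0 else real ((l - 1 + (d - 1)) choose (l - 1)))"
proof -
  obtain n where n: "d = n + 2" using d by (metis add.commute le_Suc_ex)
  have G: "Gamma (real l + real d - 1) = fact (l + n)" "Gamma (real d) = fact (n + 1)"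
      "Gamma (real l + 1) = fact l"
    using Gamma_fact[of "l + n", where 'a = real] Gamma_fact[of "n + 1", where 'a = real]
      Gamma_fact[of l, where 'a = real] by (simp_all add: n add_ac)
  define X :: real where "X = fact (l + n) / (fact (n + 1) * fact l)"
  have "real ((l + (d - 1)) choose l) = fact (Suc (l + n)) / (fact l * fact (n + 1))"
    using binomial_fact[of l "l + (d - 1)", where 'a = real] by (simp add: n)
  then have 1: "real ((l + (d - 1)) choose l) = (real l + real n + 1) * X"
    by (simp add: X_def field_simps)
  have 2: "(if l = 0 then 0 else real ((l - 1 + (d - 1)) choose (l - 1))) = real l * X"
  proof (cases l)
    case (Suc m)
    have "real ((m + (d - 1)) choose m) = fact (l + n) / (fact m * fact (n + 1))"
      using binomial_fact[of m "m + (d - 1)", where 'a = real] by (simp add: n Suc)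
    also have "\<dots> = real l * X"
      unfolding X_def Suc by (simp add: field_simps del: of_nat_Suc)
    finally show ?thesis by (simp add: Suc)
  qed simp
  show ?thesis
    unfolding harmonic_dim_eq[OF d] G 1 2 X_def[symmetric] by (simp add: n algebra_simps)
qed

lemma harmonic_dim_sums:
  fixes r :: real
  assumes d: "d \<ge> 2" and r: "\<bar>r\<bar> < 1"
  shows "(\<lambda>l. real (harmonic_dim d l) * r ^ l) sums ((1 + r) / (1 - r) ^ d)"
proof -
  define C where "C l = real ((l + (d - 1)) choose l) * r ^ l" for l
  have C: "C sums (1 / (1 - r) ^ d)"
    using negative_binomial_sums[OF r, of "d - 1"] d unfolding C_def by simp
  have "(\<lambda>l. if Suc l = 0 then 0 else r * C (Suc l - 1)) sums (r * (1 / (1 - r) ^ d))"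
    using sums_mult[OF C, of r] by simp
  then have "(\<lambda>l. if l = 0 then 0 else r * C (l - 1)) sums (r * (1 / (1 - r) ^ d))"
    by (subst (asm) sums_Suc_iff) simp
  from sums_add[OF C this]
  have "(\<lambda>l. C l + (if l = 0 then 0 else r * C (l - 1))) sums ((1 + r) / (1 - r) ^ d)"
    by (simp add: add_divide_distrib)
  moreover have "C l + (if l = 0 then 0 else r * C (l - 1)) = real (harmonic_dim d l) * r ^ l" for l
    unfolding harmonic_dim_binomial[OF d] C_def by (cases l) (simp_all add: algebra_simps)
  ultimately show ?thesis by simp
qed

lemma harmonic_dim_0: "d \<ge> 2 \<Longrightarrow> harmonic_dim d 0 = 1"
  using harmonic_dim_binomial[of d 0] by simp

section \<open>Expansions in spherical harmonics\<close>

lemma bessel_identity: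
  fixes e :: "'i \<Rightarrow> 'a::euclidean_space \<Rightarrow> real"
  assumes I: "finite I" and e: "\<And>i. i \<in> I \<Longrightarrow> continuous_on (sphere 0 1) (e i)"
    and ortho: "\<And>i j. i \<in> I \<Longrightarrow> j \<in> I \<Longrightarrow> (LINT x|\<sigma>. e i x * e j x) = (if i = j then 1 else 0)"
    and f: "continuous_on (sphere 0 1) f"
    and c: "\<And>i. i \<in> I \<Longrightarrow> (LINT x|\<sigma>. f x * e i x) = c i"
  shows "(LINT x|\<sigma>. (f x - (\<Sum>i\<in>I. c i * e i x))\<^sup>2) = (LINT x|\<sigma>. (f x)\<^sup>2) - (\<Sum>i\<in>I. (c i)\<^sup>2)"
proof -
  note int = integrable_continuous_surface
  have i1: "integrable \<sigma> (\<lambda>x. (f x)\<^sup>2)" by (intro int continuous_intros f)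
  have i2: "integrable \<sigma> (\<lambda>x. f x * e i x)" if "i \<in> I" for i by (intro int continuous_intros f e that)
  have i3: "integrable \<sigma> (\<lambda>x. e i x * e j x)" if "i \<in> I" "j \<in> I" for i j by (intro int continuous_intros e that)
  have "(LINT x|\<sigma>. (f x - (\<Sum>i\<in>I. c i * e i x))\<^sup>2) =
      (LINT x|\<sigma>. (f x)\<^sup>2 - (\<Sum>i\<in>I. 2 * c i * (f x * e i x)) + (\<Sum>i\<in>I. \<Sum>j\<in>I. c i * c j * (e i x * e j x)))"
  proof (intro Bochner_Integration.integral_cong refl)
    fix x
    have "(\<Sum>i\<in>I. c i * e i x)\<^sup>2 = (\<Sum>i\<in>I. \<Sum>j\<in>I. c i * c j * (e i x * e j x))"
      unfolding power2_eq_square sum_product by (intro sum.cong refl) simp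
    moreover have "2 * f x * (\<Sum>i\<in>I. c i * e i x) = (\<Sum>i\<in>I. 2 * c i * (f x * e i x))"
      unfolding sum_distrib_left by (intro sum.cong refl) simp
    ultimately show "(f x - (\<Sum>i\<in>I. c i * e i x))\<^sup>2 =
        (f x)\<^sup>2 - (\<Sum>i\<in>I. 2 * c i * (f x * e i x)) + (\<Sum>i\<in>I. \<Sum>j\<in>I. c i * c j * (e i x * e j x))"
      by (simp add: power2_diff)
  qed
  also have "\<dots> = (LINT x|\<sigma>. (f x)\<^sup>2) - (\<Sum>i\<in>I. 2 * c i * (LINT x|\<sigma>. f x * e i x)) +
      (\<Sum>i\<in>I. \<Sum>j\<in>I. c i * c j * (LINT x|\<sigma>. e i x * e j x))"
    using i1 i2 i3 by (simp add: Bochner_Integration.integral_sum)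
  also have "(\<Sum>i\<in>I. 2 * c i * (LINT x|\<sigma>. f x * e i x)) = 2 * (\<Sum>i\<in>I. (c i)\<^sup>2)"
    unfolding sum_distrib_left by (intro sum.cong refl) (simp add: c power2_eq_square)
  also have "(\<Sum>i\<in>I. \<Sum>j\<in>I. c i * c j * (LINT x|\<sigma>. e i x * e j x)) = (\<Sum>i\<in>I. (c i)\<^sup>2)"
  proof (intro sum.cong refl)
    fix i assume i: "i \<in> I"
    have "(\<Sum>j\<in>I. c i * c j * (LINT x|\<sigma>. e i x * e j x)) = (\<Sum>j\<in>I. if i = j then c i * c j else 0)"
      by (intro sum.cong refl) (simp add: ortho i)
    then show "(\<Sum>j\<in>I. c i * c j * (LINT x|\<sigma>. e i x * e j x)) = (c i)\<^sup>2"
      using i I by (simp add: power2_eq_square)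
  qed
  finally show ?thesis by simp
qed

text \<open>
  The error is kept with its sign, so that it is linear in \<open>f\<close>.
\<close>

definition quad_err :: "'a::euclidean_space set \<Rightarrow> ('a \<Rightarrow> real) \<Rightarrow> real" where
  "quad_err X f = 1 / real (card X) * (\<Sum>x\<in>X. f x) - (LINT x|\<sigma>. f x)"

lemma quad_err_bound:
  fixes f :: "'a::euclidean_space \<Rightarrow> real"
  assumes X: "finite X" "X \<noteq> {}" "X \<subseteq> sphere 0 1" and f: "f \<in> borel_measurable \<sigma>"
    and B: "\<And>x. x \<in> sphere 0 1 \<Longrightarrow> \<bar>f x\<bar> \<le> B"
  shows "\<bar>quad_err X f\<bar> \<le> 2 * B"
proof -
  have "\<bar>\<Sum>x\<in>X. f x\<bar> \<le> (\<Sum>x\<in>X. B)"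
    using X B by (intro order_trans[OF sum_abs] sum_mono) auto
  then have "\<bar>1 / real (card X) * (\<Sum>x\<in>X. f x)\<bar> \<le> B"
    using X by (simp add: abs_mult field_simps card_gt_0_iff)
  moreover have "\<bar>LINT x|\<sigma>. f x\<bar> \<le> B" by (rule abs_integral_surface_le[OF f B])
  ultimately show ?thesis unfolding quad_err_def by linarith
qed

lemma quad_err_diff:
  "integrable \<sigma> f \<Longrightarrow> integrable \<sigma> g \<Longrightarrow> quad_err X (\<lambda>x. f x - g x) = quad_err X f - quad_err X g"
  by (simp add: quad_err_def sum_subtractf algebra_simps diff_divide_distrib)

lemma quad_err_sum:
  assumes "\<And>i. i \<in> I \<Longrightarrow> integrable \<sigma> (f i)"
  shows "quad_err X (\<lambda>x. \<Sum>i\<in>I. c i * f i x) = (\<Sum>i\<in>I. c i * quad_err X (f i))"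
proof -
  have "(\<Sum>x\<in>X. \<Sum>i\<in>I. c i * f i x) = (\<Sum>i\<in>I. c i * (\<Sum>x\<in>X. f i x))"
    unfolding sum_distrib_left by (rule sum.swap)
  then show ?thesis using assms
    by (simp add: quad_err_def Bochner_Integration.integral_sum right_diff_distrib sum_subtractf
        sum_distrib_left mult.left_commute)
qed

locale harmonic_basis =
  fixes d :: nat and Y :: "nat \<Rightarrow> nat \<Rightarrow> 'a::euclidean_space \<Rightarrow> real"
  assumes dim: "DIM('a) = d + 1" and d: "d \<ge> 2" and ortho: "orthonormal_harmonics d Y"
begin

text \<open>
  The pairs \<open>(l, k)\<close> that index the harmonics of degree at most \<open>L\<close>. Degree \<open>0\<close> is left out of \<open>idx1\<close>:
  the constants are integrated exactly by every point set.
\<close>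

definition idx :: "nat \<Rightarrow> (nat \<times> nat) set" where
  "idx L = (SIGMA l:{..L}. {1..harmonic_dim d l})"

definition idx1 :: "nat \<Rightarrow> (nat \<times> nat) set" where
  "idx1 L = (SIGMA l:{1..L}. {1..harmonic_dim d l})"

lemma finite_idx [simp]: "finite (idx L)" by (simp add: idx_def)
lemma finite_idx1 [simp]: "finite (idx1 L)" by (simp add: idx1_def)

lemma idx_split: "idx L = insert (0, 1) (idx1 L)"
  by (auto simp: idx_def idx1_def harmonic_dim_0[OF d] not_less_eq_eq le_Suc_eq Suc_le_eq)

lemma spherical_harmonic_Y: "k \<in> {1..harmonic_dim d l} \<Longrightarrow> spherical_harmonic l (Y l k)"
  using ortho by (simp add: orthonormal_harmonics_def)

lemma continuous_Y: "k \<in> {1..harmonic_dim d l} \<Longrightarrow> continuous_on (sphere 0 1) (Y l k)"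
  by (rule spherical_harmonic_continuous[OF spherical_harmonic_Y])

lemma continuous_Y_idx: "i \<in> idx L \<Longrightarrow> continuous_on (sphere 0 1) (\<lambda>x. Y (fst i) (snd i) x)"
  using continuous_Y by (auto simp: idx_def)

lemma ortho_Y:
  "k \<in> {1..harmonic_dim d l} \<Longrightarrow> k' \<in> {1..harmonic_dim d l'} \<Longrightarrow>
    (LINT x|\<sigma>. Y l k x * Y l' k' x) = (if l = l' \<and> k = k' then 1 else 0)"
  using ortho by (simp add: orthonormal_harmonics_def)

lemma ortho_Y_idx:
  "i \<in> idx L \<Longrightarrow> j \<in> idx L \<Longrightarrow>
    (LINT x|\<sigma>. Y (fst i) (snd i) x * Y (fst j) (snd j) x) = (if i = j then 1 else 0)"
  using ortho_Y by (cases i, cases j) (simp add: idx_def)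

lemma Y0_const:
  obtains c where "\<And>x. x \<in> sphere 0 1 \<Longrightarrow> Y 0 1 x = c" "c\<^sup>2 = 1"
proof -
  have 1: "1 \<in> {1..harmonic_dim d 0}" using harmonic_dim_0[OF d] by simp
  from spherical_harmonic_Y[OF this]
  obtain p where p: "\<And>c x. p (c *\<^sub>R x) = c ^ 0 * p x" "\<And>x. x \<in> sphere 0 1 \<Longrightarrow> Y 0 1 x = p x"
    unfolding spherical_harmonic_def by blast
  have "p x = p 0" for x using p(1)[of 0 x] by simp
  then have const: "\<And>x. x \<in> sphere 0 1 \<Longrightarrow> Y 0 1 x = p 0" using p(2) by metis
  have "1 = (LINT x|\<sigma>. Y 0 1 x * Y 0 1 x)" using ortho_Y[OF 1 1] by simp
  also have "\<dots> = (LINT x|(\<sigma>::'a measure). (p 0)\<^sup>2)"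
    by (intro Bochner_Integration.integral_cong) (auto simp: const power2_eq_square simp del: One_nat_def)
  finally show ?thesis using const by (intro that[of "p 0"]) auto
qed

lemma integral_Y:
  assumes l: "l \<ge> 1" and k: "k \<in> {1..harmonic_dim d l}"
  shows "(LINT x|\<sigma>. Y l k x) = 0"
proof -
  obtain c where c: "\<And>x. x \<in> sphere 0 1 \<Longrightarrow> Y 0 1 x = c" "c\<^sup>2 = 1" using Y0_const by blast
  have 1: "1 \<in> {1..harmonic_dim d 0}" using harmonic_dim_0[OF d] by simp
  have "0 = (LINT x|\<sigma>. Y 0 1 x * Y l k x)" using ortho_Y[OF 1 k] l by simp
  also have "\<dots> = (LINT x|\<sigma>. c * Y l k x)"
    by (intro Bochner_Integration.integral_cong) (auto simp: c(1) simp del: One_nat_def)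
  finally show ?thesis using c(2) by auto
qed

lemma quad_err_Y0:
  assumes X: "finite X" "X \<noteq> {}" "X \<subseteq> sphere 0 1"
  shows "quad_err X (Y 0 1) = 0"
proof -
  obtain c where c: "\<And>x. x \<in> sphere 0 1 \<Longrightarrow> Y 0 1 x = c" using Y0_const by blast
  have "(LINT x|\<sigma>. Y 0 1 x) = (LINT x|(\<sigma>::'a measure). c)"
    by (intro Bochner_Integration.integral_cong) (auto simp: c simp del: One_nat_def)
  moreover have "(\<Sum>x\<in>X. Y 0 1 x) = (\<Sum>x\<in>X. c)" using X by (intro sum.cong) (auto simp: c simp del: One_nat_def)
  ultimately show ?thesis using X by (simp add: quad_err_def)
qed

lemma sum_idx1: "(\<Sum>i\<in>idx1 L. g (fst i) (snd i)) = (\<Sum>l=1..L. \<Sum>k=1..harmonic_dim d l. g l k)"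
  unfolding idx1_def by (simp add: sum.Sigma case_prod_unfold)

lemma sum_idx: "(\<Sum>i\<in>idx L. g (fst i) (snd i)) = (\<Sum>l\<le>L. \<Sum>k=1..harmonic_dim d l. g l k)"
  unfolding idx_def by (simp add: sum.Sigma case_prod_unfold)

context
  fixes r :: real
  assumes r: "0 < r" "r < 1"
begin

definition partial_kernel :: "nat \<Rightarrow> 'a \<Rightarrow> 'a \<Rightarrow> real" where
  "partial_kernel L x z = (\<Sum>i\<in>idx L. r ^ fst i * Y (fst i) (snd i) x * Y (fst i) (snd i) z)"

lemma r_inside: "x \<in> sphere 0 1 \<Longrightarrow> norm (r *\<^sub>R x) < 1"
  using r by simp

lemma poisson_coeff:
  assumes x: "x \<in> sphere 0 1" and i: "i \<in> idx L"
  shows "(LINT z|\<sigma>. poisson (r *\<^sub>R x) z * Y (fst i) (snd i) z) = r ^ fst i * Y (fst i) (snd i) x"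
  using poisson_int_spherical_harmonic[OF spherical_harmonic_Y x, of "snd i" "fst i" r] i r
  by (auto simp: poisson_int_def idx_def)

text \<open>
  Bessel's identity for the kernel as a function of its second argument. The semigroup property evaluates
  the square norm of the kernel as the value of another Poisson kernel on the diagonal.
\<close>

lemma kernel_remainder:
  assumes x: "x \<in> sphere 0 1"
  shows "(LINT z|\<sigma>. (poisson (r *\<^sub>R x) z - partial_kernel L x z)\<^sup>2) =
    (1 + r\<^sup>2) / (1 - r\<^sup>2) ^ d - (\<Sum>i\<in>idx L. (r ^ fst i * Y (fst i) (snd i) x)\<^sup>2)"
proof -
  have "(LINT z|\<sigma>. (poisson (r *\<^sub>R x) z - partial_kernel L x z)\<^sup>2) =
      (LINT z|\<sigma>. (poisson (r *\<^sub>R x) z)\<^sup>2) - (\<Sum>i\<in>idx L. (r ^ fst i * Y (fst i) (snd i) x)\<^sup>2)"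
    unfolding partial_kernel_def
    by (rule bessel_identity[OF finite_idx continuous_Y_idx ortho_Y_idx
          continuous_on_poisson2[OF r_inside[OF x]] poisson_coeff[OF x]])
  also have "(LINT z|\<sigma>. (poisson (r *\<^sub>R x) z)\<^sup>2) = poisson ((r * r) *\<^sub>R x) x"
    using poisson_semigroup[OF x x r r] by (simp add: power2_eq_square)
  also have "\<dots> = (1 + r\<^sup>2) / (1 - r\<^sup>2) ^ d"
    using poisson_diag[OF x, of "r * r"] r mult_strict_mono[of r 1 r 1] dim
    by (simp add: power2_eq_square)
  finally show ?thesis .
qed

text \<open>
  The mean over \<open>x\<close> of the right-hand side of \<open>kernel_remainder\<close>. It tends to \<open>0\<close> because the
  generating function of the numbers \<open>harmonic_dim d l\<close> is the diagonal value of the kernel.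
\<close>

definition tail :: "nat \<Rightarrow> real" where
  "tail L = (1 + r\<^sup>2) / (1 - r\<^sup>2) ^ d - (\<Sum>l\<le>L. real (harmonic_dim d l) * (r\<^sup>2) ^ l)"

lemma tail_tendsto: "tail \<longlonglongrightarrow> 0"
proof -
  have "\<bar>r\<^sup>2\<bar> < 1" using r by (simp add: power_less_one_iff)
  from harmonic_dim_sums[OF d this]
  have "(\<lambda>L. \<Sum>l\<le>L. real (harmonic_dim d l) * (r\<^sup>2) ^ l) \<longlonglongrightarrow> (1 + r\<^sup>2) / (1 - r\<^sup>2) ^ d"
    unfolding sums_def_le .
  from tendsto_diff[OF tendsto_const this, of "(1 + r\<^sup>2) / (1 - r\<^sup>2) ^ d"]
  show ?thesis unfolding tail_def[abs_def] by simp
qed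

lemma continuous_partial_kernel: "x \<in> sphere 0 1 \<Longrightarrow> continuous_on (sphere 0 1) (partial_kernel L x)"
  unfolding partial_kernel_def by (intro continuous_intros continuous_Y_idx)

text \<open>
  The remainder of the expansion of the Poisson integral of \<open>f\<close> on the sphere of radius \<open>r\<close> after
  degree \<open>L\<close>.
\<close>

definition Rem :: "('a \<Rightarrow> real) \<Rightarrow> nat \<Rightarrow> 'a \<Rightarrow> real" where
  "Rem f L x = poisson_int f (r *\<^sub>R x) -
    (\<Sum>i\<in>idx L. r ^ fst i * sphere_coeff Y f (fst i) (snd i) * Y (fst i) (snd i) x)"

lemma continuous_poisson_int_scaled:
  assumes f: "continuous_on (sphere 0 1) f"
  shows "continuous_on (sphere 0 1) (\<lambda>x. poisson_int f (r *\<^sub>R x))"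
proof -
  have "continuous_on ((\<lambda>x. r *\<^sub>R x) ` sphere 0 1) (poisson_int f)"
    by (rule continuous_on_poisson_int[OF f, of r]) (use r in auto)
  then show ?thesis
    by (rule continuous_on_compose2[where g = "poisson_int f"]) (auto intro!: continuous_intros)
qed

lemma continuous_Rem:
  assumes f: "continuous_on (sphere 0 1) f"
  shows "continuous_on (sphere 0 1) (Rem f L)"
  unfolding Rem_def by (intro continuous_intros continuous_poisson_int_scaled f continuous_Y_idx)

lemma Rem_sq_le:
  assumes f: "continuous_on (sphere 0 1) f" and x: "x \<in> sphere 0 1"
  shows "(Rem f L x)\<^sup>2 \<le>
    ((1 + r\<^sup>2) / (1 - r\<^sup>2) ^ d - (\<Sum>i\<in>idx L. (r ^ fst i * Y (fst i) (snd i) x)\<^sup>2)) * (LINT z|\<sigma>. (f z)\<^sup>2)"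
proof -
  note cp = continuous_on_poisson2[OF r_inside[OF x]] and ck = continuous_partial_kernel[OF x]
  have i1: "integrable \<sigma> (\<lambda>z. poisson (r *\<^sub>R x) z * f z)"
    by (intro integrable_continuous_surface continuous_intros cp f)
  have i2: "integrable \<sigma> (\<lambda>z. f z * Y (fst i) (snd i) z)" if "i \<in> idx L" for i
    by (intro integrable_continuous_surface continuous_intros continuous_Y_idx[OF that] f)
  have "(LINT z|\<sigma>. partial_kernel L x z * f z) =
      (LINT z|\<sigma>. (\<Sum>i\<in>idx L. r ^ fst i * Y (fst i) (snd i) x * (f z * Y (fst i) (snd i) z)))"
    unfolding partial_kernel_def sum_distrib_right
    by (intro Bochner_Integration.integral_cong sum.cong refl) simp
  also have "\<dots> = (\<Sum>i\<in>idx L. r ^ fst i * sphere_coeff Y f (fst i) (snd i) * Y (fst i) (snd i) x)"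
    using i2 by (subst Bochner_Integration.integral_sum) (auto intro!: sum.cong simp: sphere_coeff_def)
  finally have "Rem f L x = (LINT z|\<sigma>. (poisson (r *\<^sub>R x) z - partial_kernel L x z) * f z)"
    using i1 integrable_continuous_surface[OF continuous_on_mult[OF ck f]]
    by (simp add: Rem_def poisson_int_def left_diff_distrib)
  also have "\<dots>\<^sup>2 \<le> (LINT z|\<sigma>. (poisson (r *\<^sub>R x) z - partial_kernel L x z)\<^sup>2) * (LINT z|\<sigma>. (f z)\<^sup>2)"
    by (intro Cauchy_Schwarz_integral integrable_continuous_surface continuous_intros cp ck f)
  finally show ?thesis unfolding kernel_remainder[OF x] .
qed

lemma integral_Rem_sq_le:
  assumes f: "continuous_on (sphere 0 1) f"
  shows "(LINT x|\<sigma>. (Rem f L x)\<^sup>2) \<le> tail L * (LINT z|\<sigma>. (f z)\<^sup>2)"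
proof -
  define A where "A = (1 + r\<^sup>2) / (1 - r\<^sup>2) ^ d"
  define F where "F = (LINT z|\<sigma>. (f z)\<^sup>2)"
  have int: "integrable \<sigma> (\<lambda>x. (r ^ fst i * Y (fst i) (snd i) x)\<^sup>2)" if "i \<in> idx L" for i
    by (intro integrable_continuous_surface continuous_intros continuous_Y_idx[OF that])
  have "(LINT x|\<sigma>. (Rem f L x)\<^sup>2) \<le>
      (LINT x|\<sigma>. (A - (\<Sum>i\<in>idx L. (r ^ fst i * Y (fst i) (snd i) x)\<^sup>2)) * F)"
  proof (rule integral_mono)
    show "integrable \<sigma> (\<lambda>x. (Rem f L x)\<^sup>2)"
      by (intro integrable_continuous_surface continuous_intros continuous_Rem f)
    show "integrable \<sigma> (\<lambda>x. (A - (\<Sum>i\<in>idx L. (r ^ fst i * Y (fst i) (snd i) x)\<^sup>2)) * F)"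
      by (intro integrable_continuous_surface continuous_intros continuous_Y_idx)
  qed (use Rem_sq_le[OF f] in \<open>simp add: A_def F_def\<close>)
  also have "\<dots> = (A - (\<Sum>i\<in>idx L. (LINT x|\<sigma>. (r ^ fst i * Y (fst i) (snd i) x)\<^sup>2))) * F"
    using int by (simp add: Bochner_Integration.integral_sum)
  also have "(\<Sum>i\<in>idx L. (LINT x|\<sigma>. (r ^ fst i * Y (fst i) (snd i) x)\<^sup>2)) = (\<Sum>i\<in>idx L. (r\<^sup>2) ^ fst i)"
  proof (intro sum.cong refl)
    fix i assume i: "i \<in> idx L"
    have "(LINT x|\<sigma>. (r ^ fst i * Y (fst i) (snd i) x)\<^sup>2) =
        (LINT x|\<sigma>. (r\<^sup>2) ^ fst i * (Y (fst i) (snd i) x * Y (fst i) (snd i) x))"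
      by (intro Bochner_Integration.integral_cong refl)
        (simp add: power_mult_distrib power2_eq_square)
    also have "\<dots> = (r\<^sup>2) ^ fst i" using ortho_Y_idx[OF i i] by simp
    finally show "(LINT x|\<sigma>. (r ^ fst i * Y (fst i) (snd i) x)\<^sup>2) = (r\<^sup>2) ^ fst i" .
  qed
  also have "(\<Sum>i\<in>idx L. (r\<^sup>2) ^ fst i) = (\<Sum>l\<le>L. real (harmonic_dim d l) * (r\<^sup>2) ^ l)"
    using sum_idx[of "\<lambda>l k. (r\<^sup>2) ^ l"] by simp
  finally show ?thesis by (simp add: tail_def A_def F_def)
qed

text \<open>Smoothing once more turns the mean square convergence into uniform convergence.\<close>

lemma smoothed_expansion:
  assumes f: "continuous_on (sphere 0 1) f" and x: "x \<in> sphere 0 1"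
  shows "(poisson_int (\<lambda>z. poisson_int f (r *\<^sub>R z)) (r *\<^sub>R x) -
      (\<Sum>i\<in>idx L. (r\<^sup>2) ^ fst i * sphere_coeff Y f (fst i) (snd i) * Y (fst i) (snd i) x))\<^sup>2
    \<le> (1 + r\<^sup>2) / (1 - r\<^sup>2) ^ d * (tail L * (LINT z|\<sigma>. (f z)\<^sup>2))"
proof -
  note cp = continuous_on_poisson2[OF r_inside[OF x]]
  let ?a = "\<lambda>i. sphere_coeff Y f (fst i) (snd i)"
  have i1: "integrable \<sigma> (\<lambda>z. poisson (r *\<^sub>R x) z * poisson_int f (r *\<^sub>R z))"
    by (intro integrable_continuous_surface continuous_intros cp continuous_poisson_int_scaled f)
  have i2: "integrable \<sigma> (\<lambda>z. poisson (r *\<^sub>R x) z * Y (fst i) (snd i) z)" if "i \<in> idx L" for i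
    by (intro integrable_continuous_surface continuous_intros cp continuous_Y_idx[OF that])
  have "poisson_int (Rem f L) (r *\<^sub>R x) =
      (LINT z|\<sigma>. poisson (r *\<^sub>R x) z * poisson_int f (r *\<^sub>R z) -
        (\<Sum>i\<in>idx L. r ^ fst i * ?a i * (poisson (r *\<^sub>R x) z * Y (fst i) (snd i) z)))"
    unfolding poisson_int_def Rem_def right_diff_distrib sum_distrib_left
    by (intro Bochner_Integration.integral_cong refl arg_cong2[where f = "(-)"] sum.cong) simp
  also have "\<dots> = poisson_int (\<lambda>z. poisson_int f (r *\<^sub>R z)) (r *\<^sub>R x) -
      (\<Sum>i\<in>idx L. r ^ fst i * ?a i * (LINT z|\<sigma>. poisson (r *\<^sub>R x) z * Y (fst i) (snd i) z))"
    using i1 i2 by (simp add: Bochner_Integration.integral_sum poisson_int_def)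
  also have "(\<Sum>i\<in>idx L. r ^ fst i * ?a i * (LINT z|\<sigma>. poisson (r *\<^sub>R x) z * Y (fst i) (snd i) z)) =
      (\<Sum>i\<in>idx L. (r\<^sup>2) ^ fst i * ?a i * Y (fst i) (snd i) x)"
    using poisson_coeff[OF x]
    by (intro sum.cong refl) (simp add: power2_eq_square power_mult_distrib)
  finally have eq: "poisson_int (\<lambda>z. poisson_int f (r *\<^sub>R z)) (r *\<^sub>R x) -
      (\<Sum>i\<in>idx L. (r\<^sup>2) ^ fst i * ?a i * Y (fst i) (snd i) x) = poisson_int (Rem f L) (r *\<^sub>R x)" by simp
  have "(poisson_int (Rem f L) (r *\<^sub>R x))\<^sup>2 \<le>
      (LINT z|\<sigma>. (poisson (r *\<^sub>R x) z)\<^sup>2) * (LINT z|\<sigma>. (Rem f L z)\<^sup>2)"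
    unfolding poisson_int_def
    by (intro Cauchy_Schwarz_integral integrable_continuous_surface continuous_intros cp continuous_Rem f)
  also have "(LINT z|\<sigma>. (poisson (r *\<^sub>R x) z)\<^sup>2) = poisson ((r * r) *\<^sub>R x) x"
    using poisson_semigroup[OF x x r r] by (simp add: power2_eq_square)
  also have "\<dots> = (1 + r\<^sup>2) / (1 - r\<^sup>2) ^ d"
    using poisson_diag[OF x, of "r * r"] r mult_strict_mono[of r 1 r 1] dim
    by (simp add: power2_eq_square)
  also have "\<dots> * (LINT z|\<sigma>. (Rem f L z)\<^sup>2) \<le> \<dots> * (tail L * (LINT z|\<sigma>. (f z)\<^sup>2))"
    using r by (intro mult_left_mono integral_Rem_sq_le f) (auto simp: power_le_one)
  finally show ?thesis unfolding eq .
qed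

lemma quad_err_smoothed:
  assumes f: "continuous_on (sphere 0 1) f" and X: "finite X" "X \<noteq> {}" "X \<subseteq> sphere 0 1"
  shows "(\<lambda>L. \<Sum>i\<in>idx1 L. (r\<^sup>2) ^ fst i * sphere_coeff Y f (fst i) (snd i) * quad_err X (Y (fst i) (snd i)))
    \<longlonglongrightarrow> quad_err X (\<lambda>x. poisson_int (\<lambda>z. poisson_int f (r *\<^sub>R z)) (r *\<^sub>R x))"
proof -
  define g where "g = (\<lambda>x. poisson_int (\<lambda>z. poisson_int f (r *\<^sub>R z)) (r *\<^sub>R x))"
  define h where "h L x = (\<Sum>i\<in>idx L. (r\<^sup>2) ^ fst i * sphere_coeff Y f (fst i) (snd i) * Y (fst i) (snd i) x)" for L x
  define \<eta> where "\<eta> L = sqrt ((1 + r\<^sup>2) / (1 - r\<^sup>2) ^ d * (tail L * (LINT z|\<sigma>. (f z)\<^sup>2)))" for L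
  have cg: "continuous_on (sphere 0 1) g"
    unfolding g_def by (intro continuous_poisson_int_scaled f)
  have ch: "continuous_on (sphere 0 1) (h L)" for L
    unfolding h_def by (intro continuous_intros continuous_Y_idx)
  have "\<eta> \<longlonglongrightarrow> sqrt ((1 + r\<^sup>2) / (1 - r\<^sup>2) ^ d * (0 * (LINT z|\<sigma>. (f z)\<^sup>2)))"
    unfolding \<eta>_def by (intro tendsto_intros tail_tendsto)
  then have \<eta>: "(\<lambda>L. 2 * \<eta> L) \<longlonglongrightarrow> 0" using tendsto_mult_right_zero by force
  have hsum: "quad_err X (h L) = (\<Sum>i\<in>idx1 L. (r\<^sup>2) ^ fst i * sphere_coeff Y f (fst i) (snd i) *
      quad_err X (Y (fst i) (snd i)))" for L
  proof -
    have "quad_err X (h L) = (\<Sum>i\<in>idx L. (r\<^sup>2) ^ fst i * sphere_coeff Y f (fst i) (snd i) *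
      quad_err X (\<lambda>x. Y (fst i) (snd i) x))"
      unfolding h_def by (intro quad_err_sum integrable_continuous_surface continuous_Y_idx)
    then show ?thesis unfolding idx_split
      by (subst (asm) sum.insert) (auto simp: idx1_def quad_err_Y0[OF X] simp del: One_nat_def)
  qed
  have le: "\<bar>quad_err X (h L) - quad_err X g\<bar> \<le> 2 * \<eta> L" for L
  proof -
    have "\<bar>quad_err X (\<lambda>x. h L x - g x)\<bar> \<le> 2 * \<eta> L"
    proof (rule quad_err_bound[OF X])
      show "(\<lambda>x. h L x - g x) \<in> borel_measurable \<sigma>"
        by (intro continuous_measurable_surface continuous_intros ch cg)
      fix x :: 'a assume "x \<in> sphere 0 1"
      from smoothed_expansion[OF f this, of L]
      have "\<bar>g x - h L x\<bar> \<le> \<eta> L"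
        unfolding g_def h_def \<eta>_def by (rule real_le_rsqrt[of "\<bar>_\<bar>", unfolded power2_abs])
      then show "\<bar>h L x - g x\<bar> \<le> \<eta> L" by (simp add: abs_minus_commute)
    qed
    then show ?thesis
      by (simp add: quad_err_diff integrable_continuous_surface ch cg)
  qed
  have "(\<lambda>L. quad_err X (h L) - quad_err X g) \<longlonglongrightarrow> 0"
    by (rule tendsto_rabs_zero_cancel, rule tendsto_sandwich[OF _ _ tendsto_const \<eta>])
      (auto simp: le)
  then have "(\<lambda>L. quad_err X (h L)) \<longlonglongrightarrow> quad_err X g" by (simp add: LIM_zero_iff)
  then show ?thesis unfolding hsum g_def .
qed

end

text \<open>
  By the semigroup property, the right-hand side is the square norm of
  \<open>N\<^sup>-\<^sup>1 \<Sum> P\<^sub>s(x, z) - 1\<close> as a function of \<open>z\<close>, where \<open>P\<^sub>s\<close> is the Poisson kernel of radius \<open>s = \<surd>r\<close>,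
  and \<open>s\<^sup>l\<close> times the quadrature error of \<open>Y l k\<close> is its coefficient at \<open>Y l k\<close>. The claim is Bessel's inequality.
\<close>

lemma poisson_energy_ge:
  assumes X: "finite X" "X \<noteq> {}" "X \<subseteq> sphere 0 1" and r: "0 < r" "r < 1"
  shows "(\<Sum>i\<in>idx1 L. r ^ fst i * (quad_err X (Y (fst i) (snd i)))\<^sup>2) \<le>
    1 / (real (card X))\<^sup>2 * (\<Sum>x\<in>X. \<Sum>y\<in>X. poisson (r *\<^sub>R x) y) - 1"
proof -
  define s where "s = sqrt r"
  have s: "0 < s" "s < 1" "s * s = r" "s\<^sup>2 = r" using r by (simp_all add: s_def)
  define N where "N = real (card X)"
  have N: "N > 0" using X by (simp add: N_def card_gt_0_iff)
  define F where "F z = 1 / N * (\<Sum>x\<in>X. poisson (s *\<^sub>R x) z) - 1" for z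
  have Xs: "x \<in> sphere 0 1" if "x \<in> X" for x using that X by auto
  have in1: "norm (s *\<^sub>R x) < 1" if "x \<in> X" for x using s Xs[OF that] by simp
  have cF: "continuous_on (sphere 0 1) F"
    unfolding F_def by (intro continuous_intros continuous_on_poisson2 in1)
  have ip: "integrable \<sigma> (\<lambda>z. poisson (s *\<^sub>R x) z)" if "x \<in> X" for x
    by (intro integrable_continuous_surface continuous_on_poisson2 in1 that)
  have p1: "(LINT z|\<sigma>. poisson (s *\<^sub>R x) z) = 1" if "x \<in> X" for x
    using poisson_int_one[OF in1[OF that]] by (simp add: poisson_int_def)
  have coeff: "(LINT z|\<sigma>. F z * Y (fst i) (snd i) z) = s ^ fst i * quad_err X (Y (fst i) (snd i))"
    if i: "i \<in> idx1 L" for i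
  proof -
    have i': "i \<in> idx L" using i by (simp add: idx_split)
    have l: "fst i \<ge> 1" "snd i \<in> {1..harmonic_dim d (fst i)}" using i by (auto simp: idx1_def)
    have iY: "integrable \<sigma> (\<lambda>z. Y (fst i) (snd i) z)"
      by (intro integrable_continuous_surface continuous_Y_idx[OF i'])
    have ipY: "integrable \<sigma> (\<lambda>z. poisson (s *\<^sub>R x) z * Y (fst i) (snd i) z)" if "x \<in> X" for x
      by (intro integrable_continuous_surface continuous_intros continuous_on_poisson2 in1 that continuous_Y_idx[OF i'])
    have "(LINT z|\<sigma>. F z * Y (fst i) (snd i) z) =
        (LINT z|\<sigma>. 1 / N * (\<Sum>x\<in>X. poisson (s *\<^sub>R x) z * Y (fst i) (snd i) z) - Y (fst i) (snd i) z)"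
      unfolding F_def by (simp add: left_diff_distrib sum_distrib_right sum_distrib_left mult.assoc)
    also have "\<dots> = 1 / N * (\<Sum>x\<in>X. LINT z|\<sigma>. poisson (s *\<^sub>R x) z * Y (fst i) (snd i) z)"
      using iY ipY integral_Y[OF l] by (simp add: Bochner_Integration.integral_sum)
    also have "\<dots> = 1 / N * (\<Sum>x\<in>X. s ^ fst i * Y (fst i) (snd i) x)"
      using poisson_coeff[OF s(1,2) Xs i'] by simp
    finally show ?thesis
      by (simp add: quad_err_def integral_Y[OF l] N_def sum_distrib_left)
  qed
  have "0 \<le> (LINT z|\<sigma>. (F z - (\<Sum>i\<in>idx1 L. (s ^ fst i * quad_err X (Y (fst i) (snd i))) * Y (fst i) (snd i) z))\<^sup>2)"
    by simp
  also have "\<dots> = (LINT z|\<sigma>. (F z)\<^sup>2) - (\<Sum>i\<in>idx1 L. (s ^ fst i * quad_err X (Y (fst i) (snd i)))\<^sup>2)"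
  proof (rule bessel_identity[OF finite_idx1 _ _ cF coeff])
    fix i j assume i: "i \<in> idx1 L"
    then show "continuous_on (sphere 0 1) (Y (fst i) (snd i))"
      by (intro continuous_Y_idx[of _ L]) (simp add: idx_split)
    assume "j \<in> idx1 L"
    with i show "(LINT x|\<sigma>. Y (fst i) (snd i) x * Y (fst j) (snd j) x) = (if i = j then 1 else 0)"
      by (intro ortho_Y_idx[of _ L]) (simp_all add: idx_split)
  qed
  also have "(\<Sum>i\<in>idx1 L. (s ^ fst i * quad_err X (Y (fst i) (snd i)))\<^sup>2) =
      (\<Sum>i\<in>idx1 L. r ^ fst i * (quad_err X (Y (fst i) (snd i)))\<^sup>2)"
    by (intro sum.cong refl) (metis power_mult_distrib power_mult mult.commute s(4))
  also have "(LINT z|\<sigma>. (F z)\<^sup>2) = 1 / N\<^sup>2 * (\<Sum>x\<in>X. \<Sum>y\<in>X. poisson (r *\<^sub>R x) y) - 1"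
  proof -
    have ipp: "integrable \<sigma> (\<lambda>z. poisson (s *\<^sub>R x) z * poisson (s *\<^sub>R y) z)" if "x \<in> X" "y \<in> X" for x y
      by (intro integrable_continuous_surface continuous_intros continuous_on_poisson2 in1 that)
    have "(F z)\<^sup>2 = 1 / N\<^sup>2 * (\<Sum>x\<in>X. \<Sum>y\<in>X. poisson (s *\<^sub>R x) z * poisson (s *\<^sub>R y) z)
        - 2 / N * (\<Sum>x\<in>X. poisson (s *\<^sub>R x) z) + 1" for z
      unfolding F_def sum_product[symmetric] by (simp add: power2_eq_square algebra_simps)
    then have "(LINT z|\<sigma>. (F z)\<^sup>2) = (LINT z|\<sigma>. 1 / N\<^sup>2 * (\<Sum>x\<in>X. \<Sum>y\<in>X. poisson (s *\<^sub>R x) z * poisson (s *\<^sub>R y) z)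
        - 2 / N * (\<Sum>x\<in>X. poisson (s *\<^sub>R x) z) + 1)" by simp
    also have "\<dots> = 1 / N\<^sup>2 * (\<Sum>x\<in>X. \<Sum>y\<in>X. LINT z|\<sigma>. poisson (s *\<^sub>R x) z * poisson (s *\<^sub>R y) z)
        - 2 / N * (\<Sum>x\<in>X. LINT z|\<sigma>. poisson (s *\<^sub>R x) z) + 1"
      using ip ipp by (simp add: Bochner_Integration.integral_sum)
    also have "(\<Sum>x\<in>X. LINT z|\<sigma>. poisson (s *\<^sub>R x) z) = N" using p1 by (simp add: N_def)
    also have "(\<Sum>x\<in>X. \<Sum>y\<in>X. LINT z|\<sigma>. poisson (s *\<^sub>R x) z * poisson (s *\<^sub>R y) z) =
        (\<Sum>x\<in>X. \<Sum>y\<in>X. poisson (r *\<^sub>R x) y)"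
      using poisson_semigroup[OF Xs Xs s(1,2) s(1,2)] s(3) by simp
    finally show ?thesis using N by simp
  qed
  finally show ?thesis by (simp add: N_def)
qed

text \<open>
  Abel summation: the error of \<open>f\<close> is the limit of the errors of its twice smoothed versions, for which
  the expansion in harmonics converges uniformly.
\<close>

lemma abs_quad_err_le:
  assumes f: "continuous_on (sphere 0 1) f" and X: "finite X" "X \<noteq> {}" "X \<subseteq> sphere 0 1"
    and B: "\<And>r L. 0 < r \<Longrightarrow> r < 1 \<Longrightarrow>
      \<bar>\<Sum>i\<in>idx1 L. r ^ fst i * sphere_coeff Y f (fst i) (snd i) * quad_err X (Y (fst i) (snd i))\<bar> \<le> B"
  shows "\<bar>quad_err X f\<bar> \<le> B"
proof (rule field_le_epsilon)
  fix \<epsilon> :: real assume \<epsilon>: "\<epsilon> > 0"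
  obtain R where R: "0 < R" "R < 1"
    "\<And>r x. R < r \<Longrightarrow> r < 1 \<Longrightarrow> x \<in> sphere 0 1 \<Longrightarrow> \<bar>poisson_int f (r *\<^sub>R x) - f x\<bar> \<le> \<epsilon> / 4"
    using poisson_int_tendsto[OF f, of "\<epsilon> / 4"] \<epsilon> by (metis zero_less_divide_iff zero_less_numeral)
  obtain r where r: "R < r" "r < 1" using dense[OF R(2)] by blast
  have r0: "0 < r" using r R by linarith
  note cont1 = continuous_poisson_int_scaled[OF r0 r(2)]
  define g where "g = (\<lambda>z. poisson_int f (r *\<^sub>R z))"
  define h where "h = (\<lambda>x. poisson_int g (r *\<^sub>R x))"
  have cg: "continuous_on (sphere 0 1) g" unfolding g_def by (rule cont1[OF f])
  have ch: "continuous_on (sphere 0 1) h" unfolding h_def by (rule cont1[OF cg])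
  have "(\<lambda>L. \<bar>\<Sum>i\<in>idx1 L. (r\<^sup>2) ^ fst i * sphere_coeff Y f (fst i) (snd i) * quad_err X (Y (fst i) (snd i))\<bar>)
      \<longlonglongrightarrow> \<bar>quad_err X h\<bar>"
    unfolding h_def g_def by (intro tendsto_rabs quad_err_smoothed[OF r0 r(2) f X])
  then have hB: "\<bar>quad_err X h\<bar> \<le> B"
    by (rule LIMSEQ_le_const2) (use B[of "r\<^sup>2"] r r0 in \<open>auto simp: power_less_one_iff\<close>)
  have gf: "\<bar>g x - f x\<bar> \<le> \<epsilon> / 4" if "x \<in> sphere 0 1" for x
    unfolding g_def using R(3)[OF r that] .
  have hf: "\<bar>f x - h x\<bar> \<le> \<epsilon> / 2" if x: "x \<in> sphere 0 1" for x
  proof -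
    have nx: "norm (r *\<^sub>R x) < 1" using x r r0 by simp
    note cp = continuous_on_poisson2[OF nx]
    have "h x - g x = (LINT z|\<sigma>. poisson (r *\<^sub>R x) z * (g z - f z))"
      unfolding h_def g_def[of] poisson_int_def[of g] using integrable_poisson[OF nx cg] integrable_poisson[OF nx f]
      by (simp add: right_diff_distrib poisson_int_def g_def)
    also have "\<bar>\<dots>\<bar> \<le> (LINT z|\<sigma>. \<bar>poisson (r *\<^sub>R x) z * (g z - f z)\<bar>)"
      by (rule integral_abs_bound)
    also have "\<dots> \<le> (LINT z|\<sigma>. poisson (r *\<^sub>R x) z * (\<epsilon> / 4))"
    proof (rule integral_mono)
      show "integrable \<sigma> (\<lambda>z. \<bar>poisson (r *\<^sub>R x) z * (g z - f z)\<bar>)"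
        by (intro integrable_abs integrable_continuous_surface continuous_intros cp cg f)
      show "integrable \<sigma> (\<lambda>z. poisson (r *\<^sub>R x) z * (\<epsilon> / 4))"
        by (intro integrable_continuous_surface continuous_intros cp)
      fix z :: 'a assume "z \<in> space \<sigma>"
      then show "\<bar>poisson (r *\<^sub>R x) z * (g z - f z)\<bar> \<le> poisson (r *\<^sub>R x) z * (\<epsilon> / 4)"
        unfolding abs_mult using poisson_nonneg[OF nx, of z] gf[of z] by (intro mult_mono) auto
    qed
    also have "\<dots> = \<epsilon> / 4"
      using poisson_int_one[OF nx] by (simp add: poisson_int_def)
    finally show ?thesis using gf[OF x] by linarith
  qed
  have "\<bar>quad_err X f - quad_err X h\<bar> = \<bar>quad_err X (\<lambda>x. f x - h x)\<bar>"
    by (simp add: quad_err_diff integrable_continuous_surface ch f)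
  also have "\<dots> \<le> 2 * (\<epsilon> / 2)"
    by (rule quad_err_bound[OF X _ hf]) (intro continuous_measurable_surface continuous_intros ch f)
  finally show "\<bar>quad_err X f\<bar> \<le> B + \<epsilon>" using hB by linarith
qed

end

section \<open>Powers of the distance as superpositions of Poisson kernels\<close>

lemma powr_one_plus_ge:
  fixes a u :: real
  assumes "a > 0" "u \<ge> 0"
  shows "1 - (1 + u) powr (- a) \<le> a * u"
proof -
  have "- a * u \<le> - a * ln (1 + u)"
    using ln_add_one_self_le_self[of u] assms by simp
  also have "1 + (- a * ln (1 + u)) \<le> exp (- a * ln (1 + u))" by (rule exp_ge_add_one_self)
  also have "\<dots> = (1 + u) powr (- a)" using assms by (simp add: powr_def)
  finally show ?thesis by simp
qed

context
  fixes a q :: real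
  assumes a: "a > 0" and q: "0 < q" "q < 1"
begin

text \<open>
  For \<open>a = (d + 1) / 2\<close> and \<open>w = |x - y|\<^sup>2\<close>, the first factor is one minus the normalized Poisson kernel.
  It is of order \<open>v\<close> near \<open>0\<close> and bounded, so the integral over \<open>v\<close> converges exactly for
  \<open>0 < q < 1\<close>, where it is a multiple of \<open>w\<close> to the power \<open>q\<close>.
\<close>

definition dist_density :: "real \<Rightarrow> real \<Rightarrow> real" where
  "dist_density v w = (if v > 0 then (1 - (1 + v * w) powr (- a)) * v powr (- q - 1) else 0)"

lemma dist_density_measurable [measurable]: "(\<lambda>v. dist_density v w) \<in> borel_measurable borel"
  unfolding dist_density_def by measurable

lemma dist_density_nonneg: "w \<ge> 0 \<Longrightarrow> dist_density v w \<ge> 0"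
  unfolding dist_density_def using a powr_mono2'[of "- a" 1 "1 + v * w"] by (simp add: not_less)

definition dist_const :: real where
  "dist_const = (LINT v|lborel. dist_density v 1)"

lemma integrable_dist_density_1: "integrable lborel (\<lambda>v. dist_density v 1)"
proof -
  have i1: "(\<lambda>v::real. v powr (- q)) integrable_on {0..1}"
    using has_integral_powr_from_0[of "- q" 1] q by (auto simp: integrable_on_def)
  have i2: "(\<lambda>v::real. v powr (- q - 1)) integrable_on {1..}"
    using has_integral_powr_to_inf[of "- q - 1" 1] q by (auto simp: integrable_on_def)
  have s1: "set_integrable lebesgue {0..1} (\<lambda>v::real. v powr (- q))"
    by (rule nonnegative_absolutely_integrable_1[OF i1]) auto
  have s2: "set_integrable lebesgue {1..} (\<lambda>v::real. v powr (- q - 1))"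
    by (rule nonnegative_absolutely_integrable_1[OF i2]) auto
  have b1: "integrable lborel (\<lambda>v::real. indicator {0..1} v *\<^sub>R v powr (- q))"
    using s1 unfolding set_integrable_def by (subst (asm) integrable_completion) auto
  have b2: "integrable lborel (\<lambda>v::real. indicator {1..} v *\<^sub>R v powr (- q - 1))"
    using s2 unfolding set_integrable_def by (subst (asm) integrable_completion) auto
  show ?thesis
  proof (rule Bochner_Integration.integrable_bound[OF Bochner_Integration.integrable_add[OF integrable_mult_right[OF b1, of a] b2]])
    show "AE v in lborel. norm (dist_density v 1) \<le>
        norm (a * (indicator {0..1} v *\<^sub>R v powr (- q)) + indicator {1..} v *\<^sub>R v powr (- q - 1))"
    proof (intro AE_I2)
      fix v :: real
      consider "v \<le> 0" | "0 < v" "v < 1" | "v \<ge> 1" by linarith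
      then show "norm (dist_density v 1) \<le>
          norm (a * (indicator {0..1} v *\<^sub>R v powr (- q)) + indicator {1..} v *\<^sub>R v powr (- q - 1))"
      proof cases
        case 1
        then show ?thesis by (simp add: dist_density_def)
      next
        case 2
        have "dist_density v 1 \<le> (a * v) * v powr (- q - 1)"
          using 2 a powr_one_plus_ge[of a v] by (auto simp: dist_density_def intro!: mult_right_mono)
        also have "\<dots> = a * v powr (- q)"
          using 2 powr_add[of v 1 "- q - 1"] by simp
        finally show ?thesis using 2 a dist_density_nonneg[of 1 v] by simp
      next
        case 3
        have "dist_density v 1 \<le> 1 * v powr (- q - 1)"
          using 3 by (auto simp: dist_density_def intro!: mult_right_mono)
        moreover have "a * (indicator {0..1} v *\<^sub>R v powr (- q)) \<ge> 0" using a by simp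
        ultimately show ?thesis using 3 dist_density_nonneg[of 1 v] by simp
      qed
    qed
  qed measurable
qed

lemma dist_const_pos: "dist_const > 0"
proof -
  have "dist_const \<noteq> 0"
  proof
    assume "dist_const = 0"
    then have "AE v in lborel. dist_density v 1 = 0"
      unfolding dist_const_def
      by (subst (asm) integral_nonneg_eq_0_iff_AE[OF integrable_dist_density_1]) (auto simp: dist_density_nonneg)
    moreover have "dist_density v 1 \<noteq> 0" if "v \<in> {1..2}" for v
    proof -
      have "(1 + v * 1) powr (- a) < 1 powr (- a)"
        using that a by (intro powr_less_mono2_neg) auto
      then show ?thesis using that a by (simp add: dist_density_def)
    qed
    ultimately have "AE v in lborel. v \<notin> {1..2::real}" by (auto elim: eventually_mono)
    then have "emeasure lborel {1..2::real} = 0" by (subst (asm) AE_iff_measurable[of "{1..2}"]) auto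
    then show False by simp
  qed
  moreover have "dist_const \<ge> 0" unfolding dist_const_def by (simp add: dist_density_nonneg)
  ultimately show ?thesis by simp
qed

text \<open>The substitution \<open>v \<mapsto> w v\<close> turns the integral for \<open>w\<close> into the one for \<open>1\<close>.\<close>

lemma dist_density_integral:
  assumes w: "w \<ge> 0"
  shows "integrable lborel (\<lambda>v. dist_density v w)"
    and "(LINT v|lborel. dist_density v w) = dist_const * w powr q"
proof -
  have "integrable lborel (\<lambda>v. dist_density v w) \<and>
      (LINT v|lborel. dist_density v w) = dist_const * w powr q"
  proof (cases "w = 0")
    case True
    then have "(\<lambda>v. dist_density v w) = (\<lambda>v. 0)" by (auto simp: dist_density_def)
    then show ?thesis using True by simp
  next
    case False
    with w have w: "w > 0" by simp
    have eq: "dist_density (0 + w * v) 1 = w powr (- q - 1) * dist_density v w" for v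
      using w by (simp add: dist_density_def powr_mult zero_less_mult_iff mult.commute)
    have "integrable lborel (\<lambda>v. dist_density (0 + w * v) 1)"
      using lborel_integrable_real_affine[OF integrable_dist_density_1, of w 0] w by simp
    then have "integrable lborel (\<lambda>v. w powr (- q - 1) * dist_density v w)"
      unfolding eq .
    then have int: "integrable lborel (\<lambda>v. dist_density v w)" using w by simp
    have "dist_const = w * (LINT v|lborel. dist_density (0 + w * v) 1)"
      unfolding dist_const_def using lborel_integral_real_affine[of w "\<lambda>v. dist_density v 1" 0] w by simp
    also have "\<dots> = (w * w powr (- q - 1)) * (LINT v|lborel. dist_density v w)"
      unfolding eq by simp
    also have "w * w powr (- q - 1) = w powr (- q)"
      using w powr_add[of w 1 "- q - 1"] by simp
    finally have "dist_const * w powr q = (w powr (- q) * w powr q) * (LINT v|lborel. dist_density v w)"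
      by simp
    also have "w powr (- q) * w powr q = 1" using w by (simp flip: powr_add)
    finally show ?thesis using int by simp
  qed
  then show "integrable lborel (\<lambda>v. dist_density v w)"
    and "(LINT v|lborel. dist_density v w) = dist_const * w powr q" by auto
qed

end

text \<open>
  The Poisson kernel divided by its value on the diagonal, in the parameter \<open>v = r / (1 - r)\<^sup>2\<close>; see
  \<open>poisson_profile_eq\<close>.
\<close>

definition poisson_profile :: "real \<Rightarrow> 'a::euclidean_space \<Rightarrow> 'a \<Rightarrow> real" where
  "poisson_profile v x y = (1 + v * (norm (x - y))\<^sup>2) powr (- (real DIM('a) / 2))"

lemma poisson_parameter_exists:
  fixes v :: real
  assumes v: "v > 0"
  obtains r where "0 < r" "r < 1" "v * (1 - r)\<^sup>2 = r"
proof -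
  have "\<exists>r\<ge>0. r \<le> 1 \<and> r - v * (1 - r)\<^sup>2 = 0"
    by (rule IVT') (use v in \<open>auto intro!: continuous_intros\<close>)
  then obtain r where r: "0 \<le> r" "r \<le> 1" "r - v * (1 - r)\<^sup>2 = 0" by blast
  moreover from r v have "r \<noteq> 0" "r \<noteq> 1" by auto
  ultimately show ?thesis using that[of r] by simp
qed

lemma poisson_parameter_pos:
  fixes r v :: real
  assumes "0 < r" "r < 1" "v * (1 - r)\<^sup>2 = r"
  shows "v > 0"
proof (rule zero_less_mult_pos2)
  show "0 < v * (1 - r)\<^sup>2" "0 < (1 - r)\<^sup>2" using assms by auto
qed

lemma poisson_profile_eq:
  fixes x y :: "'a::euclidean_space"
  assumes x: "x \<in> sphere 0 1" and y: "y \<in> sphere 0 1" and r: "0 < r" "r < 1" and v: "v * (1 - r)\<^sup>2 = r"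
  shows "poisson_profile v x y = (1 - r) ^ (DIM('a) - 1) / (1 + r) * poisson (r *\<^sub>R x) y"
proof -
  let ?e = "- real DIM('a) / 2" and ?w = "(norm (x - y))\<^sup>2"
  have v0: "v > 0" by (rule poisson_parameter_pos[OF r v])
  have "(1 - r)\<^sup>2 + r * ?w = (1 - r)\<^sup>2 * (1 + v * ?w)" using v by (simp add: algebra_simps)
  then have "poisson (r *\<^sub>R x) y = (1 - r\<^sup>2) * ((1 - r)\<^sup>2 powr ?e * (1 + v * ?w) powr ?e)"
    using v0 r by (subst poisson_sphere_eq[OF x y]) (auto simp: powr_mult)
  moreover have "poisson (r *\<^sub>R x) x = (1 - r\<^sup>2) * (1 - r)\<^sup>2 powr ?e"
    using r by (subst poisson_sphere_eq[OF x x]) auto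
  ultimately have "poisson (r *\<^sub>R x) y = poisson (r *\<^sub>R x) x * poisson_profile v x y"
    by (simp add: poisson_profile_def)
  also have "\<dots> = (1 + r) / (1 - r) ^ (DIM('a) - 1) * poisson_profile v x y"
    using r by (subst poisson_diag[OF x]) auto
  finally show ?thesis using r by simp
qed

lemma poisson_profile_integral:
  fixes x :: "'a::euclidean_space"
  assumes x: "x \<in> sphere 0 1" and r: "0 < r" "r < 1" and v: "v * (1 - r)\<^sup>2 = r"
  shows "(LINT z|\<sigma>. poisson_profile v x z) = (1 - r) ^ (DIM('a) - 1) / (1 + r)"
proof -
  have "(LINT z|\<sigma>. poisson_profile v x z) =
      (LINT z|\<sigma>. (1 - r) ^ (DIM('a) - 1) / (1 + r) * poisson (r *\<^sub>R x) z)"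
    using poisson_profile_eq[OF x _ r v] by (intro Bochner_Integration.integral_cong) auto
  also have "\<dots> = (1 - r) ^ (DIM('a) - 1) / (1 + r) * poisson_int (\<lambda>_. 1) (r *\<^sub>R x)"
    by (simp add: poisson_int_def)
  finally show ?thesis using x r by (simp add: poisson_int_one)
qed

lemma continuous_on_poisson_profile:
  assumes "v \<ge> 0" shows "continuous_on A (\<lambda>z. poisson_profile v x z)"
proof -
  have "1 + v * (norm (x - z))\<^sup>2 \<noteq> 0" for z
    using assms by (smt (verit) mult_nonneg_nonneg zero_le_power2)
  then show ?thesis unfolding poisson_profile_def by (intro continuous_intros) auto
qed

section \<open>The energy controls the quadrature error\<close>

text \<open>
  The type argument records the space in which the sphere lies.
\<close>

definition mean_power_distance :: "real \<Rightarrow> 'a::euclidean_space itself \<Rightarrow> real" where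
  "mean_power_distance p TYPE('a) = (LINT x|(\<sigma>::'a measure). LINT y|\<sigma>. norm (x - y) powr p)"

definition energy_gap :: "real \<Rightarrow> 'a::euclidean_space set \<Rightarrow> real" where
  "energy_gap p X = mean_power_distance p TYPE('a) - distance_sum p X / (real (card X))\<^sup>2"

locale sobolev_setting = harmonic_basis d Y
  for d :: nat and Y :: "nat \<Rightarrow> nat \<Rightarrow> 'a::euclidean_space \<Rightarrow> real" +
  fixes s :: real
  assumes s: "real d / 2 < s" "s < real d / 2 + 1"
begin

definition q :: real where "q = s - real d / 2"
definition \<alpha> :: real where "\<alpha> = (real d + 1) / 2"

lemma q: "0 < q" "q < 1" and p_eq: "2 * s - real d = 2 * q"
  using s by (auto simp: q_def)

lemma \<alpha>: "\<alpha> > 0" by (simp add: \<alpha>_def)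

abbreviation "\<psi> \<equiv> dist_density \<alpha> q"
abbreviation "c\<^sub>0 \<equiv> dist_const \<alpha> q"

lemma psi_profile: "v > 0 \<Longrightarrow> \<psi> v ((norm (x - y))\<^sup>2) = (1 - poisson_profile v x y) * v powr (- q - 1)"
  for x y :: 'a
  unfolding dist_density_def[OF \<alpha> q] by (simp add: poisson_profile_def \<alpha>_def dim add.commute)

lemma psi_integral:
  fixes x y :: 'a
  shows "integrable lborel (\<lambda>v. \<psi> v ((norm (x - y))\<^sup>2))"
    and "(LINT v|lborel. \<psi> v ((norm (x - y))\<^sup>2)) = c\<^sub>0 * norm (x - y) powr (2 * s - real d)"
proof -
  show "integrable lborel (\<lambda>v. \<psi> v ((norm (x - y))\<^sup>2))"
    by (rule dist_density_integral(1)[OF \<alpha> q]) simp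
  have "((norm (x - y))\<^sup>2) powr q = norm (x - y) powr (2 * q)"
    by (cases "x = y") (simp_all add: powr_powr flip: powr_numeral)
  then show "(LINT v|lborel. \<psi> v ((norm (x - y))\<^sup>2)) = c\<^sub>0 * norm (x - y) powr (2 * s - real d)"
    using dist_density_integral(2)[OF \<alpha> q, of "(norm (x - y))\<^sup>2"] by (simp add: p_eq)
qed

lemma norm_powr_bound:
  fixes x y :: 'a
  assumes "x \<in> sphere 0 1" "y \<in> sphere 0 1"
  shows "norm (x - y) powr (2 * s - real d) \<le> 4"
proof -
  have "norm (x - y) \<le> 2" using norm_triangle_ineq4[of x y] assms by simp
  then have "norm (x - y) powr (2 * q) \<le> 2 powr (2 * q)" using q by (intro powr_mono2) auto
  also have "\<dots> \<le> 2 powr 2" using q by (intro powr_mono) auto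
  finally show ?thesis by (simp add: p_eq)
qed

text \<open>
  Fubini's theorem, applicable because the integrand is nonnegative and the potential is bounded.
\<close>

lemma potential_eq:
  fixes x :: 'a
  assumes x: "x \<in> sphere 0 1"
  shows "integrable lborel (\<lambda>v. LINT z|\<sigma>. \<psi> v ((norm (x - z))\<^sup>2))" (is ?I)
    and "c\<^sub>0 * (LINT z|\<sigma>. norm (x - z) powr (2 * s - real d)) =
      (LINT v|lborel. LINT z|\<sigma>. \<psi> v ((norm (x - z))\<^sup>2))" (is ?E)
proof -
  interpret P: pair_sigma_finite "\<sigma> :: 'a measure" "lborel :: real measure"
    by standard
  define F where "F = (\<lambda>z v. \<psi> v ((norm (x - z))\<^sup>2))"
  have meas: "case_prod F \<in> borel_measurable (\<sigma> \<Otimes>\<^sub>M lborel)"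
  proof -
    have [measurable]: "(\<lambda>z. norm (x - z)) \<in> borel_measurable \<sigma>"
      by (intro borel_measurable_surface) measurable
    show ?thesis unfolding F_def dist_density_def[OF \<alpha> q] by measurable
  qed
  have nn: "norm (F z v) = F z v" for z v
    unfolding F_def using dist_density_nonneg[OF \<alpha> q] by simp
  have int: "integrable (\<sigma> \<Otimes>\<^sub>M lborel) (case_prod F)"
  proof (rule P.Fubini_integrable[OF meas])
    have "(\<lambda>z. norm (x - z) powr (2 * s - real d)) \<in> borel_measurable \<sigma>"
      by (intro borel_measurable_surface) measurable
    then show "integrable \<sigma> (\<lambda>z. LINT v|lborel. norm (case (z, v) of (a, b) \<Rightarrow> F a b))"
      using norm_powr_bound[OF x] unfolding prod.case nn unfolding F_def psi_integral(2)
      by (intro integrable_mult_right integrable_bounded_surface[of _ 4]) auto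
    show "AE z in \<sigma>. integrable lborel (\<lambda>v. case (z, v) of (a, b) \<Rightarrow> F a b)"
      unfolding F_def using psi_integral(1) by simp
  qed
  show ?I using P.integrable_snd[OF int] by (simp add: F_def)
  show ?E using P.Fubini_integral[OF int] by (simp add: F_def psi_integral(2))
qed

lemma potential_density:
  fixes x :: 'a
  assumes x: "x \<in> sphere 0 1" and v: "v > 0"
  shows "(LINT z|\<sigma>. \<psi> v ((norm (x - z))\<^sup>2)) = (1 - (LINT z|\<sigma>. poisson_profile v x z)) * v powr (- q - 1)"
  using integrable_continuous_surface[OF continuous_on_poisson_profile[of v "sphere 0 1" x]] v
  by (simp add: psi_profile)

text \<open>
  For each \<open>v\<close> the mean of the normalized Poisson kernel is the reciprocal of the value of the kernel on
  the diagonal, which is the same at all points.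
\<close>

lemma potential_const:
  fixes x y :: 'a
  assumes x: "x \<in> sphere 0 1" and y: "y \<in> sphere 0 1"
  shows "(LINT z|\<sigma>. norm (x - z) powr (2 * s - real d)) = (LINT z|\<sigma>. norm (y - z) powr (2 * s - real d))"
proof -
  have "(LINT z|\<sigma>. \<psi> v ((norm (x - z))\<^sup>2)) = (LINT z|\<sigma>. \<psi> v ((norm (y - z))\<^sup>2))" for v
  proof (cases "v > 0")
    case True
    then obtain r where r: "0 < r" "r < 1" "v * (1 - r)\<^sup>2 = r" using poisson_parameter_exists by blast
    show ?thesis
      by (simp only: potential_density[OF x True] potential_density[OF y True]
          poisson_profile_integral[OF x r] poisson_profile_integral[OF y r])
  next
    case False
    then show ?thesis by (simp add: dist_density_def[OF \<alpha> q])
  qed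
  then have "c\<^sub>0 * (LINT z|\<sigma>. norm (x - z) powr (2 * s - real d)) =
      c\<^sub>0 * (LINT z|\<sigma>. norm (y - z) powr (2 * s - real d))"
    by (simp only: potential_eq(2)[OF x] potential_eq(2)[OF y])
  then show ?thesis using dist_const_pos[OF \<alpha> q] by simp
qed

lemma potential_eq_mean:
  fixes x :: 'a
  assumes x: "x \<in> sphere 0 1"
  shows "(LINT z|\<sigma>. norm (x - z) powr (2 * s - real d)) = mean_power_distance (2 * s - real d) TYPE('a)"
proof -
  have "mean_power_distance (2 * s - real d) TYPE('a) =
      (LINT y|(\<sigma>::'a measure). LINT z|\<sigma>. norm (x - z) powr (2 * s - real d))"
    unfolding mean_power_distance_def
    by (rule Bochner_Integration.integral_cong[OF refl], rule potential_const[OF _ x]) simp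
  then show ?thesis by simp
qed

text \<open>
  At the parameter \<open>v\<close>, the density \<open>g\<close> of the energy gap is the mean of the normalized Poisson kernel
  over pairs of points of \<open>X\<close> minus its mean over the sphere, times \<open>v\<close> to the power \<open>-q - 1\<close>.
\<close>

lemma energy_gap_density:
  fixes X :: "'a set"
  assumes X: "finite X" "X \<noteq> {}" "X \<subseteq> sphere 0 1"
  obtains g where "integrable lborel g" "c\<^sub>0 * energy_gap (2 * s - real d) X = (LINT v|lborel. g v)"
    "\<And>v. v \<le> 0 \<Longrightarrow> g v = 0"
    "\<And>v r L. 0 < r \<Longrightarrow> r < 1 \<Longrightarrow> v * (1 - r)\<^sup>2 = r \<Longrightarrow>
      g v \<ge> v powr (- q - 1) * ((1 - r) ^ d / (1 + r)) *
        (\<Sum>i\<in>idx1 L. r ^ fst i * (quad_err X (Y (fst i) (snd i)))\<^sup>2)"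
proof -
  define N where "N = real (card X)"
  have N: "N > 0" using X by (simp add: N_def card_gt_0_iff)
  obtain e where e: "e \<in> X" using X by blast
  then have eS: "e \<in> sphere 0 1" using X by blast
  define g where "g v = (LINT z|\<sigma>. \<psi> v ((norm (e - z))\<^sup>2)) -
    1 / N\<^sup>2 * (\<Sum>x\<in>X. \<Sum>y\<in>X. \<psi> v ((norm (x - y))\<^sup>2))" for v
  show ?thesis
  proof (rule that[of g])
    show "integrable lborel g"
      unfolding g_def using potential_eq(1)[OF eS] psi_integral(1) by simp
    have "(LINT v|lborel. g v) = c\<^sub>0 * mean_power_distance (2 * s - real d) TYPE('a) -
        1 / N\<^sup>2 * (\<Sum>x\<in>X. \<Sum>y\<in>X. c\<^sub>0 * norm (x - y) powr (2 * s - real d))"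
      unfolding g_def using potential_eq[OF eS] psi_integral potential_eq_mean[OF eS]
      by (simp add: Bochner_Integration.integral_sum)
    then show "c\<^sub>0 * energy_gap (2 * s - real d) X = (LINT v|lborel. g v)"
      by (simp add: energy_gap_def distance_sum_def N_def right_diff_distrib sum_distrib_left[symmetric])
    show "g v = 0" if "v \<le> 0" for v
      using that by (simp add: g_def dist_density_def[OF \<alpha> q])
    fix v r :: real and L assume r: "0 < r" "r < 1" "v * (1 - r)\<^sup>2 = r"
    have v: "v > 0" by (rule poisson_parameter_pos[OF r])
    define B where "B = (1 - r) ^ d / (1 + r)"
    have B: "B \<ge> 0" using r by (simp add: B_def)
    have dd: "DIM('a) - 1 = d" using dim by simp
    have "(\<Sum>x\<in>X. \<Sum>y\<in>X. \<psi> v ((norm (x - y))\<^sup>2)) =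
        (\<Sum>x\<in>X. \<Sum>y\<in>X. v powr (- q - 1) - v powr (- q - 1) * B * poisson (r *\<^sub>R x) y)"
    proof (intro sum.cong refl)
      fix x y assume "x \<in> X" "y \<in> X"
      then have "x \<in> sphere 0 1" "y \<in> sphere 0 1" using X by auto
      then have "poisson_profile v x y = B * poisson (r *\<^sub>R x) y"
        unfolding B_def dd[symmetric] by (rule poisson_profile_eq[OF _ _ r])
      then show "\<psi> v ((norm (x - y))\<^sup>2) =
          v powr (- q - 1) - v powr (- q - 1) * B * poisson (r *\<^sub>R x) y"
        by (simp add: psi_profile[OF v] algebra_simps)
    qed
    also have "\<dots> = v powr (- q - 1) * (N\<^sup>2 - B * (\<Sum>x\<in>X. \<Sum>y\<in>X. poisson (r *\<^sub>R x) y))"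
      by (simp add: sum_subtractf sum_distrib_left N_def power2_eq_square algebra_simps)
    finally have "g v = (1 - B) * v powr (- q - 1) -
        1 / N\<^sup>2 * (v powr (- q - 1) * (N\<^sup>2 - B * (\<Sum>x\<in>X. \<Sum>y\<in>X. poisson (r *\<^sub>R x) y)))"
      by (simp add: g_def potential_density[OF eS v] poisson_profile_integral[OF eS r] B_def dim)
    also have "\<dots> = v powr (- q - 1) * B * (1 / N\<^sup>2 * (\<Sum>x\<in>X. \<Sum>y\<in>X. poisson (r *\<^sub>R x) y) - 1)"
      using N by (simp add: field_simps)
    also have "\<dots> \<ge> v powr (- q - 1) * B * (\<Sum>i\<in>idx1 L. r ^ fst i * (quad_err X (Y (fst i) (snd i)))\<^sup>2)"
      unfolding N_def using B by (intro mult_left_mono poisson_energy_ge X r) auto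
    finally show "g v \<ge> v powr (- q - 1) * ((1 - r) ^ d / (1 + r)) *
        (\<Sum>i\<in>idx1 L. r ^ fst i * (quad_err X (Y (fst i) (snd i)))\<^sup>2)" by (simp add: B_def)
  qed
qed

text \<open>
  In this range of \<open>v\<close> the number \<open>1 - r = \<surd>(r / v)\<close> lies between \<open>1 / (4 l)\<close> and \<open>1 / (2 l)\<close>. The upper
  bound gives \<open>r\<^sup>l \<ge> 1 / 2\<close> by Bernoulli's inequality.
\<close>

lemma window_lower_bound:
  fixes l :: nat
  assumes l: "l \<ge> 1" and v: "4 * (real l)\<^sup>2 \<le> v" "v \<le> 8 * (real l)\<^sup>2"
    and r: "0 < r" "r < 1" "v * (1 - r)\<^sup>2 = r"
  shows "(8 * (real l)\<^sup>2) powr (- q - 1) * (1 / (4 * real l)) ^ d / 4 \<le>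
    v powr (- q - 1) * ((1 - r) ^ d / (1 + r)) * r ^ l"
proof -
  have l0: "real l \<ge> 1" using l by simp
  then have l2: "(real l)\<^sup>2 \<ge> 1" by simp
  have "4 * (real l)\<^sup>2 * (1 - r)\<^sup>2 \<le> v * (1 - r)\<^sup>2" using v by (intro mult_right_mono) auto
  also have "\<dots> \<le> 1\<^sup>2" using r by simp
  finally have "(2 * real l * (1 - r))\<^sup>2 \<le> 1\<^sup>2" by (simp add: power_mult_distrib)
  then have "2 * real l * (1 - r) \<le> 1" by (rule power2_le_imp_le) simp
  then have u: "real l * (1 - r) \<le> 1 / 2" by simp
  moreover have "1 - r \<le> real l * (1 - r)" using l0 r by simp
  ultimately have rhalf: "r \<ge> 1 / 2" by linarith
  have "1 + real l * (r - 1) \<le> (1 + (r - 1)) ^ l" using r by (intro Bernoulli_inequality) simp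
  then have "r ^ l \<ge> 1 + real l * (r - 1)" by simp
  moreover have "real l * (r - 1) = - (real l * (1 - r))" by (simp add: algebra_simps)
  ultimately have rl: "r ^ l \<ge> 1 / 2" using u by linarith
  have "1 / 2 \<le> v * (1 - r)\<^sup>2" using rhalf r by simp
  also have "\<dots> \<le> 8 * (real l)\<^sup>2 * (1 - r)\<^sup>2" using v by (intro mult_right_mono) auto
  finally have "1\<^sup>2 \<le> (4 * real l * (1 - r))\<^sup>2" by (simp add: power_mult_distrib)
  then have "1 \<le> 4 * real l * (1 - r)" by (rule power2_le_imp_le) (use r l0 in auto)
  then have "1 / (4 * real l) \<le> 1 - r" using l0 by (simp add: field_simps)
  then have P: "(1 / (4 * real l)) ^ d \<le> (1 - r) ^ d" by (intro power_mono) auto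
  have "(1 / (4 * real l)) ^ d / 2 \<le> (1 - r) ^ d / (1 + r)"
    using P r by (intro frac_le) auto
  moreover have "(8 * (real l)\<^sup>2) powr (- q - 1) \<le> v powr (- q - 1)"
    using v l2 q by (intro powr_mono2') auto
  ultimately have "(8 * (real l)\<^sup>2) powr (- q - 1) * ((1 / (4 * real l)) ^ d / 2) * (1 / 2) \<le>
      v powr (- q - 1) * ((1 - r) ^ d / (1 + r)) * r ^ l"
    using rl r by (intro mult_mono mult_nonneg_nonneg) auto
  then show ?thesis by simp
qed

text \<open>
  Only the part \<open>4 l\<^sup>2 \<le> v \<le> 8 l\<^sup>2\<close> of the integral is kept for degree \<open>l\<close>. The integrand there is of
  order \<open>- d - 2 q - 2\<close> in \<open>l\<close> and the range has length \<open>4 l\<^sup>2\<close>, which together make the order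
  \<open>- d - 2 q = - 2 s\<close>.
\<close>

lemma energy_gap_ge:
  obtains C where "C > 0" "\<And>X L. finite X \<Longrightarrow> X \<noteq> {} \<Longrightarrow> X \<subseteq> sphere (0::'a) 1 \<Longrightarrow>
    (\<Sum>i\<in>idx1 L. real (fst i) powr (- 2 * s) * (quad_err X (Y (fst i) (snd i)))\<^sup>2)
      \<le> C * energy_gap (2 * s - real d) X"
proof -
  define K where "K = 8 powr (- q - 1) * (1 / 4) ^ d"
  have K: "K > 0" by (simp add: K_def)
  define \<beta> where "\<beta> l = (8 * (real l)\<^sup>2) powr (- q - 1) * (1 / (4 * real l)) ^ d / 4" for l
  have \<beta>0: "\<beta> l \<ge> 0" for l by (simp add: \<beta>_def)
  have \<beta>: "4 * (real l)\<^sup>2 * \<beta> l = K * real l powr (- 2 * s)" if "l \<ge> 1" for l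
  proof -
    have l0: "real l > 0" using that by simp
    have h1: "(8 * (real l)\<^sup>2) powr (- q - 1) = 8 powr (- q - 1) * real l powr (- 2 * q - 2)"
      using l0 by (simp add: powr_mult powr_powr algebra_simps flip: powr_numeral)
    have h2: "(1 / (4 * real l)) ^ d = (1 / 4) ^ d * real l powr (- real d)"
      using l0 by (simp add: power_divide power_mult_distrib powr_minus powr_realpow inverse_eq_divide)
    have "4 * (real l)\<^sup>2 * \<beta> l =
        K * (real l powr 2 * real l powr (- 2 * q - 2) * real l powr (- real d))"
      unfolding \<beta>_def K_def h1 h2 using l0 by (simp add: mult_ac)
    also have "real l powr 2 * real l powr (- 2 * q - 2) * real l powr (- real d) = real l powr (- 2 * s)"
      unfolding powr_add[symmetric] by (rule arg_cong[where f = "\<lambda>t. real l powr t"]) (simp add: q_def)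
    finally show ?thesis .
  qed
  have c0: "c\<^sub>0 > 0" by (rule dist_const_pos[OF \<alpha> q])
  show ?thesis
  proof (rule that[of "c\<^sub>0 / K"])
    fix X :: "'a set" and L assume X: "finite X" "X \<noteq> {}" "X \<subseteq> sphere 0 1"
    define m where "m i = (quad_err X (Y (fst i) (snd i)))\<^sup>2" for i
    obtain g where g: "integrable lborel g" "c\<^sub>0 * energy_gap (2 * s - real d) X = (LINT v|lborel. g v)"
      "\<And>v. v \<le> 0 \<Longrightarrow> g v = 0"
      "\<And>v r L. 0 < r \<Longrightarrow> r < 1 \<Longrightarrow> v * (1 - r)\<^sup>2 = r \<Longrightarrow>
        g v \<ge> v powr (- q - 1) * ((1 - r) ^ d / (1 + r)) * (\<Sum>i\<in>idx1 L. r ^ fst i * m i)"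
      by (rule energy_gap_density[OF X, folded m_def]; rule that; blast)
    define I where "I l = {4 * (real l)\<^sup>2..8 * (real l)\<^sup>2}" for l
    have le: "(\<Sum>i\<in>idx1 L. m i * \<beta> (fst i) * indicator (I (fst i)) v) \<le> g v" for v
    proof (cases "v > 0")
      case True
      then obtain r where r: "0 < r" "r < 1" "v * (1 - r)\<^sup>2 = r" using poisson_parameter_exists by blast
      have "(\<Sum>i\<in>idx1 L. m i * \<beta> (fst i) * indicator (I (fst i)) v) \<le>
          (\<Sum>i\<in>idx1 L. m i * (v powr (- q - 1) * ((1 - r) ^ d / (1 + r)) * r ^ fst i))"
      proof (rule sum_mono)
        fix i assume i: "i \<in> idx1 L"
        then have l: "fst i \<ge> 1" by (auto simp: idx1_def)
        have m0: "m i \<ge> 0" by (simp add: m_def)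
        show "m i * \<beta> (fst i) * indicator (I (fst i)) v \<le> m i * (v powr (- q - 1) * ((1 - r) ^ d / (1 + r)) * r ^ fst i)"
        proof (cases "v \<in> I (fst i)")
          case True
          then have "\<beta> (fst i) \<le> v powr (- q - 1) * ((1 - r) ^ d / (1 + r)) * r ^ fst i"
            unfolding \<beta>_def I_def by (intro window_lower_bound[OF l _ _ r]) auto
          from mult_left_mono[OF this m0] show ?thesis using True by (simp only: indicator_simps mult_1_right)
        next
          case False
          then show ?thesis using m0 r by simp
        qed
      qed
      also have "\<dots> = v powr (- q - 1) * ((1 - r) ^ d / (1 + r)) * (\<Sum>i\<in>idx1 L. r ^ fst i * m i)"
        unfolding sum_distrib_left by (intro sum.cong) (auto simp: algebra_simps)
      also have "\<dots> \<le> g v" by (rule g(4)[OF r])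
      finally show ?thesis .
    next
      case False
      then have "v \<notin> I (fst i)" if "i \<in> idx1 L" for i
        using that by (auto simp: I_def idx1_def not_less)
          (smt (verit) zero_less_power2 of_nat_0_less_iff le_simps(3))
      then have "(\<Sum>i\<in>idx1 L. m i * \<beta> (fst i) * indicator (I (fst i)) v) = 0"
        by (intro sum.neutral) auto
      then show ?thesis using g(3)[of v] False by simp
    qed
    have intI: "integrable lborel (indicator (I l) :: real \<Rightarrow> real)" for l
      unfolding I_def by (simp add: integrable_indicator_iff)
    have "(LINT v|lborel. (\<Sum>i\<in>idx1 L. m i * \<beta> (fst i) * indicator (I (fst i)) v)) \<le> (LINT v|lborel. g v)"
      by (rule integral_mono[OF _ g(1) le]) (intro Bochner_Integration.integrable_sum integrable_mult_right intI)
    also have "(LINT v|lborel. (\<Sum>i\<in>idx1 L. m i * \<beta> (fst i) * indicator (I (fst i)) v)) =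
        (\<Sum>i\<in>idx1 L. m i * \<beta> (fst i) * (4 * (real (fst i))\<^sup>2))"
      using intI by (subst Bochner_Integration.integral_sum) (simp_all add: I_def)
    also have "\<dots> = (\<Sum>i\<in>idx1 L. K * (real (fst i) powr (- 2 * s) * m i))"
    proof (rule sum.cong[OF refl])
      fix i assume "i \<in> idx1 L"
      then have "fst i \<ge> 1" by (auto simp: idx1_def)
      from \<beta>[OF this] show "m i * \<beta> (fst i) * (4 * (real (fst i))\<^sup>2) = K * (real (fst i) powr (- 2 * s) * m i)"
        by (metis mult.assoc mult.commute)
    qed
    finally have "K * (\<Sum>i\<in>idx1 L. real (fst i) powr (- 2 * s) * m i) \<le> c\<^sub>0 * energy_gap (2 * s - real d) X"
      by (simp add: g(2) sum_distrib_left)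
    then show "(\<Sum>i\<in>idx1 L. real (fst i) powr (- 2 * s) * (quad_err X (Y (fst i) (snd i)))\<^sup>2)
        \<le> c\<^sub>0 / K * energy_gap (2 * s - real d) X"
      using K by (simp add: m_def field_simps)
  qed (use c0 K in simp)
qed

text \<open>
  The Cauchy-Schwarz inequality with the weights \<open>l\<close> to the power \<open>2 s\<close>, which are at most
  \<open>(1 + \<lambda>\<^sub>l)\<^sup>s\<close> since \<open>\<lambda>\<^sub>l \<ge> l\<^sup>2\<close>, on the coefficients of \<open>f\<close> and their reciprocals on the errors of the
  harmonics.
\<close>

lemma quad_err_le_energy_gap:
  assumes a: "\<And>l. a l > 0" and comp: "comparable a (\<lambda>l. (1 + eigval d l) powr (- s))"
  obtains C where "C > 0" "\<And>X f. finite X \<Longrightarrow> X \<noteq> {} \<Longrightarrow> X \<subseteq> sphere (0::'a) 1 \<Longrightarrow>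
    f \<in> sobolev_space d s Y \<Longrightarrow> sobolev_norm d a Y f \<le> 1 \<Longrightarrow>
    (quad_err X f)\<^sup>2 \<le> C * energy_gap (2 * s - real d) X"
proof -
  obtain C where C: "C > 0" "\<And>X L. finite X \<Longrightarrow> X \<noteq> {} \<Longrightarrow> X \<subseteq> sphere (0::'a) 1 \<Longrightarrow>
    (\<Sum>i\<in>idx1 L. real (fst i) powr (- 2 * s) * (quad_err X (Y (fst i) (snd i)))\<^sup>2)
      \<le> C * energy_gap (2 * s - real d) X"
    using energy_gap_ge by blast
  obtain c1 c2 where c: "c1 > 0" "c2 > 0"
    "\<And>l. c1 * a l \<le> (1 + eigval d l) powr (- s)" "\<And>l. (1 + eigval d l) powr (- s) \<le> c2 * a l"
    using comp unfolding comparable_def by blast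
  have eig: "eigval d l \<ge> (real l)\<^sup>2" for l
    using d unfolding eigval_def power2_eq_square by (intro mult_left_mono) auto
  then have eig0: "1 + eigval d l \<ge> 1" for l using zero_le_power2[of "real l"] by (meson add_increasing2 order_trans order_refl)
  have eigp: "(1 + eigval d l) powr s > 0" for l using eig0[of l] by simp
  have w1: "(1 + eigval d l) powr s \<le> 1 / c1 * (1 / a l)" for l
  proof -
    have "c1 * a l * (1 + eigval d l) powr s \<le> 1"
      using mult_right_mono[OF c(3)[of l], of "(1 + eigval d l) powr s"] eig0[of l]
      by (simp flip: powr_add)
    then show ?thesis using c(1) a[of l] by (simp add: field_simps)
  qed
  have w2: "1 / a l \<le> c2 * (1 + eigval d l) powr s" for l
  proof -
    have "1 \<le> c2 * a l * (1 + eigval d l) powr s"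
      using mult_right_mono[OF c(4)[of l], of "(1 + eigval d l) powr s"] eig0[of l]
      by (simp flip: powr_add)
    then show ?thesis using a[of l] by (simp add: field_simps)
  qed
  have w0: "real l powr (2 * s) \<le> (1 + eigval d l) powr s" if "l \<ge> 1" for l
  proof -
    have "real l powr (2 * s) = ((real l)\<^sup>2) powr s"
      using that by (simp add: powr_powr flip: powr_numeral)
    also have "\<dots> \<le> (1 + eigval d l) powr s"
      using eig[of l] s d by (intro powr_mono2) auto
    finally show ?thesis .
  qed
  show ?thesis
  proof (rule that[of "1 / c1 * C"])
    fix X :: "'a set" and f :: "'a \<Rightarrow> real"
    assume X: "finite X" "X \<noteq> {}" "X \<subseteq> sphere 0 1"
      and f: "f \<in> sobolev_space d s Y" and nf: "sobolev_norm d a Y f \<le> 1"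
    have cf: "continuous_on (sphere 0 1) f" using f by (simp add: sobolev_space_def)
    let ?a = "\<lambda>i. sphere_coeff Y f (fst i) (snd i)" and ?m = "\<lambda>i. quad_err X (Y (fst i) (snd i))"
    have summ: "summable (\<lambda>l. \<Sum>k=1..harmonic_dim d l. (1 + eigval d l) powr s * \<bar>sphere_coeff Y f l k\<bar>\<^sup>2)"
      using f by (simp add: sobolev_space_def)
    define T where "T l = (\<Sum>k=1..harmonic_dim d l. 1 / a l * \<bar>sphere_coeff Y f l k\<bar>\<^sup>2)" for l
    have T0: "T l \<ge> 0" for l
      unfolding T_def using a[of l] by (intro sum_nonneg mult_nonneg_nonneg) auto
    have "summable T"
    proof (rule summable_comparison_test'[OF summable_mult[OF summ, of c2], of 0])
      fix l
      have "T l \<le> (\<Sum>k=1..harmonic_dim d l. c2 * (1 + eigval d l) powr s * \<bar>sphere_coeff Y f l k\<bar>\<^sup>2)"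
        unfolding T_def using w2 by (intro sum_mono mult_right_mono) auto
      then show "norm (T l) \<le> c2 * (\<Sum>k=1..harmonic_dim d l. (1 + eigval d l) powr s * \<bar>sphere_coeff Y f l k\<bar>\<^sup>2)"
        using T0[of l] by (simp add: sum_distrib_left mult.assoc)
    qed
    moreover have "suminf T \<le> 1" using nf unfolding sobolev_norm_def T_def[symmetric] by simp
    ultimately have TL: "(\<Sum>l=1..L. T l) \<le> 1" for L
      using sum_le_suminf[of T "{1..L}"] T0 by fastforce
    have A: "(\<Sum>i\<in>idx1 L. real (fst i) powr (2 * s) * (?a i)\<^sup>2) \<le> 1 / c1" for L
    proof -
      have "(\<Sum>i\<in>idx1 L. real (fst i) powr (2 * s) * (?a i)\<^sup>2) \<le> (\<Sum>i\<in>idx1 L. 1 / c1 * (1 / a (fst i)) * (?a i)\<^sup>2)"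
      proof (intro sum_mono mult_right_mono)
        fix i assume "i \<in> idx1 L"
        then have "fst i \<ge> 1" by (auto simp: idx1_def)
        from order_trans[OF w0[OF this] w1] show "real (fst i) powr (2 * s) \<le> 1 / c1 * (1 / a (fst i))" .
      qed simp
      also have "\<dots> = (\<Sum>l=1..L. \<Sum>k=1..harmonic_dim d l. 1 / c1 * (1 / a l) * (sphere_coeff Y f l k)\<^sup>2)"
        by (rule sum_idx1)
      also have "\<dots> = 1 / c1 * (\<Sum>l=1..L. T l)"
        unfolding T_def sum_distrib_left by (intro sum.cong refl) simp
      also have "\<dots> \<le> 1 / c1 * 1" using c TL by (intro mult_left_mono) auto
      finally show ?thesis by simp
    qed
    define E where "E = energy_gap (2 * s - real d) X"
    have "0 \<le> C * E" using C(2)[OF X, of 0] by (simp add: E_def idx1_def)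
    then have E: "0 \<le> 1 / c1 * (C * E)" using c by simp
    have "\<bar>quad_err X f\<bar> \<le> sqrt (1 / c1 * (C * E))"
    proof (rule abs_quad_err_le[OF cf X])
      fix r :: real and L assume r: "0 < r" "r < 1"
      have "(\<Sum>i\<in>idx1 L. r ^ fst i * ?a i * ?m i)\<^sup>2 =
          (\<Sum>i\<in>idx1 L. (real (fst i) powr s * ?a i) * (real (fst i) powr (- s) * (r ^ fst i * ?m i)))\<^sup>2"
      proof (intro arg_cong[where f = "\<lambda>x. x\<^sup>2"] sum.cong refl)
        fix i assume "i \<in> idx1 L"
        then have 1: "real (fst i) powr s * real (fst i) powr (- s) = 1"
          by (auto simp: idx1_def simp flip: powr_add)
        then show "r ^ fst i * ?a i * ?m i = (real (fst i) powr s * ?a i) * (real (fst i) powr (- s) * (r ^ fst i * ?m i))"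
        proof -
          have "(real (fst i) powr s * ?a i) * (real (fst i) powr (- s) * (r ^ fst i * ?m i)) =
              (real (fst i) powr s * real (fst i) powr (- s)) * (r ^ fst i * ?a i * ?m i)"
            by (simp only: mult_ac)
          then show ?thesis by (simp only: 1 mult_1_left)
        qed
      qed
      also have "\<dots> \<le> (\<Sum>i\<in>idx1 L. (real (fst i) powr s * ?a i)\<^sup>2) *
          (\<Sum>i\<in>idx1 L. (real (fst i) powr (- s) * (r ^ fst i * ?m i))\<^sup>2)"
        by (rule Cauchy_Schwarz_ineq_sum)
      also have "\<dots> \<le> 1 / c1 * (C * E)"
      proof (intro mult_mono)
        have sq: "(x powr t)\<^sup>2 = x powr (2 * t)" for x t :: real
          by (simp add: power2_eq_square flip: powr_add)
        show "(\<Sum>i\<in>idx1 L. (real (fst i) powr s * ?a i)\<^sup>2) \<le> 1 / c1"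
          using A[of L] by (simp add: power_mult_distrib sq)
        have "(\<Sum>i\<in>idx1 L. (real (fst i) powr (- s) * (r ^ fst i * ?m i))\<^sup>2) \<le>
            (\<Sum>i\<in>idx1 L. real (fst i) powr (- 2 * s) * (?m i)\<^sup>2)"
        proof (rule sum_mono)
          fix i :: "nat \<times> nat"
          have "(r ^ fst i)\<^sup>2 \<le> 1" using r by (simp add: power_le_one)
          then have "(r ^ fst i)\<^sup>2 * (?m i)\<^sup>2 \<le> 1 * (?m i)\<^sup>2" by (rule mult_right_mono) simp
          then have "real (fst i) powr (- 2 * s) * ((r ^ fst i)\<^sup>2 * (?m i)\<^sup>2) \<le> real (fst i) powr (- 2 * s) * (1 * (?m i)\<^sup>2)"
            by (rule mult_left_mono) simp
          then show "(real (fst i) powr (- s) * (r ^ fst i * ?m i))\<^sup>2 \<le> real (fst i) powr (- 2 * s) * (?m i)\<^sup>2"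
            by (simp only: power_mult_distrib sq) simp
        qed
        also have "\<dots> \<le> C * E" unfolding E_def by (rule C(2)[OF X])
        finally show "(\<Sum>i\<in>idx1 L. (real (fst i) powr (- s) * (r ^ fst i * ?m i))\<^sup>2) \<le> C * E" .
      qed (use c in \<open>auto intro: sum_nonneg\<close>)
      finally show "\<bar>\<Sum>i\<in>idx1 L. r ^ fst i * ?a i * ?m i\<bar> \<le> sqrt (1 / c1 * (C * E))"
        by (intro real_le_rsqrt) simp
    qed
    then have "\<bar>quad_err X f\<bar>\<^sup>2 \<le> (sqrt (1 / c1 * (C * E)))\<^sup>2" by (intro power_mono) auto
    then show "(quad_err X f)\<^sup>2 \<le> 1 / c1 * C * energy_gap (2 * s - real d) X"
      using E by (simp add: E_def)
  qed (use c C in simp)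
qed

end

section \<open>Mutual energies of densities\<close>

text \<open>
  A class of functions closed under sums, products and potentials, on which all integrals converge.
\<close>

definition bounded_measurable :: "('a::euclidean_space \<Rightarrow> real) \<Rightarrow> bool" where
  "bounded_measurable f \<longleftrightarrow> f \<in> borel_measurable \<sigma> \<and> (\<exists>B. \<forall>x\<in>sphere 0 1. \<bar>f x\<bar> \<le> B)"

lemma bounded_measurable_integrable: "bounded_measurable f \<Longrightarrow> integrable \<sigma> f"
  unfolding bounded_measurable_def using integrable_bounded_surface by blast

lemma bounded_measurable_const: "bounded_measurable (\<lambda>_::'a::euclidean_space. c)"
  unfolding bounded_measurable_def by (auto intro!: exI[of _ "\<bar>c\<bar>"])

lemma bounded_measurable_add:
  assumes "bounded_measurable f" "bounded_measurable g"
  shows "bounded_measurable (\<lambda>x. f x + g x)"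
proof -
  obtain B C where "\<forall>x\<in>sphere 0 1. \<bar>f x\<bar> \<le> B" "\<forall>x\<in>sphere 0 1. \<bar>g x\<bar> \<le> C"
    using assms unfolding bounded_measurable_def by blast
  then have "\<forall>x\<in>sphere 0 1. \<bar>f x + g x\<bar> \<le> B + C" by (meson abs_triangle_ineq add_mono order_trans)
  then show ?thesis using assms unfolding bounded_measurable_def by (blast intro: borel_measurable_add)
qed

lemma bounded_measurable_mult:
  assumes "bounded_measurable f" "bounded_measurable g"
  shows "bounded_measurable (\<lambda>x. f x * g x)"
proof -
  obtain B C where BC: "\<And>x. x \<in> sphere 0 1 \<Longrightarrow> \<bar>f x\<bar> \<le> B" "\<And>x. x \<in> sphere 0 1 \<Longrightarrow> \<bar>g x\<bar> \<le> C"
    using assms unfolding bounded_measurable_def by blast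
  have "\<bar>f x * g x\<bar> \<le> B * C" if "x \<in> sphere 0 1" for x
    unfolding abs_mult using BC[OF that] by (intro mult_mono) auto
  then show ?thesis using assms unfolding bounded_measurable_def by (blast intro: borel_measurable_times)
qed

lemma bounded_measurable_sum:
  "(\<And>i. i \<in> I \<Longrightarrow> bounded_measurable (f i)) \<Longrightarrow> bounded_measurable (\<lambda>x. \<Sum>i\<in>I. f i x)"
  by (induction I rule: infinite_finite_induct) (simp_all add: bounded_measurable_const bounded_measurable_add)

lemma bounded_measurable_sum_list:
  "(\<And>w. w \<in> set ws \<Longrightarrow> bounded_measurable (h w)) \<Longrightarrow> bounded_measurable (\<lambda>x. \<Sum>w\<leftarrow>ws. h w x)"
  by (induction ws) (simp_all add: bounded_measurable_const bounded_measurable_add)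

lemma bounded_measurable_diff:
  "bounded_measurable f \<Longrightarrow> bounded_measurable g \<Longrightarrow> bounded_measurable (\<lambda>x. f x - g x)"
  using bounded_measurable_add[of f "\<lambda>x. - 1 * g x"]
    bounded_measurable_mult[OF bounded_measurable_const[of "- 1"], of g] by simp

lemma bounded_measurable_continuous:
  "continuous_on (sphere 0 1) f \<Longrightarrow> bounded_measurable f"
  unfolding bounded_measurable_def using continuous_measurable_surface bounded_continuous_sphere by metis

lemma bounded_measurable_indicator:
  fixes c :: "'a::euclidean_space \<Rightarrow> 'k"
  assumes "{x \<in> sphere 0 1. c x = k} \<in> sets \<sigma>"
  shows "bounded_measurable (\<lambda>x. of_bool (c x = k))"
proof -
  have "(\<lambda>x. indicator {x \<in> sphere 0 1. c x = k} x :: real) \<in> borel_measurable \<sigma>"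
    using assms by (rule borel_measurable_indicator)
  then have "(\<lambda>x. of_bool (c x = k) :: real) \<in> borel_measurable \<sigma>"
    by (rule measurable_cong[THEN iffD1, rotated]) (simp add: indicator_def)
  then show ?thesis unfolding bounded_measurable_def by (auto intro!: exI[of _ 1])
qed

definition unit_density :: "('a::euclidean_space \<Rightarrow> real) \<Rightarrow> bool" where
  "unit_density w \<longleftrightarrow> bounded_measurable w \<and> (\<forall>x\<in>sphere 0 1. 0 \<le> w x) \<and> (LINT x|\<sigma>. w x) = 1"

definition potential :: "real \<Rightarrow> ('a::euclidean_space \<Rightarrow> real) \<Rightarrow> 'a \<Rightarrow> real" where
  "potential p w x = (LINT z|\<sigma>. norm (x - z) powr p * w z)"

text \<open>
  The expected value of \<open>|x - y|\<^sup>p\<close> if \<open>f\<close> and \<open>g\<close> are the densities of independent points \<open>x\<close> and \<open>y\<close>.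
\<close>

definition mutual_energy :: "real \<Rightarrow> ('a::euclidean_space \<Rightarrow> real) \<Rightarrow> ('a \<Rightarrow> real) \<Rightarrow> real" where
  "mutual_energy p f g = (LINT x|\<sigma>. f x * potential p g x)"

lemma norm_powr_sphere_le:
  fixes x y :: "'a::euclidean_space"
  assumes "0 < p" "x \<in> sphere 0 1" "y \<in> sphere 0 1"
  shows "norm (x - y) powr p \<le> 2 powr p"
  using norm_triangle_ineq4[of x y] assms by (intro powr_mono2) auto

lemma bounded_measurable_dist:
  fixes x :: "'a::euclidean_space"
  assumes p: "0 < p"
  shows "bounded_measurable (\<lambda>z. norm (x - z) powr p)"
  using p by (intro bounded_measurable_continuous continuous_on_powr' continuous_intros) auto

lemma bounded_measurable_dist':
  fixes x :: "'a::euclidean_space"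
  assumes p: "0 < p"
  shows "bounded_measurable (\<lambda>z. norm (z - x) powr p)"
  using bounded_measurable_dist[OF p, of x] by (simp add: norm_minus_commute)

lemma dist_kernel_measurable:
  fixes p :: real
  shows "(\<lambda>(x, z). norm (x - z :: 'a::euclidean_space) powr p) \<in> borel_measurable (\<sigma> \<Otimes>\<^sub>M \<sigma>)"
proof -
  have [measurable]: "(\<lambda>x. x) \<in> measurable (\<sigma> :: 'a measure) borel"
    by (rule borel_measurable_surface) simp
  show ?thesis by measurable
qed

lemma bounded_measurable_potential:
  fixes w :: "'a::euclidean_space \<Rightarrow> real"
  assumes p: "0 < p" and w: "bounded_measurable w"
  shows "bounded_measurable (potential p w)"
proof -
  obtain B where B: "\<And>x. x \<in> sphere 0 1 \<Longrightarrow> \<bar>w x\<bar> \<le> B"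
    using w unfolding bounded_measurable_def by blast
  have [measurable]: "w \<in> borel_measurable \<sigma>" using w by (simp add: bounded_measurable_def)
  note [measurable] = dist_kernel_measurable
  have "(\<lambda>(x, z). norm (x - z) powr p * w z) \<in> borel_measurable (\<sigma> \<Otimes>\<^sub>M \<sigma>)"
  proof -
    have "(\<lambda>y. (case y of (x, z) \<Rightarrow> norm (x - z) powr p) * w (snd y)) \<in> borel_measurable (\<sigma> \<Otimes>\<^sub>M \<sigma>)"
      by measurable
    then show ?thesis by (simp add: case_prod_beta')
  qed
  then have m: "potential p w \<in> borel_measurable \<sigma>"
    unfolding potential_def by (rule surface.borel_measurable_lebesgue_integral)
  have "\<bar>potential p w x\<bar> \<le> 2 powr p * B" if x: "x \<in> sphere 0 1" for x
    unfolding potential_def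
  proof (rule abs_integral_surface_le)
    show "(\<lambda>z. norm (x - z) powr p * w z) \<in> borel_measurable \<sigma>"
      using bounded_measurable_mult[OF bounded_measurable_dist[OF p, of x] w] by (simp add: bounded_measurable_def)
    fix z :: 'a assume z: "z \<in> sphere 0 1"
    show "\<bar>norm (x - z) powr p * w z\<bar> \<le> 2 powr p * B"
      unfolding abs_mult using norm_powr_sphere_le[OF p x z] B[OF z] by (intro mult_mono) auto
  qed
  then show ?thesis using m unfolding bounded_measurable_def by blast
qed

lemma potential_add:
  assumes p: "0 < p" and f: "bounded_measurable f" and g: "bounded_measurable g"
  shows "potential p (\<lambda>x. f x + g x) x = potential p f x + potential p g x"
  unfolding potential_def distrib_left
  using assms by (intro Bochner_Integration.integral_add bounded_measurable_integrable
      bounded_measurable_mult bounded_measurable_dist)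

lemma mutual_energy_add_left:
  assumes p: "0 < p" and f: "bounded_measurable f" and g: "bounded_measurable g" and h: "bounded_measurable h"
  shows "mutual_energy p (\<lambda>x. f x + g x) h = mutual_energy p f h + mutual_energy p g h"
  unfolding mutual_energy_def distrib_right
  using assms by (intro Bochner_Integration.integral_add bounded_measurable_integrable
      bounded_measurable_mult bounded_measurable_potential)

lemma mutual_energy_add_right:
  assumes p: "0 < p" and f: "bounded_measurable f" and g: "bounded_measurable g" and h: "bounded_measurable h"
  shows "mutual_energy p h (\<lambda>x. f x + g x) = mutual_energy p h f + mutual_energy p h g"
  unfolding mutual_energy_def potential_add[OF p f g] distrib_left
  using assms by (intro Bochner_Integration.integral_add bounded_measurable_integrable
      bounded_measurable_mult bounded_measurable_potential)

lemma mutual_energy_commute: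
  fixes f g :: "'a::euclidean_space \<Rightarrow> real"
  assumes p: "0 < p" and f: "bounded_measurable f" and g: "bounded_measurable g"
  shows "mutual_energy p f g = mutual_energy p g f"
proof -
  interpret P: pair_sigma_finite "\<sigma> :: 'a measure" "\<sigma> :: 'a measure" by standard
  obtain B C where BC: "\<And>x. x \<in> sphere 0 1 \<Longrightarrow> \<bar>f x\<bar> \<le> B" "\<And>x. x \<in> sphere 0 1 \<Longrightarrow> \<bar>g x\<bar> \<le> C"
    using f g unfolding bounded_measurable_def by blast
  have fg [measurable]: "f \<in> borel_measurable \<sigma>" "g \<in> borel_measurable \<sigma>"
    using f g by (simp_all add: bounded_measurable_def)
  note [measurable] = dist_kernel_measurable
  define F where "F = (\<lambda>x z. norm (x - z) powr p * (f x * g z))"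
  have m: "case_prod F \<in> borel_measurable (\<sigma> \<Otimes>\<^sub>M \<sigma>)"
  proof -
    have "(\<lambda>y. (case y of (x, z) \<Rightarrow> norm (x - z) powr p) * (f (fst y) * g (snd y))) \<in> borel_measurable (\<sigma> \<Otimes>\<^sub>M \<sigma>)"
      by measurable
    then show ?thesis by (simp add: F_def case_prod_beta')
  qed
  have bF: "bounded_measurable (\<lambda>z. F x z)" for x
    unfolding F_def by (intro bounded_measurable_mult bounded_measurable_dist p bounded_measurable_const g)
  have int: "integrable (\<sigma> \<Otimes>\<^sub>M \<sigma>) (case_prod F)"
  proof (rule P.Fubini_integrable[OF m])
    show "AE x in \<sigma>. integrable \<sigma> (\<lambda>y. case (x, y) of (a, b) \<Rightarrow> F a b)"
      using bounded_measurable_integrable[OF bF] by simp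
    have "(\<lambda>(x, z). norm (F x z)) \<in> borel_measurable (\<sigma> \<Otimes>\<^sub>M \<sigma>)"
      using measurable_compose[OF m borel_measurable_norm] by (simp add: case_prod_beta')
    then have mm: "(\<lambda>x. LINT z|\<sigma>. norm (F x z)) \<in> borel_measurable \<sigma>"
      by (rule surface.borel_measurable_lebesgue_integral)
    show "integrable \<sigma> (\<lambda>x. LINT y|\<sigma>. norm (case (x, y) of (a, b) \<Rightarrow> F a b))"
      unfolding prod.case
    proof (rule integrable_bounded_surface[OF mm])
      fix x :: 'a assume x: "x \<in> sphere 0 1"
      show "\<bar>LINT z|\<sigma>. norm (F x z)\<bar> \<le> 2 powr p * (B * C)"
      proof (rule abs_integral_surface_le)
        show "(\<lambda>z. norm (F x z)) \<in> borel_measurable \<sigma>"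
          using bF[of x] by (intro measurable_compose[OF _ borel_measurable_norm]) (simp add: bounded_measurable_def)
        fix z :: 'a assume z: "z \<in> sphere 0 1"
        have "B \<ge> 0" using BC(1)[OF x] by linarith
        then show "\<bar>norm (F x z)\<bar> \<le> 2 powr p * (B * C)"
          unfolding F_def real_norm_def abs_idempotent abs_mult
          using norm_powr_sphere_le[OF p x z] BC(1)[OF x] BC(2)[OF z] by (intro mult_mono) auto
      qed
    qed
  qed
  have "mutual_energy p f g = (LINT x|\<sigma>. LINT z|\<sigma>. F x z)"
    unfolding mutual_energy_def potential_def F_def by (simp add: mult_ac flip: integral_mult_right_zero)
  also have "\<dots> = (LINT z|\<sigma>. LINT x|\<sigma>. F x z)" using P.Fubini_integral[OF int] by simp
  also have "\<dots> = mutual_energy p g f"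
    unfolding mutual_energy_def potential_def F_def
    by (simp add: mult_ac norm_minus_commute flip: integral_mult_right_zero)
  finally show ?thesis .
qed

section \<open>From densities to points\<close>

text \<open>
  A function cannot be below its mean almost everywhere, and finitely many points are a null set.
\<close>

lemma exists_point_ge_mean:
  fixes g w :: "'a::euclidean_space \<Rightarrow> real"
  assumes dim: "DIM('a) \<ge> 2" and w: "unit_density w" and g: "bounded_measurable g" and F: "finite F"
  obtains x where "x \<in> sphere 0 1" "x \<notin> F" "g x \<ge> (LINT x|\<sigma>. w x * g x)"
proof (rule ccontr)
  note obtained = that
  assume "\<not> thesis"
  define m where "m = (LINT x|\<sigma>. w x * g x)"
  have less: "g x < m" if "x \<in> sphere 0 1" "x \<notin> F" for x
    using \<open>\<not> thesis\<close> obtained[of x] that unfolding m_def by (meson not_le)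
  have w': "bounded_measurable w" "\<And>x. x \<in> sphere 0 1 \<Longrightarrow> w x \<ge> 0" "(LINT x|\<sigma>. w x) = 1"
    using w by (auto simp: unit_density_def)
  have "AE x in \<sigma>. x \<noteq> y" for y :: 'a
  proof (cases "y \<in> sphere 0 1")
    case True
    then have "{y} \<in> null_sets \<sigma>"
      using surface_measure_singleton[OF dim True]
      by (auto simp: null_sets_def sets_surface_measure sets_restrict_space)
    from AE_not_in[OF this] show ?thesis by simp
  next
    case False
    then show ?thesis by (intro AE_I2) auto
  qed
  then have F0: "AE x in \<sigma>. \<forall>y\<in>F. x \<noteq> y" using F by (simp add: AE_finite_all)
  have int: "integrable \<sigma> (\<lambda>x. w x * (m - g x))"
    by (intro bounded_measurable_integrable bounded_measurable_mult bounded_measurable_diff bounded_measurable_const w' g)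
  have nn: "AE x in \<sigma>. 0 \<le> w x * (m - g x)"
    using F0 AE_space
  proof eventually_elim
    case (elim x)
    then show ?case using less[of x] w'(2)[of x] by (intro mult_nonneg_nonneg) auto
  qed
  have "(LINT x|\<sigma>. w x * (m - g x)) = m * (LINT x|\<sigma>. w x) - m"
    unfolding right_diff_distrib
    by (subst Bochner_Integration.integral_diff)
      (auto intro!: bounded_measurable_integrable bounded_measurable_mult bounded_measurable_const w' g simp: m_def)
  then have "(LINT x|\<sigma>. w x * (m - g x)) = 0" by (simp add: w')
  then have "AE x in \<sigma>. w x * (m - g x) = 0"
    using integral_nonneg_eq_0_iff_AE[OF int nn] by simp
  with F0 AE_space have "AE x in \<sigma>. w x = 0"
  proof eventually_elim
    case (elim x)
    then show ?case using less[of x] by auto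
  qed
  then have "(LINT x|\<sigma>. w x) = (LINT x|(\<sigma>::'a measure). 0)"
    using w'(1) by (intro integral_cong_AE) (auto simp: bounded_measurable_def)
  then show False using w'(3) by simp
qed

text \<open>
  The expected sum of distances of independent points with the densities in the list.
\<close>

fun offdiagonal_energy :: "real \<Rightarrow> ('a::euclidean_space \<Rightarrow> real) list \<Rightarrow> real" where
  "offdiagonal_energy p [] = 0"
| "offdiagonal_energy p (w # ws) = 2 * (\<Sum>v\<leftarrow>ws. mutual_energy p w v) + offdiagonal_energy p ws"

lemma mutual_energy_sum_list_right:
  assumes p: "0 < p" and w: "bounded_measurable w" and ws: "\<And>v. v \<in> set ws \<Longrightarrow> bounded_measurable v"
  shows "mutual_energy p w (\<lambda>x. \<Sum>v\<leftarrow>ws. v x) = (\<Sum>v\<leftarrow>ws. mutual_energy p w v)"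
  using ws
proof (induction ws)
  case Nil
  then show ?case by (simp add: mutual_energy_def potential_def)
next
  case (Cons v ws)
  then show ?case
    using mutual_energy_add_right[OF p, of v "\<lambda>x. \<Sum>v\<leftarrow>ws. v x" w] w
    by (simp add: bounded_measurable_sum_list)
qed

lemma mutual_energy_sum_list:
  assumes p: "0 < p" and ws: "\<And>v. v \<in> set ws \<Longrightarrow> bounded_measurable v"
  shows "mutual_energy p (\<lambda>x. \<Sum>v\<leftarrow>ws. v x) (\<lambda>x. \<Sum>v\<leftarrow>ws. v x) =
    offdiagonal_energy p ws + (\<Sum>v\<leftarrow>ws. mutual_energy p v v)"
  using ws
proof (induction ws)
  case Nil
  then show ?case by (simp add: mutual_energy_def)
next
  case (Cons w ws)
  define f where "f = (\<lambda>x. \<Sum>v\<leftarrow>ws. v x)"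
  have w: "bounded_measurable w" and f: "bounded_measurable f"
    using Cons by (auto simp: f_def intro!: bounded_measurable_sum_list)
  have "mutual_energy p (\<lambda>x. w x + f x) (\<lambda>x. w x + f x) =
      mutual_energy p w w + 2 * mutual_energy p w f + mutual_energy p f f"
    by (simp add: mutual_energy_add_left[OF p w f bounded_measurable_add[OF w f]]
        mutual_energy_add_right[OF p w f w] mutual_energy_add_right[OF p w f f] mutual_energy_commute[OF p f w])
  also have "mutual_energy p w f = (\<Sum>v\<leftarrow>ws. mutual_energy p w v)"
    unfolding f_def using Cons by (intro mutual_energy_sum_list_right[OF p w]) auto
  also have "mutual_energy p f f = offdiagonal_energy p ws + (\<Sum>v\<leftarrow>ws. mutual_energy p v v)"
    unfolding f_def using Cons by auto
  finally show ?case by (simp add: f_def)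
qed

lemma distance_sum_insert:
  fixes x :: "'a::euclidean_space"
  assumes "finite F" "x \<notin> F"
  shows "distance_sum p (insert x F) = distance_sum p F + 2 * (\<Sum>y\<in>F. norm (y - x) powr p)"
  using assms by (simp add: distance_sum_def sum.distrib norm_minus_commute[of x])

text \<open>
  The points are fixed one after the other, each so that the conditional expectation of the final sum of
  distances does not decrease. The right-hand side is that expectation when the points of \<open>F\<close> are fixed and
  those with the densities \<open>ws\<close> are still random. New points avoid the old ones, which keeps the cardinality.
\<close>

lemma exists_points_ge_mean:
  fixes ws :: "('a::euclidean_space \<Rightarrow> real) list"
  assumes dim: "DIM('a) \<ge> 2" and p: "0 < p"
    and ws: "\<And>w. w \<in> set ws \<Longrightarrow> unit_density w" and F: "finite F" "F \<subseteq> sphere 0 1"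
  shows "\<exists>F' :: 'a set. finite F' \<and> F' \<subseteq> sphere 0 1 \<and> card F' = card F + length ws \<and>
    distance_sum p F' \<ge> distance_sum p F +
      2 * (\<Sum>w\<leftarrow>ws. \<Sum>y\<in>F. potential p w y) + offdiagonal_energy p ws"
  using ws F
proof (induction ws arbitrary: F)
  case Nil
  show ?case by (rule exI[of _ F]) (use Nil.prems in simp)
next
  case (Cons w ws)
  have w: "unit_density w" "bounded_measurable w" using Cons.prems(1)[of w] by (auto simp: unit_density_def)
  have bv: "bounded_measurable v" if "v \<in> set ws" for v
    using Cons.prems(1)[of v] that by (auto simp: unit_density_def)
  define g where "g x = 2 * (\<Sum>y\<in>F. norm (x - y) powr p) + 2 * (\<Sum>v\<leftarrow>ws. potential p v x)" for x
  have bl: "bounded_measurable (\<lambda>x. \<Sum>v\<leftarrow>ws. potential p v x)"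
    by (intro bounded_measurable_sum_list bounded_measurable_potential p bv)
  have bs: "bounded_measurable (\<lambda>x. \<Sum>y\<in>F. norm (x - y) powr p)"
    by (intro bounded_measurable_sum bounded_measurable_dist' p)
  have bg: "bounded_measurable g"
    unfolding g_def by (intro bounded_measurable_add bounded_measurable_mult bounded_measurable_const bl bs)
  obtain x where x: "x \<in> sphere 0 1" "x \<notin> F" "g x \<ge> (LINT x|\<sigma>. w x * g x)"
    using exists_point_ge_mean[OF dim w(1) bg Cons.prems(2)] by blast
  have "(LINT x|\<sigma>. w x * g x) = 2 * (LINT x|\<sigma>. w x * (\<Sum>y\<in>F. norm (x - y) powr p)) +
      2 * (LINT x|\<sigma>. w x * (\<Sum>v\<leftarrow>ws. potential p v x))"
  proof -
    have "(LINT x|\<sigma>. w x * g x) = (LINT x|\<sigma>. 2 * (w x * (\<Sum>y\<in>F. norm (x - y) powr p)) +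
      2 * (w x * (\<Sum>v\<leftarrow>ws. potential p v x)))"
      by (simp add: g_def algebra_simps)
    also have "\<dots> = 2 * (LINT x|\<sigma>. w x * (\<Sum>y\<in>F. norm (x - y) powr p)) +
      2 * (LINT x|\<sigma>. w x * (\<Sum>v\<leftarrow>ws. potential p v x))"
      using bounded_measurable_integrable[OF bounded_measurable_mult[OF w(2) bl]]
        bounded_measurable_integrable[OF bounded_measurable_mult[OF w(2) bs]] by simp
    finally show ?thesis .
  qed
  also have "(LINT x|\<sigma>. w x * (\<Sum>y\<in>F. norm (x - y) powr p)) = (\<Sum>y\<in>F. potential p w y)"
  proof -
    have "(LINT x|\<sigma>. w x * (\<Sum>y\<in>F. norm (x - y) powr p)) = (LINT x|\<sigma>. (\<Sum>y\<in>F. norm (y - x) powr p * w x))"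
      by (simp add: sum_distrib_left mult.commute norm_minus_commute)
    also have "\<dots> = (\<Sum>y\<in>F. LINT x|\<sigma>. norm (y - x) powr p * w x)"
      by (intro Bochner_Integration.integral_sum bounded_measurable_integrable bounded_measurable_mult
          bounded_measurable_dist p w)
    finally show ?thesis by (simp add: potential_def)
  qed
  also have "(LINT x|\<sigma>. w x * (\<Sum>v\<leftarrow>ws. potential p v x)) = (\<Sum>v\<leftarrow>ws. mutual_energy p w v)"
    using bv
  proof (induction ws)
    case (Cons v ws)
    have "bounded_measurable (\<lambda>x. \<Sum>v\<leftarrow>ws. potential p v x)"
      using Cons.prems p by (intro bounded_measurable_sum_list bounded_measurable_potential) auto
    then have "integrable \<sigma> (\<lambda>x. w x * potential p v x)" "integrable \<sigma> (\<lambda>x. w x * (\<Sum>v\<leftarrow>ws. potential p v x))"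
      using Cons.prems p w by (auto intro!: bounded_measurable_integrable bounded_measurable_mult bounded_measurable_potential)
    then show ?case using Cons by (simp add: distrib_left mutual_energy_def)
  qed simp
  finally have gx: "g x \<ge> 2 * (\<Sum>y\<in>F. potential p w y) + 2 * (\<Sum>v\<leftarrow>ws. mutual_energy p w v)"
    using x(3) by linarith
  have "\<And>w. w \<in> set ws \<Longrightarrow> unit_density w" "finite (insert x F)" "insert x F \<subseteq> sphere 0 1"
    using Cons.prems x by auto
  from Cons.IH[OF this] obtain F' :: "'a set" where F': "finite F'" "F' \<subseteq> sphere 0 1"
    "card F' = card (insert x F) + length ws"
    "distance_sum p F' \<ge> distance_sum p (insert x F) +
      2 * (\<Sum>w\<leftarrow>ws. \<Sum>y\<in>insert x F. potential p w y) + offdiagonal_energy p ws"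
    by blast
  have "(\<Sum>w\<leftarrow>ws. \<Sum>y\<in>insert x F. potential p w y) =
      (\<Sum>v\<leftarrow>ws. potential p v x) + (\<Sum>w\<leftarrow>ws. \<Sum>y\<in>F. potential p w y)"
    using Cons.prems x by (simp add: sum_list_addf)
  then have "distance_sum p F' \<ge> distance_sum p F + g x +
      2 * (\<Sum>w\<leftarrow>ws. \<Sum>y\<in>F. potential p w y) + offdiagonal_energy p ws"
    using F'(4) distance_sum_insert[OF Cons.prems(2) x(2), of p]
    by (simp add: g_def norm_minus_commute[of x])
  then have "distance_sum p F' \<ge> distance_sum p F +
      2 * (\<Sum>w\<leftarrow>w # ws. \<Sum>y\<in>F. potential p w y) + offdiagonal_energy p (w # ws)"
    using gx by simp
  then show ?case using F'(1-3) Cons.prems x by (intro exI[of _ F']) auto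
qed

section \<open>Multiscale rounding of the uniform distribution\<close>

text \<open>
  On a cell of mass \<open>m\<close>, the normalized restriction of \<open>\<rho>\<close> is used \<open>\<lfloor>m\<rfloor>\<close> times as a unit density; a
  residual of mass below \<open>1\<close> remains. Since the support of such a density has diameter at most \<open>\<delta>\<close>, its
  self-energy is at most \<open>\<delta>\<close> to the power \<open>p\<close>.
\<close>

lemma rounding_step:
  fixes \<rho> :: "'a::euclidean_space \<Rightarrow> real" and c :: "'a \<Rightarrow> 'k"
  assumes p: "0 < p" and \<rho>: "bounded_measurable \<rho>" "\<And>x. x \<in> sphere 0 1 \<Longrightarrow> 0 \<le> \<rho> x"
    and fin: "finite (c ` sphere 0 1)" and M: "real (card (c ` sphere 0 1)) \<le> M"
    and meas: "\<And>k. {x \<in> sphere 0 1. c x = k} \<in> sets \<sigma>"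
    and diam: "\<And>x y. x \<in> sphere 0 1 \<Longrightarrow> y \<in> sphere 0 1 \<Longrightarrow> c x = c y \<Longrightarrow> norm (x - y) \<le> \<delta>"
  obtains ws \<rho>' where "\<And>w. w \<in> set ws \<Longrightarrow> unit_density w"
    "\<And>w. w \<in> set ws \<Longrightarrow> mutual_energy p w w \<le> \<delta> powr p"
    "bounded_measurable \<rho>'" "\<And>x. x \<in> sphere 0 1 \<Longrightarrow> 0 \<le> \<rho>' x"
    "\<And>x. x \<in> sphere 0 1 \<Longrightarrow> \<rho> x = (\<Sum>w\<leftarrow>ws. w x) + \<rho>' x"
    "(LINT x|\<sigma>. \<rho>' x) < M" "real (length ws) \<le> (LINT x|\<sigma>. \<rho> x)"
proof -
  define K where "K = c ` (sphere 0 1 :: 'a set)"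
  obtain ks where ks: "set ks = K" "distinct ks" using finite_distinct_list[OF fin] by (auto simp: K_def)
  have K: "finite K" "K \<noteq> {}" using fin SOME_Basis by (auto simp: K_def ex_in_conv[symmetric] intro: exI[of _ "SOME b. b \<in> Basis"])
  define m where "m k = (LINT x|\<sigma>. \<rho> x * of_bool (c x = k))" for k
  define n where "n k = nat \<lfloor>m k\<rfloor>" for k
  define u where "u k x = \<rho> x * of_bool (c x = k) / m k" for k x
  define ws where "ws = concat (map (\<lambda>k. replicate (n k) (u k)) ks)"
  \<comment> \<open>On cells of mass \<open>0\<close> the quotient is \<open>0 / 0 = 0\<close>, and all of \<open>\<rho>\<close> stays in the residual.\<close>
  define \<rho>' where "\<rho>' x = (\<Sum>k\<in>K. \<rho> x * of_bool (c x = k) * (1 - real (n k) / m k))" for x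
  have bk: "bounded_measurable (\<lambda>x. \<rho> x * of_bool (c x = k))" for k
    by (intro bounded_measurable_mult \<rho> bounded_measurable_indicator meas)
  have m0: "m k \<ge> 0" for k
    unfolding m_def using \<rho>(2) by (intro Bochner_Integration.integral_nonneg_AE AE_I2) auto
  have n: "real (n k) \<le> m k" "m k < real (n k) + 1" for k
    using m0[of k] by (simp_all add: n_def of_nat_nat)
  have nm: "real (n k) / m k \<le> 1" for k using n(1)[of k] m0[of k] by (simp add: divide_le_eq)
  have unit: "unit_density (u k)" if "n k > 0" for k
  proof -
    have mk: "m k > 0" using n(1)[of k] that by linarith
    have "bounded_measurable (\<lambda>x. inverse (m k) * (\<rho> x * of_bool (c x = k)))"
      by (intro bounded_measurable_mult[OF bounded_measurable_const bk])
    then have "bounded_measurable (u k)" by (simp add: u_def[abs_def] divide_inverse mult.commute)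
    moreover have "(LINT x|\<sigma>. u k x) = 1" using mk by (simp add: u_def m_def)
    moreover have "0 \<le> u k x" if "x \<in> sphere 0 1" for x using \<rho>(2)[OF that] mk by (simp add: u_def)
    ultimately show ?thesis by (simp add: unit_density_def)
  qed
  have mem: "\<exists>k. n k > 0 \<and> w = u k" if "w \<in> set ws" for w
    using that by (auto simp: ws_def in_set_replicate)
  have energy: "mutual_energy p (u k) (u k) \<le> \<delta> powr p" if "n k > 0" for k
  proof -
    have uk: "bounded_measurable (u k)" "(LINT x|\<sigma>. u k x) = 1" "\<And>x. x \<in> sphere 0 1 \<Longrightarrow> u k x \<ge> 0"
      using unit[OF that] by (auto simp: unit_density_def)
    have out: "u k x = 0" if "c x \<noteq> k" for x using that by (simp add: u_def)
    have pot: "potential p (u k) x \<le> \<delta> powr p" if x: "x \<in> sphere 0 1" "c x = k" for x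
    proof -
      have "potential p (u k) x \<le> (LINT z|\<sigma>. \<delta> powr p * u k z)"
        unfolding potential_def
      proof (rule integral_mono)
        fix z :: 'a assume "z \<in> space \<sigma>"
        then have z: "z \<in> sphere 0 1" by simp
        show "norm (x - z) powr p * u k z \<le> \<delta> powr p * u k z"
        proof (cases "c z = k")
          case True
          then have "norm (x - z) powr p \<le> \<delta> powr p"
            using diam[OF x(1) z] x p by (intro powr_mono2) auto
          then show ?thesis using uk(3)[OF z] by (rule mult_right_mono)
        qed (simp add: out)
      qed (intro bounded_measurable_integrable bounded_measurable_mult bounded_measurable_dist
          bounded_measurable_const p uk)+
      then show ?thesis using uk(2) by simp
    qed
    have "mutual_energy p (u k) (u k) \<le> (LINT x|\<sigma>. u k x * \<delta> powr p)"
      unfolding mutual_energy_def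
    proof (rule integral_mono)
      fix x :: 'a assume "x \<in> space \<sigma>"
      then have x: "x \<in> sphere 0 1" by simp
      show "u k x * potential p (u k) x \<le> u k x * \<delta> powr p"
        using pot[OF x] uk(3)[OF x] out[of x] by (cases "c x = k") (auto intro: mult_left_mono)
    qed (intro bounded_measurable_integrable bounded_measurable_mult bounded_measurable_potential
        bounded_measurable_const p uk)+
    then show ?thesis using uk(2) by simp
  qed
  have pick: "(\<Sum>k\<in>K. \<rho> x * of_bool (c x = k) * t k) = \<rho> x * t (c x)" if "x \<in> sphere 0 1" for x t
  proof -
    have "(\<Sum>k\<in>K. \<rho> x * of_bool (c x = k) * t k) = (\<Sum>k\<in>K. if c x = k then \<rho> x * t k else 0)"
      by (intro sum.cong) auto
    then show ?thesis using K(1) that by (simp add: K_def)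
  qed
  have sumws: "(\<Sum>w\<leftarrow>ws. w x) = (\<Sum>k\<in>K. \<rho> x * of_bool (c x = k) * (real (n k) / m k))" for x
  proof -
    have "(\<Sum>w\<leftarrow>concat (map (\<lambda>k. replicate (n k) (u k)) l). w x) = (\<Sum>k\<leftarrow>l. real (n k) * u k x)" for l
      by (induction l) (simp_all add: sum_list_replicate)
    then have "(\<Sum>w\<leftarrow>ws. w x) = (\<Sum>k\<in>K. real (n k) * u k x)"
      using ks by (simp add: ws_def sum_list_distinct_conv_sum_set)
    then show ?thesis by (simp add: u_def mult_ac)
  qed
  have len: "real (length ws) = (\<Sum>k\<in>K. real (n k))"
  proof -
    have "real (length (concat (map (\<lambda>k. replicate (n k) (u k)) l))) = (\<Sum>k\<leftarrow>l. real (n k))" for l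
      by (induction l) simp_all
    then show ?thesis using ks by (simp add: ws_def sum_list_distinct_conv_sum_set)
  qed
  have total: "(LINT x|\<sigma>. \<rho> x) = (\<Sum>k\<in>K. m k)"
  proof -
    have "(LINT x|\<sigma>. \<rho> x) = (LINT x|\<sigma>. (\<Sum>k\<in>K. \<rho> x * of_bool (c x = k)))"
      using pick[where t = "\<lambda>_. 1"] by (intro Bochner_Integration.integral_cong) auto
    also have "\<dots> = (\<Sum>k\<in>K. m k)"
      unfolding m_def by (intro Bochner_Integration.integral_sum bounded_measurable_integrable bk)
    finally show ?thesis .
  qed
  show ?thesis
  proof (rule that[of ws \<rho>'])
    show "unit_density w" "mutual_energy p w w \<le> \<delta> powr p" if "w \<in> set ws" for w
      using mem[OF that] unit energy by auto
    show "bounded_measurable \<rho>'"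
      unfolding \<rho>'_def by (intro bounded_measurable_sum bounded_measurable_mult[OF bk bounded_measurable_const])
    show "0 \<le> \<rho>' x" if "x \<in> sphere 0 1" for x
      unfolding \<rho>'_def using \<rho>(2)[OF that] nm by (intro sum_nonneg mult_nonneg_nonneg) auto
    show "\<rho> x = (\<Sum>w\<leftarrow>ws. w x) + \<rho>' x" if "x \<in> sphere 0 1" for x
      unfolding sumws \<rho>'_def pick[OF that] by (simp add: algebra_simps)
    have "(LINT x|\<sigma>. \<rho>' x) = (\<Sum>k\<in>K. m k * (1 - real (n k) / m k))"
      unfolding \<rho>'_def using bounded_measurable_integrable[OF bk]
      by (subst Bochner_Integration.integral_sum) (simp_all add: m_def)
    also have "\<dots> = (\<Sum>k\<in>K. m k - real (n k))"
    proof (intro sum.cong refl)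
      fix k show "m k * (1 - real (n k) / m k) = m k - real (n k)"
        using n(1)[of k] by (cases "m k = 0") (simp_all add: right_diff_distrib)
    qed
    also have "\<dots> < (\<Sum>k\<in>K. 1)"
    proof (rule sum_strict_mono[OF K])
      fix k show "m k - real (n k) < 1" using n(2)[of k] by linarith
    qed
    also have "\<dots> \<le> M" using M by (simp add: K_def)
    finally show "(LINT x|\<sigma>. \<rho>' x) < M" .
    show "real (length ws) \<le> (LINT x|\<sigma>. \<rho> x)"
      unfolding len total by (intro sum_mono n)
  qed
qed

text \<open>
  The sphere is projected radially to the boundary of the cube \<open>[-1, 1]\<close> to the power \<open>d + 1\<close>, whose
  points are located in the grid of mesh \<open>2\<close> to the power \<open>-k\<close>. On the boundary one coordinate is
  \<open>\<plusminus>1\<close>, so that only \<open>d\<close> coordinates are free and the number of cells is of order \<open>2\<close> to the power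
  \<open>k d\<close>.
\<close>

definition cube_cell :: "nat \<Rightarrow> 'a::euclidean_space \<Rightarrow> 'a \<Rightarrow> int" where
  "cube_cell k x = restrict (\<lambda>b. \<lfloor>2 ^ k * ((x \<bullet> b) / infnorm x)\<rfloor>) Basis"

lemma infnorm_attained:
  fixes x :: "'a::euclidean_space"
  obtains b where "b \<in> Basis" "\<bar>x \<bullet> b\<bar> = infnorm x"
proof -
  have "infnorm x \<in> (\<lambda>i. \<bar>x \<bullet> i\<bar>) ` Basis"
    unfolding infnorm_Max by (rule Max_in) auto
  then show ?thesis using that by auto
qed

lemma cube_cell_count:
  "finite (cube_cell k ` sphere (0::'a::euclidean_space) 1)"
  "real (card (cube_cell k ` sphere (0::'a) 1)) \<le>
    2 * real DIM('a) * 3 ^ (DIM('a) - 1) * 2 ^ (k * (DIM('a) - 1))"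
proof -
  define Z where "Z = {- (2 ^ k)..2 ^ k :: int}"
  define T where "T b e = (\<Pi>\<^sub>E b'\<in>(Basis::'a set). if b' = b then {e} else Z)" for b :: 'a and e :: int
  define U where "U = (\<Union>b\<in>(Basis::'a set). T b (2 ^ k) \<union> T b (- (2 ^ k)))"
  have sub: "cube_cell k ` sphere (0::'a) 1 \<subseteq> U"
  proof
    fix f assume "f \<in> cube_cell k ` sphere (0::'a) 1"
    then obtain x :: 'a where x: "norm x = 1" "f = cube_cell k x" by auto
    then have i0: "infnorm x > 0" by (auto simp: infnorm_pos_lt)
    obtain b where b: "b \<in> Basis" "\<bar>x \<bullet> b\<bar> = infnorm x" using infnorm_attained by blast
    have ratio: "\<bar>(x \<bullet> b') / infnorm x\<bar> \<le> 1" if "b' \<in> Basis" for b'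
      using Basis_le_infnorm[OF that, of x] i0 by (simp add: abs_divide)
    have rng: "f b' \<in> Z" if "b' \<in> Basis" for b'
    proof -
      define t where "t = (x \<bullet> b') / infnorm x"
      have "\<bar>t\<bar> \<le> 1" using ratio[OF that] by (simp only: t_def)
      then have "- 1 \<le> t" "t \<le> 1" by linarith+
      then have "- (2 ^ k) \<le> 2 ^ k * t" "2 ^ k * t \<le> 2 ^ k"
        using mult_left_mono[of "- 1" t "2 ^ k"] mult_left_mono[of t 1 "2 ^ k"] by auto
      then have "- (2 ^ k) \<le> \<lfloor>2 ^ k * t\<rfloor>" "\<lfloor>2 ^ k * t\<rfloor> \<le> 2 ^ k"
        using floor_mono[of "2 ^ k * t" "2 ^ k"] by (simp_all add: le_floor_iff)
      then show ?thesis using that by (simp add: x(2) cube_cell_def Z_def t_def)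
    qed
    have "(x \<bullet> b) / infnorm x = 1 \<or> (x \<bullet> b) / infnorm x = - 1"
      using b(2) i0 by (auto simp: abs_if field_simps split: if_splits)
    then have "f b = 2 ^ k \<or> f b = - (2 ^ k)"
    proof
      assume "(x \<bullet> b) / infnorm x = 1"
      moreover have "f b = \<lfloor>2 ^ k * ((x \<bullet> b) / infnorm x)\<rfloor>" using b by (simp add: x(2) cube_cell_def)
      ultimately have "f b = \<lfloor>2 ^ k * (1::real)\<rfloor>" by (simp only:)
      also have "\<dots> = 2 ^ k" by (metis floor_of_int mult.right_neutral of_int_numeral of_int_power)
      finally show ?thesis by simp
    next
      assume "(x \<bullet> b) / infnorm x = - 1"
      moreover have "f b = \<lfloor>2 ^ k * ((x \<bullet> b) / infnorm x)\<rfloor>" using b by (simp add: x(2) cube_cell_def)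
      ultimately have "f b = \<lfloor>2 ^ k * (- 1::real)\<rfloor>" by (simp only:)
      also have "2 ^ k * (- 1::real) = of_int (- (2 ^ k))" by simp
      finally show ?thesis by (simp only: floor_of_int) simp
    qed
    moreover have "f \<in> extensional Basis" by (simp add: x(2) cube_cell_def)
    ultimately have "f \<in> T b (2 ^ k) \<or> f \<in> T b (- (2 ^ k))"
      using rng by (auto simp: T_def PiE_def Pi_def)
    then show "f \<in> U" using b by (auto simp: U_def)
  qed
  have cardT: "card (T b e) = (2 ^ (k + 1) + 1) ^ (DIM('a) - 1)" "finite (T b e)" if "b \<in> Basis" for b e
  proof -
    have cZ: "card Z = 2 ^ (k + 1) + 1" by (simp add: Z_def nat_add_distrib nat_mult_distrib nat_power_eq)
    have "card (T b e) = (\<Prod>b'\<in>(Basis::'a set). card (if b' = b then {e} else Z))"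
      unfolding T_def by (rule card_PiE) simp
    also have "\<dots> = (\<Prod>b'\<in>Basis - {b}. card Z)"
      using that by (subst prod.remove[of _ b]) (auto intro!: prod.cong)
    also have "\<dots> = card Z ^ (DIM('a) - 1)" using that by (simp add: card_Diff_singleton)
    finally show "card (T b e) = (2 ^ (k + 1) + 1) ^ (DIM('a) - 1)" by (simp add: cZ)
    show "finite (T b e)" unfolding T_def by (rule finite_PiE) (auto simp: Z_def)
  qed
  have finU: "finite U" unfolding U_def using cardT(2) by auto
  then show "finite (cube_cell k ` sphere (0::'a) 1)" using sub finite_subset by blast
  have "card (cube_cell k ` sphere (0::'a) 1) \<le> card U" by (rule card_mono[OF finU sub])
  also have "\<dots> \<le> (\<Sum>b\<in>(Basis::'a set). card (T b (2 ^ k) \<union> T b (- (2 ^ k))))"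
    unfolding U_def by (rule card_UN_le) simp
  also have "\<dots> \<le> (\<Sum>b\<in>(Basis::'a set). 2 * (2 ^ (k + 1) + 1) ^ (DIM('a) - 1))"
  proof (rule sum_mono)
    fix b :: 'a assume "b \<in> Basis"
    from cardT[OF this] show "card (T b (2 ^ k) \<union> T b (- (2 ^ k))) \<le> 2 * (2 ^ (k + 1) + 1) ^ (DIM('a) - 1)"
      using card_Un_le[of "T b (2 ^ k)" "T b (- (2 ^ k))"] by simp
  qed
  also have "\<dots> = DIM('a) * (2 * (2 ^ (k + 1) + 1) ^ (DIM('a) - 1))" by simp
  also have "\<dots> \<le> DIM('a) * (2 * (3 * 2 ^ k) ^ (DIM('a) - 1))"
    by (intro mult_left_mono power_mono) auto
  finally have "real (card (cube_cell k ` sphere (0::'a) 1)) \<le> real (DIM('a) * (2 * (3 * 2 ^ k) ^ (DIM('a) - 1)))"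
    by (rule of_nat_mono)
  then show "real (card (cube_cell k ` sphere (0::'a) 1)) \<le>
    2 * real DIM('a) * 3 ^ (DIM('a) - 1) * 2 ^ (k * (DIM('a) - 1))"
    by (simp add: power_mult_distrib power_mult mult_ac)
qed

lemma cube_cell_measurable:
  "{x \<in> sphere (0::'a::euclidean_space) 1. cube_cell k x = f} \<in> sets \<sigma>"
proof -
  have [measurable]: "(infnorm :: 'a \<Rightarrow> real) \<in> borel_measurable borel"
    by (intro borel_measurable_continuous_onI continuous_on_infnorm continuous_on_id)
  have "{x \<in> sphere (0::'a) 1. cube_cell k x = f} =
      {x \<in> sphere 0 1. f \<in> extensional Basis \<and> (\<forall>b\<in>Basis. \<lfloor>2 ^ k * ((x \<bullet> b) / infnorm x)\<rfloor> = f b)}"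
    unfolding cube_cell_def by (auto simp: fun_eq_iff restrict_def extensional_def)
  also have "\<dots> = sphere 0 1 \<inter> {x. f \<in> extensional Basis \<and> (\<forall>b\<in>Basis. \<lfloor>2 ^ k * ((x \<bullet> b) / infnorm x)\<rfloor> = f b)}"
    by auto
  also have "\<dots> \<in> sets \<sigma>"
  proof -
    have "{x::'a \<in> space borel. f \<in> extensional Basis \<and> (\<forall>b\<in>Basis. \<lfloor>2 ^ k * ((x \<bullet> b) / infnorm x)\<rfloor> = f b)} \<in> sets borel"
      by measurable
    then show ?thesis by (simp add: sets_surface_measure sets_restrict_space)
  qed
  finally show ?thesis .
qed

lemma norm_sgn_diff_le:
  fixes y y' :: "'a::euclidean_space"
  assumes "norm y \<ge> 1" "norm y' > 0"
  shows "norm (sgn y - sgn y') \<le> 2 * norm (y - y')"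
proof -
  have y: "norm y > 0" using assms by linarith
  have "sgn y - sgn y' = (1 / norm y) *\<^sub>R (y - y') + ((norm y' - norm y) / norm y) *\<^sub>R sgn y'"
    using assms y by (simp add: sgn_div_norm scaleR_diff_right scaleR_diff_left diff_divide_distrib divide_inverse algebra_simps)
  also have "norm \<dots> \<le> norm (y - y') / norm y + \<bar>norm y' - norm y\<bar> / norm y"
    using assms by (intro order_trans[OF norm_triangle_ineq]) (simp add: norm_sgn)
  also have "\<dots> \<le> norm (y - y') / norm y + norm (y - y') / norm y"
    using norm_triangle_ineq3[of y' y] y
    by (intro add_left_mono divide_right_mono) (simp_all add: norm_minus_commute)
  also have "\<dots> \<le> norm (y - y') / 1 + norm (y - y') / 1"
    using assms by (intro add_mono divide_left_mono) auto
  finally show ?thesis by simp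
qed

text \<open>
  The boundary of the cube lies outside the open unit ball, and there the radial projection to the sphere
  is Lipschitz with constant \<open>2\<close>.
\<close>

lemma cube_cell_diameter:
  fixes x x' :: "'a::euclidean_space"
  assumes x: "x \<in> sphere 0 1" and x': "x' \<in> sphere 0 1" and eq: "cube_cell k x = cube_cell k x'"
  shows "norm (x - x') \<le> 2 * real DIM('a) / 2 ^ k"
proof -
  define y where "y = (1 / infnorm x) *\<^sub>R x"
  define y' where "y' = (1 / infnorm x') *\<^sub>R x'"
  have i: "infnorm x > 0" "infnorm x' > 0" using x x' by (auto simp: infnorm_pos_lt)
  have le: "infnorm x \<le> 1" using infnorm_le_norm[of x] x by simp
  have s: "sgn y = x" "sgn y' = x'"
    using i x x' by (simp_all add: y_def y'_def sgn_div_norm)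
  have ny: "norm y \<ge> 1" "norm y' > 0" using i le x x' by (simp_all add: y_def y'_def)
  have "norm (y - y') \<le> (\<Sum>b\<in>Basis. \<bar>(y - y') \<bullet> b\<bar>)" by (rule norm_le_l1)
  also have "\<dots> \<le> (\<Sum>b\<in>(Basis::'a set). 1 / 2 ^ k)"
  proof (rule sum_mono)
    fix b :: 'a assume b: "b \<in> Basis"
    have "\<lfloor>2 ^ k * (y \<bullet> b)\<rfloor> = \<lfloor>2 ^ k * (y' \<bullet> b)\<rfloor>"
      using fun_cong[OF eq, of b] b by (simp add: cube_cell_def y_def y'_def)
    then have "\<bar>2 ^ k * (y \<bullet> b) - 2 ^ k * (y' \<bullet> b)\<bar> \<le> 1" by linarith
    then have "2 ^ k * \<bar>(y - y') \<bullet> b\<bar> \<le> 1"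
      by (simp add: inner_diff_left abs_mult flip: right_diff_distrib)
    then show "\<bar>(y - y') \<bullet> b\<bar> \<le> 1 / 2 ^ k" by (simp add: field_simps)
  qed
  also have "\<dots> = real DIM('a) / 2 ^ k" by simp
  finally show ?thesis using norm_sgn_diff_le[OF ny] unfolding s by simp
qed

text \<open>
  The residual of each step is rounded on the cells of the next coarser level. After step \<open>i\<close> its mass is
  at most the number of cells of level \<open>K + 1 - i\<close>, which also bounds the number of unit densities produced
  in the following step.
\<close>

lemma multiscale_rounding:
  fixes p :: real and N K i :: nat
  defines "D \<equiv> DIM('a::euclidean_space) - 1"
  defines "A \<equiv> 2 * real DIM('a) * 3 ^ D" and "B \<equiv> 2 * real DIM('a)"
  assumes p: "0 < p" and N: "real N \<le> A * 2 ^ ((K + 1) * D)" and i: "i \<le> K + 1"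
  shows "\<exists>ws (\<rho> :: 'a \<Rightarrow> real). (\<forall>w\<in>set ws. unit_density w) \<and> bounded_measurable \<rho> \<and>
    (\<forall>x\<in>sphere 0 1. 0 \<le> \<rho> x \<and> real N = (\<Sum>w\<leftarrow>ws. w x) + \<rho> x) \<and>
    (LINT x|\<sigma>. \<rho> x) \<le> A * 2 ^ ((K + 1 - i) * D) \<and>
    (\<Sum>w\<leftarrow>ws. mutual_energy p w w) \<le>
      (\<Sum>j=K + 1 - i..<K + 1. A * 2 ^ ((j + 1) * D) * (B / 2 ^ j) powr p)"
  using i
proof (induction i)
  case 0
  show ?case using N by (intro exI[of _ "[]"] exI[of _ "\<lambda>_. real N"]) (simp add: bounded_measurable_const)
next
  case (Suc i)
  define j where "j = K - i"
  define G where "G j = A * 2 ^ ((j + 1) * D) * (B / 2 ^ j) powr p" for j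
  have j: "K + 1 - i = j + 1" "K + 1 - Suc i = j" "j < K + 1" using Suc.prems by (auto simp: j_def)
  have "i \<le> K + 1" using Suc.prems by simp
  from Suc.IH[OF this] obtain ws and \<rho> :: "'a \<Rightarrow> real" where IH: "\<And>w. w \<in> set ws \<Longrightarrow> unit_density w" "bounded_measurable \<rho>"
    "\<And>x. x \<in> sphere 0 1 \<Longrightarrow> 0 \<le> \<rho> x" "\<And>x. x \<in> sphere 0 1 \<Longrightarrow> real N = (\<Sum>w\<leftarrow>ws. w x) + \<rho> x"
    "(LINT x|\<sigma>. \<rho> x) \<le> A * 2 ^ ((j + 1) * D)"
    "(\<Sum>w\<leftarrow>ws. mutual_energy p w w) \<le> (\<Sum>j=j + 1..<K + 1. G j)"
    unfolding j(1) G_def[symmetric] by blast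
  obtain vs \<rho>' where st: "\<And>w. w \<in> set vs \<Longrightarrow> unit_density w"
    "\<And>w. w \<in> set vs \<Longrightarrow> mutual_energy p w w \<le> (B / 2 ^ j) powr p"
    "bounded_measurable \<rho>'" "\<And>x. x \<in> sphere 0 1 \<Longrightarrow> 0 \<le> \<rho>' x"
    "\<And>x. x \<in> sphere 0 1 \<Longrightarrow> \<rho> x = (\<Sum>w\<leftarrow>vs. w x) + \<rho>' x"
    "(LINT x|\<sigma>. \<rho>' x) < A * 2 ^ (j * D)" "real (length vs) \<le> (LINT x|\<sigma>. \<rho> x)"
    by (rule rounding_step[OF p IH(2,3) cube_cell_count(1)[of j] cube_cell_count(2)[of j]
          cube_cell_measurable cube_cell_diameter]) (auto simp: A_def B_def D_def)
  have "(\<Sum>w\<leftarrow>vs. mutual_energy p w w) \<le> (\<Sum>w\<leftarrow>vs. (B / 2 ^ j) powr p)"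
    by (intro sum_list_mono st)
  also have "\<dots> = real (length vs) * (B / 2 ^ j) powr p" by (simp add: sum_list_triv)
  also have "\<dots> \<le> A * 2 ^ ((j + 1) * D) * (B / 2 ^ j) powr p"
    using st(7) IH(5) by (intro mult_right_mono) auto
  finally have "(\<Sum>w\<leftarrow>vs. mutual_energy p w w) \<le> G j" by (simp only: G_def)
  moreover have "(\<Sum>j=j..<K + 1. G j) = G j + (\<Sum>j=j + 1..<K + 1. G j)"
    using sum.atLeast_Suc_lessThan[OF j(3), of G] by (simp only: Suc_eq_plus1)
  ultimately have "(\<Sum>w\<leftarrow>ws @ vs. mutual_energy p w w) \<le> (\<Sum>j=j..<K + 1. G j)"
    using IH(6) unfolding map_append sum_list_append by linarith
  then show ?case
    unfolding j(2) G_def[symmetric] using IH(1,4) st by (intro exI[of _ "ws @ vs"] exI[of _ \<rho>']) auto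
qed

text \<open>
  A last rounding step with the whole sphere as the only cell leaves a residual of mass below \<open>1\<close>. Its mass
  is also an integer, namely \<open>N\<close> minus the number of unit densities, hence \<open>0\<close>.
\<close>

lemma uniform_as_unit_densities:
  fixes p :: real and N K :: nat
  defines "D \<equiv> DIM('a::euclidean_space) - 1"
  defines "A \<equiv> 2 * real DIM('a) * 3 ^ D" and "B \<equiv> 2 * real DIM('a)"
  assumes p: "0 < p" and N: "real N \<le> A * 2 ^ ((K + 1) * D)"
  obtains ws where "\<And>w. w \<in> set ws \<Longrightarrow> unit_density (w :: 'a \<Rightarrow> real)" "length ws = N"
    "AE x in \<sigma>. (\<Sum>w\<leftarrow>ws. w x) = real N"
    "(\<Sum>w\<leftarrow>ws. mutual_energy p w w) \<le>
      (\<Sum>j<K + 1. A * 2 ^ ((j + 1) * D) * (B / 2 ^ j) powr p) + A * 2 powr p"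
proof -
  obtain ws and \<rho> :: "'a \<Rightarrow> real" where r: "\<And>w. w \<in> set ws \<Longrightarrow> unit_density w" "bounded_measurable \<rho>"
    "\<And>x. x \<in> sphere 0 1 \<Longrightarrow> 0 \<le> \<rho> x" "\<And>x. x \<in> sphere 0 1 \<Longrightarrow> real N = (\<Sum>w\<leftarrow>ws. w x) + \<rho> x"
    "(LINT x|\<sigma>. \<rho> x) \<le> A"
    "(\<Sum>w\<leftarrow>ws. mutual_energy p w w) \<le> (\<Sum>j<K + 1. A * 2 ^ ((j + 1) * D) * (B / 2 ^ j) powr p)"
    using multiscale_rounding[where 'a='a, OF p N[unfolded A_def D_def] order_refl, folded D_def, folded A_def B_def]
    unfolding diff_self_eq_0 mult_0 power_0 mult_1_right atLeast0LessThan by blast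
  obtain vs \<rho>' where st: "\<And>w. w \<in> set vs \<Longrightarrow> unit_density w"
    "\<And>w. w \<in> set vs \<Longrightarrow> mutual_energy p w w \<le> 2 powr p"
    "bounded_measurable \<rho>'" "\<And>x. x \<in> sphere 0 1 \<Longrightarrow> 0 \<le> \<rho>' x"
    "\<And>x. x \<in> sphere 0 1 \<Longrightarrow> \<rho> x = (\<Sum>w\<leftarrow>vs. w x) + \<rho>' x"
    "(LINT x|\<sigma>. \<rho>' x) < 1" "real (length vs) \<le> (LINT x|\<sigma>. \<rho> x)"
  proof (rule rounding_step[OF p r(2,3), where c = "\<lambda>_. ()" and M = 1 and \<delta> = 2])
    show "{x \<in> sphere (0::'a) 1. () = k} \<in> sets \<sigma>" for k
    proof -
      have "{x \<in> sphere (0::'a) 1. () = k} = space \<sigma>" by auto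
      then show ?thesis by (simp only: sets.top)
    qed
    show "norm (x - y) \<le> 2" if "x \<in> sphere 0 1" "y \<in> sphere 0 1" for x y :: 'a
      using norm_triangle_ineq4[of x y] that by simp
    have "(\<lambda>_::'a. ()) ` sphere 0 1 \<subseteq> {()}" by auto
    then show "real (card ((\<lambda>_::'a. ()) ` sphere 0 1)) \<le> 1"
      using card_mono[of "{()}" "(\<lambda>_::'a. ()) ` sphere 0 1"] by simp
  qed auto
  define us where "us = ws @ vs"
  have us: "\<And>w. w \<in> set us \<Longrightarrow> unit_density w" using r st by (auto simp: us_def)
  have tot: "real N = (\<Sum>w\<leftarrow>us. w x) + \<rho>' x" if "x \<in> sphere 0 1" for x
    using r(4)[OF that] st(5)[OF that] by (simp add: us_def)
  have intl: "integrable \<sigma> (\<lambda>x. (\<Sum>w\<leftarrow>us. w x)) \<and> (LINT x|\<sigma>. (\<Sum>w\<leftarrow>us. w x)) = real (length us)"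
    using us
  proof (induction us)
    case (Cons w us)
    then have "integrable \<sigma> w" "(LINT x|\<sigma>. w x) = 1"
      by (auto simp: unit_density_def bounded_measurable_integrable)
    with Cons show ?case by simp
  qed simp
  have "real N = (LINT x|(\<sigma>::'a measure). real N)" by simp
  also have "\<dots> = (LINT x|\<sigma>. (\<Sum>w\<leftarrow>us. w x) + \<rho>' x)"
    using tot by (intro Bochner_Integration.integral_cong) auto
  also have "\<dots> = real (length us) + (LINT x|\<sigma>. \<rho>' x)"
    using intl bounded_measurable_integrable[OF st(3)] by simp
  finally have eq: "real N = real (length us) + (LINT x|\<sigma>. \<rho>' x)" .
  have "(LINT x|\<sigma>. \<rho>' x) \<ge> 0" using st(4) by (intro Bochner_Integration.integral_nonneg_AE AE_I2) auto
  with eq st(6) have len: "length us = N" by linarith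
  with eq have "(LINT x|\<sigma>. \<rho>' x) = 0" by simp
  moreover have "AE x in \<sigma>. 0 \<le> \<rho>' x" using st(4) by (intro AE_I2) auto
  ultimately have "AE x in \<sigma>. \<rho>' x = 0"
    using integral_nonneg_eq_0_iff_AE[OF bounded_measurable_integrable[OF st(3)]] by simp
  with AE_space have ae: "AE x in \<sigma>. (\<Sum>w\<leftarrow>us. w x) = real N"
  proof eventually_elim
    case (elim x)
    then show ?case using tot[of x] by simp
  qed
  have "(\<Sum>w\<leftarrow>vs. mutual_energy p w w) \<le> (\<Sum>w\<leftarrow>vs. 2 powr p)" by (intro sum_list_mono st)
  also have "\<dots> = real (length vs) * 2 powr p" by (simp add: sum_list_triv)
  also have "\<dots> \<le> A * 2 powr p" using st(7) r(5) by (intro mult_right_mono) auto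
  finally show ?thesis using r(6) us len ae by (intro that[of us]) (auto simp: us_def)
qed

lemma mean_power_distance_eq:
  assumes p: "0 < p" and ws: "\<And>w. w \<in> set ws \<Longrightarrow> unit_density (w :: 'a::euclidean_space \<Rightarrow> real)"
    and ae: "AE x in \<sigma>. (\<Sum>w\<leftarrow>ws. w x) = real N"
  shows "(real N)\<^sup>2 * mean_power_distance p TYPE('a) = offdiagonal_energy p ws + (\<Sum>w\<leftarrow>ws. mutual_energy p w w)"
proof -
  define f where "f = (\<lambda>x. \<Sum>w\<leftarrow>ws. w x)"
  have bw: "bounded_measurable w" if "w \<in> set ws" for w using ws[OF that] by (simp add: unit_density_def)
  have f: "bounded_measurable f" unfolding f_def by (intro bounded_measurable_sum_list bw)
  have ae: "AE x in \<sigma>. f x = real N" using ae by (simp add: f_def)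
  have pot: "potential p f x = real N * (LINT z|\<sigma>. norm (x - z) powr p)" for x
  proof -
    have "potential p f x = (LINT z|\<sigma>. real N * norm (x - z) powr p)"
      unfolding potential_def
    proof (rule integral_cong_AE)
      show "AE z in \<sigma>. norm (x - z) powr p * f z = real N * norm (x - z) powr p"
        using ae by eventually_elim simp
      show "(\<lambda>z. norm (x - z) powr p * f z) \<in> borel_measurable \<sigma>"
        using bounded_measurable_mult[OF bounded_measurable_dist[OF p, of x] f] by (simp add: bounded_measurable_def)
      show "(\<lambda>z. real N * norm (x - z) powr p) \<in> borel_measurable \<sigma>"
        using bounded_measurable_mult[OF bounded_measurable_const bounded_measurable_dist[OF p, of x]]
        by (simp add: bounded_measurable_def)
    qed
    then show ?thesis by simp
  qed
  have "mutual_energy p f f = (LINT x|\<sigma>. real N * potential p f x)"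
    unfolding mutual_energy_def
  proof (rule integral_cong_AE)
    show "AE x in \<sigma>. f x * potential p f x = real N * potential p f x"
      using ae by eventually_elim simp
    show "(\<lambda>x. f x * potential p f x) \<in> borel_measurable \<sigma>"
      using bounded_measurable_mult[OF f bounded_measurable_potential[OF p f]] by (simp add: bounded_measurable_def)
    show "(\<lambda>x. real N * potential p f x) \<in> borel_measurable \<sigma>"
      using bounded_measurable_mult[OF bounded_measurable_const bounded_measurable_potential[OF p f]]
      by (simp add: bounded_measurable_def)
  qed
  also have "\<dots> = (real N)\<^sup>2 * mean_power_distance p TYPE('a)"
    by (simp add: pot mean_power_distance_def power2_eq_square)
  finally show ?thesis using mutual_energy_sum_list[OF p bw] by (simp add: f_def)
qed

text \<open>
  The finest level \<open>K\<close> is chosen with \<open>2\<close> to the power \<open>K d\<close> of order \<open>N\<close>. The cells of level \<open>j\<close> account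
  for self-energies of order \<open>\<theta>\<^sup>j\<close> with \<open>\<theta>\<close> equal to \<open>2\<close> to the power \<open>d - p\<close>; as \<open>p < d\<close>, the finest level
  dominates and contributes the order of \<open>N\<close> to the power \<open>1 - p / d\<close>.
\<close>

theorem exists_small_energy_gap:
  fixes p :: real
  assumes dim: "DIM('a::euclidean_space) = d + 1" and d: "d \<ge> 2" and p: "0 < p" "p < real d"
  obtains C where "C > 0" "\<And>N. N \<ge> 1 \<Longrightarrow> \<exists>X :: 'a set. point_set N X \<and>
    (real N)\<^sup>2 * mean_power_distance p TYPE('a) - distance_sum p X \<le> C * real N powr (1 - p / real d)"
proof -
  define A where "A = 2 * real DIM('a) * 3 ^ d"
  define B where "B = 2 * real DIM('a)"
  define \<theta> where "\<theta> = 2 powr (real d - p)"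
  have A: "A \<ge> 1"
  proof -
    have "1 * 1 \<le> (2 * real DIM('a)) * 3 ^ d" by (rule mult_mono) (use dim in auto)
    then show ?thesis by (simp add: A_def)
  qed
  have \<theta>: "\<theta> > 1" using p by (simp add: \<theta>_def)
  \<comment> \<open>The sum of the geometric series up to level \<open>K\<close>, and the cost of the last rounding step.\<close>
  define C where "C = A * 2 ^ d * B powr p * \<theta> / (\<theta> - 1) + A * 2 powr p"
  have BC: "A * 2 ^ d * B powr p * \<theta> / (\<theta> - 1) \<ge> 0" using A \<theta> by simp
  have C: "C > 0" unfolding C_def using BC A by (intro add_nonneg_pos) auto
  show ?thesis
  proof (rule that[OF C])
    fix N :: nat assume N: "N \<ge> 1"
    have "(2::nat) ^ d > 1" using d by (intro one_less_power) auto
    then obtain K where K: "(2 ^ d) ^ K \<le> N" "N < (2 ^ d) ^ (K + 1)"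
      using ex_power_ivl1[of "2 ^ d" N] N by auto
    have NA: "real N \<le> A * 2 ^ ((K + 1) * d)"
    proof -
      have "real N \<le> real ((2 ^ d) ^ (K + 1))" using K by (intro of_nat_mono) simp
      also have "\<dots> = 1 * 2 ^ ((K + 1) * d)" by (simp add: power_mult mult.commute flip: power_add power_mult)
      also have "\<dots> \<le> A * 2 ^ ((K + 1) * d)" using A by (intro mult_right_mono) auto
      finally show ?thesis .
    qed
    have dd: "DIM('a) - 1 = d" using dim by simp
    obtain ws where ws: "\<And>w. w \<in> set ws \<Longrightarrow> unit_density (w :: 'a \<Rightarrow> real)" "length ws = N"
      "AE x in \<sigma>. (\<Sum>w\<leftarrow>ws. w x) = real N"
      "(\<Sum>w\<leftarrow>ws. mutual_energy p w w) \<le>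
        (\<Sum>j<K + 1. A * 2 ^ ((j + 1) * d) * (B / 2 ^ j) powr p) + A * 2 powr p"
      using uniform_as_unit_densities[where 'a='a, unfolded dd, OF p(1) NA[unfolded A_def]]
      unfolding A_def B_def by blast
    have N1: "real N powr (1 - p / real d) \<ge> 1"
      using N p d by (intro ge_one_powr_ge_zero) (auto simp: field_simps)
    have \<theta>K: "\<theta> ^ K \<le> real N powr (1 - p / real d)"
    proof -
      have "\<theta> ^ K = (2 powr (real d * real K)) powr (1 - p / real d)"
      proof -
        have "\<theta> ^ K = \<theta> powr real K" using \<theta> by (simp add: powr_realpow)
        also have "\<dots> = 2 powr ((real d - p) * real K)" by (simp add: \<theta>_def powr_powr)
        also have "(real d - p) * real K = (real d * real K) * (1 - p / real d)"
          using d by (simp add: field_simps)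
        also have "2 powr \<dots> = (2 powr (real d * real K)) powr (1 - p / real d)" by (rule powr_powr[symmetric])
        finally show ?thesis .
      qed
      also have "2 powr (real d * real K) = real ((2 ^ d) ^ K)"
        using powr_realpow[of 2 "d * K"] by (simp add: power_mult)
      also have "\<dots> powr (1 - p / real d) \<le> real N powr (1 - p / real d)"
        using K(1) p d by (intro powr_mono2 of_nat_mono) (auto simp: field_simps)
      finally show ?thesis .
    qed
    have "(\<Sum>j<K + 1. A * 2 ^ ((j + 1) * d) * (B / 2 ^ j) powr p) = (\<Sum>j<K + 1. A * 2 ^ d * B powr p * \<theta> ^ j)"
    proof (intro sum.cong refl)
      fix j :: nat
      have e1: "(2::real) ^ (j * d) / (2 ^ j) powr p = \<theta> ^ j"
      proof -
        have "(2::real) ^ (j * d) = 2 powr (real j * real d)"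
          using powr_realpow[of "2::real" "j * d"] by simp
        moreover have "((2::real) ^ j) powr p = 2 powr (real j * p)"
          using powr_realpow[of "2::real" j] by (metis powr_powr zero_less_numeral)
        moreover have "\<theta> ^ j = 2 powr (real j * (real d - p))"
          using powr_realpow[of \<theta> j] \<theta> by (simp add: \<theta>_def powr_powr mult.commute)
        ultimately show ?thesis by (simp add: powr_diff right_diff_distrib)
      qed
      have e2: "(B / 2 ^ j) powr p = B powr p / (2 ^ j) powr p"
        by (simp add: powr_divide B_def)
      have e3: "(2::real) ^ ((j + 1) * d) = 2 ^ d * 2 ^ (j * d)" by (simp add: power_add)
      show "A * 2 ^ ((j + 1) * d) * (B / 2 ^ j) powr p = A * 2 ^ d * B powr p * \<theta> ^ j"
        unfolding e2 e3 e1[symmetric] by (simp add: mult_ac)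
    qed
    also have "\<dots> = A * 2 ^ d * B powr p * ((\<theta> ^ (K + 1) - 1) / (\<theta> - 1))"
      unfolding sum_distrib_left[symmetric] using \<theta> by (subst geometric_sum) auto
    also have "\<dots> \<le> A * 2 ^ d * B powr p * (\<theta> * real N powr (1 - p / real d) / (\<theta> - 1))"
    proof (intro mult_left_mono divide_right_mono)
      show "\<theta> ^ (K + 1) - 1 \<le> \<theta> * real N powr (1 - p / real d)"
      proof -
        have "\<theta> * \<theta> ^ K \<le> \<theta> * real N powr (1 - p / real d)"
          by (rule mult_left_mono[OF \<theta>K]) (use \<theta> in simp)
        moreover have "\<theta> ^ (K + 1) = \<theta> * \<theta> ^ K" by simp
        ultimately show ?thesis by linarith
      qed
    qed (use A \<theta> in auto)
    also have "\<dots> = A * 2 ^ d * B powr p * \<theta> / (\<theta> - 1) * real N powr (1 - p / real d)" by simp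
    finally have "(\<Sum>w\<leftarrow>ws. mutual_energy p w w) \<le>
        A * 2 ^ d * B powr p * \<theta> / (\<theta> - 1) * real N powr (1 - p / real d) + A * 2 powr p * 1"
      using ws(4) by simp
    also have "\<dots> \<le> C * real N powr (1 - p / real d)"
      unfolding C_def distrib_right using N1 A by (intro add_left_mono mult_left_mono) auto
    finally have cost: "(\<Sum>w\<leftarrow>ws. mutual_energy p w w) \<le> C * real N powr (1 - p / real d)" .
    have "DIM('a) \<ge> 2" using dim d by simp
    then obtain X :: "'a set" where X: "finite X" "X \<subseteq> sphere 0 1" "card X = N" "distance_sum p X \<ge> offdiagonal_energy p ws"
      using exists_points_ge_mean[where F = "{}" and ws = ws and p = p] ws(1,2) p
      by (auto simp: distance_sum_def)
    show "\<exists>X :: 'a set. point_set N X \<and>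
        (real N)\<^sup>2 * mean_power_distance p TYPE('a) - distance_sum p X \<le> C * real N powr (1 - p / real d)"
      using X cost mean_power_distance_eq[OF p(1) ws(1,3)]
      by (intro exI[of _ X]) (auto simp: point_set_def)
  qed
qed

theorem theorem16:
  fixes d :: nat and s :: real
    and a :: "nat \<Rightarrow> real"
    and Y :: "nat \<Rightarrow> nat \<Rightarrow> 'a::euclidean_space \<Rightarrow> real"
    and X :: "nat \<Rightarrow> 'a set"
  assumes "DIM('a) = d + 1" and "d \<ge> 2"
    and "real d / 2 < s" and "s < real d / 2 + 1"
    and "orthonormal_harmonics d Y"
    and "\<And>l. a l > 0"
    and "comparable a (\<lambda>l. (1 + eigval d l) powr (- s))"
    and "\<And>N. N \<ge> 2 \<Longrightarrow> maximizes_distance_sum (2 * s - real d) N (X N)"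
  shows "QMC_designs d s a Y {2..} X"
proof -
  interpret sobolev_setting d Y s
    using assms(1-5) by unfold_locales
  define p where "p = 2 * s - real d"
  have p: "0 < p" "p < real d" using assms(2-4) by (auto simp: p_def)
  obtain C where C: "C > 0" "\<And>Z f. finite Z \<Longrightarrow> Z \<noteq> {} \<Longrightarrow> Z \<subseteq> sphere (0::'a) 1 \<Longrightarrow>
      f \<in> sobolev_space d s Y \<Longrightarrow> sobolev_norm d a Y f \<le> 1 \<Longrightarrow> (quad_err Z f)\<^sup>2 \<le> C * energy_gap p Z"
    using quad_err_le_energy_gap[OF assms(6,7)] unfolding p_def by blast
  obtain C' where C': "C' > 0" "\<And>N. N \<ge> 1 \<Longrightarrow> \<exists>Z :: 'a set. point_set N Z \<and>
      (real N)\<^sup>2 * mean_power_distance p TYPE('a) - distance_sum p Z \<le> C' * real N powr (1 - p / real d)"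
    using exists_small_energy_gap[OF assms(1,2) p] by blast
  have pts: "point_set N (X N)" if "N \<ge> 2" for N
    using assms(8)[OF that] by (simp add: maximizes_distance_sum_def)
  have gap: "energy_gap p (X N) \<le> C' * real N powr (- 2 * s / real d)" if N: "N \<ge> 2" for N
  proof -
    have N0: "real N > 0" using N by simp
    obtain Z :: "'a set" where Z: "point_set N Z"
      "(real N)\<^sup>2 * mean_power_distance p TYPE('a) - distance_sum p Z \<le> C' * real N powr (1 - p / real d)"
      using C'(2)[of N] N by auto
    have "distance_sum p Z \<le> distance_sum p (X N)"
      using assms(8)[OF N] Z(1) by (simp add: maximizes_distance_sum_def p_def)
    then have "(real N)\<^sup>2 * mean_power_distance p TYPE('a) - distance_sum p (X N) \<le> C' * real N powr (1 - p / real d)"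
      using Z(2) by linarith
    moreover have "(real N)\<^sup>2 * energy_gap p (X N) =
        (real N)\<^sup>2 * mean_power_distance p TYPE('a) - distance_sum p (X N)"
      using pts[OF N] N0 by (simp add: energy_gap_def point_set_def right_diff_distrib)
    moreover have "real N powr (1 - p / real d) = (real N)\<^sup>2 * real N powr (- 2 * s / real d)"
    proof -
      have e: "1 - p / real d = 2 + (- 2 * s / real d)" using assms(2) by (simp add: p_def field_simps)
      show ?thesis unfolding e powr_add using N0 by simp
    qed
    ultimately have "(real N)\<^sup>2 * energy_gap p (X N) \<le> (real N)\<^sup>2 * (C' * real N powr (- 2 * s / real d))"
      by (simp only: mult.left_commute)
    then show ?thesis using N0 by simp
  qed
  define c where "c = sqrt (C * C')"
  have c: "c > 0" using C C' by (simp add: c_def)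
  have "worst_case_error d s a Y (X N) \<le> ereal (c / real N powr (s / real d))" if N: "N \<ge> 2" for N
    unfolding worst_case_error_def
  proof (rule SUP_least)
    fix f assume "f \<in> {f \<in> sobolev_space d s Y. sobolev_norm d a Y f \<le> 1}"
    then have f: "f \<in> sobolev_space d s Y" "sobolev_norm d a Y f \<le> 1" by auto
    have XN: "finite (X N)" "X N \<noteq> {}" "X N \<subseteq> sphere 0 1"
      using pts[OF N] N by (auto simp: point_set_def)
    have "(quad_err (X N) f)\<^sup>2 \<le> C * energy_gap p (X N)" by (rule C(2)[OF XN f])
    also have "\<dots> \<le> C * (C' * real N powr (- 2 * s / real d))"
      using gap[OF N] C by (intro mult_left_mono) auto
    also have "\<dots> = (c / real N powr (s / real d))\<^sup>2"
    proof -
      have 1: "c\<^sup>2 = C * C'" using C C' by (simp add: c_def)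
      have 2: "(real N powr (s / real d))\<^sup>2 = real N powr (2 * s / real d)"
        by (simp add: power2_eq_square flip: powr_add)
      have 3: "- 2 * s / real d = - (2 * s / real d)" by simp
      show ?thesis unfolding power_divide 1 2 3 powr_minus by (simp add: divide_inverse)
    qed
    finally have "\<bar>quad_err (X N) f\<bar> \<le> c / real N powr (s / real d)"
      using c by (intro power2_le_imp_le[of "\<bar>_\<bar>", unfolded power2_abs]) auto
    then show "ereal \<bar>1 / real (card (X N)) * (\<Sum>x\<in>X N. f x) - (LINT x|\<sigma>. f x)\<bar>
        \<le> ereal (c / real N powr (s / real d))"
      by (simp add: quad_err_def)
  qed
  then show ?thesis
    unfolding QMC_designs_def using pts c by (intro conjI exI[of _ c]) auto
qed

end
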